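(* Let $\pi$ be a (possibly empty) set of prime numbers. Let $N$ be a $\pi$-divisible torsion-free nilpotent group of finite rank, and let $\sigma$ be a $\pi$-like endomorphism of $N$ such that $\det \sigma|_{Z(N)}$ is a $\pi$-unit. Then $\sigma\in\mathrm{Aut}(N)$.
   Context: Rank means Prüfer rank. A group $N$ is $\pi$-divisible if every element of $N$ has a $p$-th root in $N$ for every $p\in\pi$. A $\pi$-number is a rational integer all of whose prime divisors lie in $\pi$; $\mathbb{Z}[1/\pi]=\{m/n : m\in\mathbb{Z},\ n \text{ a non-zero } \pi\text{-number}\}$; a $\pi$-unit is a unit of the ring $\mathbb{Z}[1/\pi]$. (For $\pi=\emptyset$ one has $\mathbb{Z}[1/\pi]=\mathbb{Z}$, and $\pi$-divisibility is no condition.) $\pi$-like: Let $V$ be a rational vector space of finite dimension $n$ and $\nu$ an automorphism of $V$. Then $\nu$ is $\pi$-like if one of the following equivalent conditions holds: (i) the coefficients of the characteristic polynomial of $\nu$ lie in $\mathbb{Z}[1/\pi]$; (ii) there is a subgroup $W\leqslant V$ with $W\cong\mathbb{Z}[1/\pi]^n$ and $\nu(W)\leqslant W$. An injective endomorphism $\sigma$ of a torsion-free nilpotent group $N$ of finite rank is $\pi$-like if the automorphism it induces on the rational Lie algebra associated with $N$ (the Lie algebra, via the Mal'cev correspondence, of the rational Mal'cev completion of $N$) is $\pi$-like. In particular, a $\pi$-like endomorphism is injective by definition. $Z(N)$ is the centre of $N$. An injective endomorphism $\sigma$ of such an $N$ satisfies $\sigma(Z(N))\leqslant Z(N)$, and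 $\det\sigma|_{Z(N)}$ denotes the determinant of the $\mathbb{Q}$-linear map induced by $\sigma$ on $Z(N)\otimes_{\mathbb{Z}}\mathbb{Q}$. *)

theory Defs
  imports
    "HOL-Algebra.Free_Abelian_Groups"
    "Jordan_Normal_Form.VS_Connect"
    "Jordan_Normal_Form.Char_Poly"
begin

section \<open>Groups\<close>

definition torsion_free_group :: "('a, 'b) monoid_scheme \<Rightarrow> bool" where
  "torsion_free_group G \<longleftrightarrow> group G \<and>
     (\<forall>x \<in> carrier G. \<forall>n::nat. n > 0 \<longrightarrow> x [^]\<^bsub>G\<^esub> n = \<one>\<^bsub>G\<^esub> \<longrightarrow> x = \<one>\<^bsub>G\<^esub>)"

definition centre :: "('a, 'b) monoid_scheme \<Rightarrow> 'a set" where
  "centre G = {z \<in> carrier G. \<forall>x \<in> carrier G. z \<otimes>\<^bsub>G\<^esub> x = x \<otimes>\<^bsub>G\<^esub> z}"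

primrec upper_central :: "('a, 'b) monoid_scheme \<Rightarrow> nat \<Rightarrow> 'a set" where
  "upper_central G 0 = {\<one>\<^bsub>G\<^esub>}"
| "upper_central G (Suc i) = {x \<in> carrier G. \<forall>y \<in> carrier G.
     x \<otimes>\<^bsub>G\<^esub> y \<otimes>\<^bsub>G\<^esub> inv\<^bsub>G\<^esub> x \<otimes>\<^bsub>G\<^esub> inv\<^bsub>G\<^esub> y \<in> upper_central G i}"

definition nilpotent_group :: "('a, 'b) monoid_scheme \<Rightarrow> bool" where
  "nilpotent_group G \<longleftrightarrow> group G \<and> (\<exists>c. upper_central G c = carrier G)"

definition finite_pruefer_rank :: "('a, 'b) monoid_scheme \<Rightarrow> bool" where
  "finite_pruefer_rank G \<longleftrightarrow> (\<exists>r::nat. \<forall>S. finite S \<and> S \<subseteq> carrier G \<longrightarrow>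
     (\<exists>T. finite T \<and> T \<subseteq> carrier G \<and> card T \<le> r \<and> generate G T = generate G S))"

definition pi_divisible :: "nat set \<Rightarrow> ('a, 'b) monoid_scheme \<Rightarrow> bool" where
  "pi_divisible \<pi> G \<longleftrightarrow> (\<forall>p \<in> \<pi>. \<forall>x \<in> carrier G. \<exists>y \<in> carrier G. y [^]\<^bsub>G\<^esub> p = x)"


section \<open>The ring \<open>\<int>[1/\<pi>]\<close>\<close>

definition pi_number :: "nat set \<Rightarrow> int \<Rightarrow> bool" where
  "pi_number \<pi> n \<longleftrightarrow> (\<forall>p::nat. prime p \<and> int p dvd n \<longrightarrow> p \<in> \<pi>)"

definition Z_inv :: "nat set \<Rightarrow> rat set" where
  "Z_inv \<pi> = {of_int m / of_int n | m n. n \<noteq> 0 \<and> pi_number \<pi> n}"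

definition pi_unit :: "nat set \<Rightarrow> rat \<Rightarrow> bool" where
  "pi_unit \<pi> q \<longleftrightarrow> q \<in> Z_inv \<pi> \<and> (\<exists>r \<in> Z_inv \<pi>. q * r = 1)"


section \<open>Determinant and characteristic polynomial over the rationals\<close>

text \<open>\<open>A\<close> is the matrix of \<open>f\<close> with respect to the ordered basis \<open>bs\<close> (coordinates of the
  images are the columns).\<close>

definition represents ::
  "(rat, 'v, 'z) module_scheme \<Rightarrow> ('v \<Rightarrow> 'v) \<Rightarrow> 'v list \<Rightarrow> rat mat \<Rightarrow> bool" where
  "represents V f bs A \<longleftrightarrow>
     distinct bs \<and> vectorspace.basis class_ring V (set bs) \<and>
     A \<in> carrier_mat (length bs) (length bs) \<and>
     (\<forall>j < length bs. f (bs ! j) = (\<Oplus>\<^bsub>V\<^esub> i \<in> {..<length bs}. A $$ (i, j) \<odot>\<^bsub>V\<^esub> (bs ! i)))"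

text \<open>Determinant and characteristic polynomial do not depend on the chosen basis. Both are
  meaningful for linear endomorphisms of finite-dimensional spaces only.\<close>

definition lin_det :: "(rat, 'v, 'z) module_scheme \<Rightarrow> ('v \<Rightarrow> 'v) \<Rightarrow> rat" where
  "lin_det V f = det (SOME A. \<exists>bs. represents V f bs A)"

definition lin_char_poly :: "(rat, 'v, 'z) module_scheme \<Rightarrow> ('v \<Rightarrow> 'v) \<Rightarrow> rat poly" where
  "lin_char_poly V f = char_poly (SOME A. \<exists>bs. represents V f bs A)"

definition pi_like_automorphism ::
  "nat set \<Rightarrow> (rat, 'v, 'z) module_scheme \<Rightarrow> ('v \<Rightarrow> 'v) \<Rightarrow> bool" where
  "pi_like_automorphism \<pi> V \<nu> \<longleftrightarrow>
     vectorspace class_ring V \<and> vectorspace.fin_dim class_ring V \<and>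
     \<nu> \<in> LinearCombinations.module_hom class_ring V V \<and> bij_betw \<nu> (carrier V) (carrier V) \<and>
     (\<forall>i. coeff (lin_char_poly V \<nu>) i \<in> Z_inv \<pi>)"


section \<open>The tensor product of an abelian group with the rationals\<close>

text \<open>For a (multiplicatively written) abelian group \<open>A\<close>, the tensor product with \<open>\<rat>\<close> over \<open>\<int>\<close>
  is the free abelian group on the symbols \<open>(a, q)\<close> modulo the biadditivity relations; its elements
  are cosets.\<close>

definition tensor_symbols :: "('a, 'b) monoid_scheme \<Rightarrow> ('a \<times> rat \<Rightarrow>\<^sub>0 int) monoid" where
  "tensor_symbols A = free_Abelian_group (carrier A \<times> UNIV)"

definition tensor_relations :: "('a, 'b) monoid_scheme \<Rightarrow> ('a \<times> rat \<Rightarrow>\<^sub>0 int) set" where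
  "tensor_relations A = generate (tensor_symbols A)
     ({frag_of (a \<otimes>\<^bsub>A\<^esub> b, q) - frag_of (a, q) - frag_of (b, q) | a b q.
         a \<in> carrier A \<and> b \<in> carrier A} \<union>
      {frag_of (a, q + r) - frag_of (a, q) - frag_of (a, r) | a q r. a \<in> carrier A})"

text \<open>The map of cosets induced by \<open>(a, q) \<mapsto> h (a, q)\<close> on symbols.\<close>

definition tensor_induced :: "('a, 'b) monoid_scheme \<Rightarrow> ('a \<times> rat \<Rightarrow> 'a \<times> rat) \<Rightarrow>
    ('a \<times> rat \<Rightarrow>\<^sub>0 int) set \<Rightarrow> ('a \<times> rat \<Rightarrow>\<^sub>0 int) set" where
  "tensor_induced A h X =
     tensor_relations A <#>\<^bsub>tensor_symbols A\<^esub> (frag_extend (\<lambda>s. frag_of (h s)) ` X)"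

text \<open>The ring multiplication slots of the module record play no role.\<close>

definition tensor_rat :: "('a, 'b) monoid_scheme \<Rightarrow> (rat, ('a \<times> rat \<Rightarrow>\<^sub>0 int) set) module" where
  "tensor_rat A = (let T = tensor_symbols A Mod tensor_relations A in
     \<lparr>carrier = carrier T, monoid.mult = (\<lambda>_ _. undefined), one = undefined,
      zero = \<one>\<^bsub>T\<^esub>, add = (\<otimes>\<^bsub>T\<^esub>),
      module.smult = (\<lambda>q. tensor_induced A (\<lambda>(a, r). (a, q * r)))\<rparr>)"

definition tensor_rat_map :: "('a, 'b) monoid_scheme \<Rightarrow> ('a \<Rightarrow> 'a) \<Rightarrow>
    ('a \<times> rat \<Rightarrow>\<^sub>0 int) set \<Rightarrow> ('a \<times> rat \<Rightarrow>\<^sub>0 int) set" where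
  "tensor_rat_map A f = tensor_induced A (\<lambda>(a, r). (f a, r))"

definition det_on_centre :: "('a, 'b) monoid_scheme \<Rightarrow> ('a \<Rightarrow> 'a) \<Rightarrow> rat" where
  "det_on_centre N \<sigma> =
     (let Z = N\<lparr>carrier := centre N\<rparr> in lin_det (tensor_rat Z) (tensor_rat_map Z \<sigma>))"


section \<open>Nilpotent rational Lie algebras and the Mal'cev correspondence\<close>

record ('k, 'v) lie_algebra = "('k, 'v) module" +
  lie_bracket :: "'v \<Rightarrow> 'v \<Rightarrow> 'v"  (\<open>(\<open>indent=1 notation=\<open>mixfix lie bracket\<close>\<close>\<lbrakk>_,/ _\<rbrakk>\<index>)\<close>)

locale rational_lie_algebra = vectorspace class_ring L
  for L :: "(rat, 'v, 'z) lie_algebra_scheme" (structure) +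
  assumes bracket_closed:
      "x \<in> carrier L \<Longrightarrow> y \<in> carrier L \<Longrightarrow> \<lbrakk>x, y\<rbrakk> \<in> carrier L"
    and bracket_add_left:
      "x \<in> carrier L \<Longrightarrow> y \<in> carrier L \<Longrightarrow> z \<in> carrier L \<Longrightarrow>
        \<lbrakk>x \<oplus> y, z\<rbrakk> = \<lbrakk>x, z\<rbrakk> \<oplus> \<lbrakk>y, z\<rbrakk>"
    and bracket_add_right:
      "x \<in> carrier L \<Longrightarrow> y \<in> carrier L \<Longrightarrow> z \<in> carrier L \<Longrightarrow>
        \<lbrakk>x, y \<oplus> z\<rbrakk> = \<lbrakk>x, y\<rbrakk> \<oplus> \<lbrakk>x, z\<rbrakk>"
    and bracket_smult_left:
      "x \<in> carrier L \<Longrightarrow> y \<in> carrier L \<Longrightarrow> \<lbrakk>q \<odot> x, y\<rbrakk> = q \<odot> \<lbrakk>x, y\<rbrakk>"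
    and bracket_smult_right:
      "x \<in> carrier L \<Longrightarrow> y \<in> carrier L \<Longrightarrow> \<lbrakk>x, q \<odot> y\<rbrakk> = q \<odot> \<lbrakk>x, y\<rbrakk>"
    and bracket_self:
      "x \<in> carrier L \<Longrightarrow> \<lbrakk>x, x\<rbrakk> = \<zero>"
    and jacobi:
      "x \<in> carrier L \<Longrightarrow> y \<in> carrier L \<Longrightarrow> z \<in> carrier L \<Longrightarrow>
        \<lbrakk>x, \<lbrakk>y, z\<rbrakk>\<rbrakk> \<oplus> \<lbrakk>y, \<lbrakk>z, x\<rbrakk>\<rbrakk> \<oplus> \<lbrakk>z, \<lbrakk>x, y\<rbrakk>\<rbrakk> = \<zero>"

text \<open>The right-normed product \<open>[x\<^sub>1, [x\<^sub>2, \<dots> [x\<^sub>n\<^sub>-\<^sub>1, x\<^sub>n] \<dots>]]\<close>.\<close>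

fun right_normed :: "('k, 'v, 'z) lie_algebra_scheme \<Rightarrow> 'v list \<Rightarrow> 'v" where
  "right_normed L [] = \<zero>\<^bsub>L\<^esub>"
| "right_normed L [x] = x"
| "right_normed L (x # y # zs) = \<lbrakk>x, right_normed L (y # zs)\<rbrakk>\<^bsub>L\<^esub>"

text \<open>The right-normed products of \<open>c + 1\<close> elements span the \<open>(c + 1)\<close>-st term of the lower central
  series.\<close>

definition lie_nilpotent_class_le :: "('k, 'v, 'z) lie_algebra_scheme \<Rightarrow> nat \<Rightarrow> bool" where
  "lie_nilpotent_class_le L c \<longleftrightarrow>
     (\<forall>xs. set xs \<subseteq> carrier L \<and> length xs = Suc c \<longrightarrow> right_normed L xs = \<zero>\<^bsub>L\<^esub>)"

text \<open>Dynkin's form of the Baker-Campbell-Hausdorff series \<open>log (exp X exp Y)\<close>: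
  the sum over all nonempty sequences \<open>(r\<^sub>1, s\<^sub>1), \<dots>, (r\<^sub>k, s\<^sub>k)\<close> with \<open>r\<^sub>i + s\<^sub>i > 0\<close> of
  \<open>(-1)\<^sup>k\<^sup>-\<^sup>1 / (k n \<Prod> r\<^sub>i! s\<^sub>i!)\<close> times the right-normed product of the word
  \<open>X\<^sup>r\<^sup>1 Y\<^sup>s\<^sup>1 \<dots> X\<^sup>r\<^sup>k Y\<^sup>s\<^sup>k\<close> of length \<open>n = \<Sum> (r\<^sub>i + s\<^sub>i)\<close>. It is truncated at \<open>n \<le> c\<close>, which loses
  nothing if the Lie algebra has class at most \<open>c\<close>.\<close>

definition dynkin_weight :: "(nat \<times> nat) list \<Rightarrow> nat" where
  "dynkin_weight rs = (\<Sum>(r, s) \<leftarrow> rs. r + s)"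

definition dynkin_indices :: "nat \<Rightarrow> (nat \<times> nat) list set" where
  "dynkin_indices c =
     {rs. rs \<noteq> [] \<and> (\<forall>(r, s) \<in> set rs. r + s > 0) \<and> dynkin_weight rs \<le> c}"

definition dynkin_coeff :: "(nat \<times> nat) list \<Rightarrow> rat" where
  "dynkin_coeff rs = (- 1) ^ (length rs - 1) /
     (of_nat (length rs) * of_nat (dynkin_weight rs) * (\<Prod>(r, s) \<leftarrow> rs. fact r * fact s))"

definition dynkin_word :: "'v \<Rightarrow> 'v \<Rightarrow> (nat \<times> nat) list \<Rightarrow> 'v list" where
  "dynkin_word X Y rs = concat (map (\<lambda>(r, s). replicate r X @ replicate s Y) rs)"

definition bch :: "(rat, 'v, 'z) lie_algebra_scheme \<Rightarrow> nat \<Rightarrow> 'v \<Rightarrow> 'v \<Rightarrow> 'v" where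
  "bch L c X Y = (\<Oplus>\<^bsub>L\<^esub> rs \<in> dynkin_indices c.
     dynkin_coeff rs \<odot>\<^bsub>L\<^esub> right_normed L (dynkin_word X Y rs))"

text \<open>The sum is over a finite set; \<open>finsum\<close> over an infinite set would be zero.\<close>

lemma finite_dynkin_indices: "finite (dynkin_indices c)"
proof (rule finite_subset)
  show "dynkin_indices c \<subseteq> {rs. set rs \<subseteq> {..c} \<times> {..c} \<and> length rs \<le> c}"
  proof
    fix rs assume rs: "rs \<in> dynkin_indices c"
    have mem: "r + s \<le> dynkin_weight rs" if "(r, s) \<in> set rs" for r s
      using that by (induction rs) (auto simp: dynkin_weight_def)
    have "length xs \<le> dynkin_weight xs" if "\<forall>(r, s) \<in> set xs. r + s > 0" for xs
      using that by (induction xs) (auto simp: dynkin_weight_def)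
    with rs mem show "rs \<in> {rs. set rs \<subseteq> {..c} \<times> {..c} \<and> length rs \<le> c}"
      unfolding dynkin_indices_def by fastforce
  qed
  show "finite {rs. set rs \<subseteq> {..c} \<times> {..c} \<and> length rs \<le> c}"
    by (rule finite_lists_length_le) simp
qed

text \<open>\<open>M\<close>, with the embedding \<open>\<iota>\<close>, is a rational Mal'cev completion of \<open>N\<close>. Such a completion of a
  torsion-free nilpotent group exists and is unique up to a unique isomorphism over \<open>N\<close>.\<close>

definition malcev_completion ::
  "('a, 'b) monoid_scheme \<Rightarrow> ('m, 'd) monoid_scheme \<Rightarrow> ('a \<Rightarrow> 'm) \<Rightarrow> bool" where
  "malcev_completion N M \<iota> \<longleftrightarrow>
     torsion_free_group M \<and> nilpotent_group M \<and>
     (\<forall>x \<in> carrier M. \<forall>n::nat. n > 0 \<longrightarrow> (\<exists>y \<in> carrier M. y [^]\<^bsub>M\<^esub> n = x)) \<and>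
     \<iota> \<in> hom N M \<and> inj_on \<iota> (carrier N) \<and>
     (\<forall>x \<in> carrier M. \<exists>n::nat. n > 0 \<and> x [^]\<^bsub>M\<^esub> n \<in> \<iota> ` carrier N)"

text \<open>The nilpotent rational Lie algebra \<open>L\<close> corresponds to the group \<open>M\<close> via the bijection \<open>lg\<close>
  (the logarithm): the multiplication of \<open>M\<close> becomes the Baker-Campbell-Hausdorff product.
  For a Mal'cev completion \<open>M\<close> such an \<open>L\<close> exists and is unique up to isomorphism.\<close>

definition malcev_correspondence ::
  "('m, 'd) monoid_scheme \<Rightarrow> (rat, 'l, 'z) lie_algebra_scheme \<Rightarrow> ('m \<Rightarrow> 'l) \<Rightarrow> bool" where
  "malcev_correspondence M L lg \<longleftrightarrow>
     rational_lie_algebra L \<and> bij_betw lg (carrier M) (carrier L) \<and>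
     (\<exists>c. lie_nilpotent_class_le L c \<and>
       (\<forall>x \<in> carrier M. \<forall>y \<in> carrier M. lg (x \<otimes>\<^bsub>M\<^esub> y) = bch L c (lg x) (lg y)))"

text \<open>For a completion \<open>(M, \<iota>)\<close> of \<open>N\<close> with Lie algebra \<open>(L, lg)\<close>: \<open>\<sigma>\<close> extends uniquely to an
  automorphism \<open>\<tau>\<close> of \<open>M\<close>, which transported along \<open>lg\<close> is the automorphism of \<open>L\<close> induced by \<open>\<sigma>\<close>.\<close>

definition pi_like_endomorphism ::
  "nat set \<Rightarrow> ('a, 'b) monoid_scheme \<Rightarrow> ('m, 'd) monoid_scheme \<Rightarrow> ('a \<Rightarrow> 'm) \<Rightarrow>
   (rat, 'l, 'z) lie_algebra_scheme \<Rightarrow> ('m \<Rightarrow> 'l) \<Rightarrow> ('a \<Rightarrow> 'a) \<Rightarrow> bool" where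
  "pi_like_endomorphism \<pi> N M \<iota> L lg \<sigma> \<longleftrightarrow>
     \<sigma> \<in> hom N N \<and> inj_on \<sigma> (carrier N) \<and>
     (\<exists>\<tau> \<in> iso M M. (\<forall>x \<in> carrier N. \<tau> (\<iota> x) = \<iota> (\<sigma> x)) \<and>
       pi_like_automorphism \<pi> L (\<lambda>v. lg (\<tau> (inv_into (carrier M) lg v))))"

end

theory Submission
  imports Defs
begin

text \<open>
  Let \<open>R = \<int>[1/\<pi>]\<close>, let \<open>L\<close> be the Lie algebra, \<open>Z\<^sub>i\<close> its upper central series and \<open>\<nu>\<close> the automorphism
  induced by \<open>\<sigma>\<close>; as \<open>\<nu>\<close> is linear and respects the Baker-Campbell-Hausdorff product, it respects brackets.
  Cayley-Hamilton makes \<open>\<nu>\<close> integral over \<open>R\<close>. By Gauss' lemma the characteristic polynomial of \<open>\<nu>\<close> on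
  the centre \<open>Z\<^sub>1\<close> lies in \<open>R[x]\<close>, and its constant term is a \<open>\<pi>\<close>-unit, so \<open>\<nu>\<inverse>\<close> is integral over \<open>R\<close> on
  \<open>Z\<^sub>1\<close>. This propagates up the series: from \<open>[\<nu>\<inverse> x, y] = \<nu>\<inverse> [x, \<nu> y]\<close> one sees that on \<open>Z\<^sub>i\<^sub>+\<^sub>1 / Z\<^sub>i\<close>, which
  embeds into \<open>Hom(L, Z\<^sub>i / Z\<^sub>i\<^sub>-\<^sub>1)\<close>, \<open>\<nu>\<inverse>\<close> acts as a product of two commuting operators that are integral
  over \<open>R\<close>. Hence \<open>\<nu>\<inverse>\<close> acts on each factor as a polynomial in \<open>\<nu>\<close> over \<open>R\<close>. The logarithms of \<open>N\<close> are
  closed under \<open>\<nu>\<close>, under multiplication by \<open>R\<close> and, modulo \<open>Z\<^sub>i\<close>, under the addition of elements of \<open>Z\<^sub>i\<^sub>+\<^sub>1\<close>, so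
  preimages under \<open>\<sigma>\<close> can be built by induction along the series.
\<close>

section \<open>The ring \<open>\<int>[1/\<pi>]\<close> and Gauss' lemma\<close>

text \<open>The factors \<open>U (Suc i)\<close> modulo \<open>U i\<close> are never formed: a
  statement about a factor says that some operator maps \<open>U (Suc i)\<close> into
  \<open>U i\<close>, so that on the series only the centre needs a matrix and a determinant.
  Integrality is the notion that survives the climb: two monic relations over
  \<open>Z_inv \<pi>\<close> for commuting operators combine, by a computation with polynomials in
  two variables, into one for the product. In place of an embedding into a space of homomorphisms,
  these polynomials act directly on the brackets of x and y. An integral inverse is a polynomial for
  this reason: applying the m-th power of \<nu> to a monic relation of degree m for \<mu> yields
  \<open>1 + \<nu> r(\<nu>) = 0\<close> on the factor, with r over the ring. The obstacle on the
  group side is that the logarithms of \<open>N\<close> need not be closed under addition.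
  Polynomials in \<nu> are therefore realised by elements of \<open>N\<close> only up to an error
  one step lower in the series, and the final induction absorbs this error. The tensor product that
  defines the determinant is reached through its embedding into \<open>L\<close>, which turns cosets
  into vectors.\<close>

lemma pi_number_1: "pi_number \<pi> 1"
  by (auto simp: pi_number_def)

lemma pi_number_mult: "pi_number \<pi> m \<Longrightarrow> pi_number \<pi> n \<Longrightarrow> pi_number \<pi> (m * n)"
  unfolding pi_number_def by (metis prime_dvd_mult_iff prime_nat_int_transfer)

lemma pi_number_dvd: "pi_number \<pi> n \<Longrightarrow> m dvd n \<Longrightarrow> pi_number \<pi> m"
  unfolding pi_number_def using dvd_trans by blast

lemma Z_invI: "n \<noteq> 0 \<Longrightarrow> pi_number \<pi> n \<Longrightarrow> of_int m / of_int n \<in> Z_inv \<pi>"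
  unfolding Z_inv_def by blast

lemma of_int_in_Z_inv: "of_int m \<in> Z_inv \<pi>"
  using Z_invI[of 1 \<pi> m] pi_number_1 by simp

lemma zero_in_Z_inv: "0 \<in> Z_inv \<pi>" and one_in_Z_inv: "1 \<in> Z_inv \<pi>"
  using of_int_in_Z_inv[of 0 \<pi>] of_int_in_Z_inv[of 1 \<pi>] by simp_all

lemma Z_inv_mult:
  assumes "a \<in> Z_inv \<pi>" "b \<in> Z_inv \<pi>" shows "a * b \<in> Z_inv \<pi>"
proof -
  from assms obtain m n m' n' where *: "a = of_int m / of_int n" "n \<noteq> 0" "pi_number \<pi> n"
    "b = of_int m' / of_int n'" "n' \<noteq> 0" "pi_number \<pi> n'"
    unfolding Z_inv_def by blast
  then have "a * b = of_int (m * m') / of_int (n * n')" by simp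
  moreover have "\<dots> \<in> Z_inv \<pi>" using * by (intro Z_invI pi_number_mult) auto
  ultimately show ?thesis by simp
qed

lemma Z_inv_add:
  assumes "a \<in> Z_inv \<pi>" "b \<in> Z_inv \<pi>" shows "a + b \<in> Z_inv \<pi>"
proof -
  from assms obtain m n m' n' where *: "a = of_int m / of_int n" "n \<noteq> 0" "pi_number \<pi> n"
    "b = of_int m' / of_int n'" "n' \<noteq> 0" "pi_number \<pi> n'"
    unfolding Z_inv_def by blast
  then have "a + b = of_int (m * n' + m' * n) / of_int (n * n')"
    by (simp add: field_simps)
  moreover have "\<dots> \<in> Z_inv \<pi>" using * by (intro Z_invI pi_number_mult) auto
  ultimately show ?thesis by simp
qed

lemma Z_inv_uminus: "a \<in> Z_inv \<pi> \<Longrightarrow> - a \<in> Z_inv \<pi>"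
  using Z_inv_mult[OF of_int_in_Z_inv[of "-1"]] by fastforce

lemma Z_inv_sum: "(\<And>i. i \<in> I \<Longrightarrow> a i \<in> Z_inv \<pi>) \<Longrightarrow> sum a I \<in> Z_inv \<pi>"
  by (induction I rule: infinite_finite_induct) (auto intro: zero_in_Z_inv Z_inv_add)

section \<open>Polynomials over the ring of \<pi>-fractions\<close>

definition Z_inv_poly :: "nat set \<Rightarrow> rat poly set" where
  "Z_inv_poly \<pi> = {p. \<forall>i. coeff p i \<in> Z_inv \<pi>}"

lemma Z_inv_poly_const: "a \<in> Z_inv \<pi> \<Longrightarrow> [:a:] \<in> Z_inv_poly \<pi>"
  unfolding Z_inv_poly_def by (auto simp: coeff_pCons zero_in_Z_inv split: nat.splits)

lemma Z_inv_poly_add: "p \<in> Z_inv_poly \<pi> \<Longrightarrow> q \<in> Z_inv_poly \<pi> \<Longrightarrow> p + q \<in> Z_inv_poly \<pi>"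
  unfolding Z_inv_poly_def by (auto intro: Z_inv_add)

lemma Z_inv_poly_mult: "p \<in> Z_inv_poly \<pi> \<Longrightarrow> q \<in> Z_inv_poly \<pi> \<Longrightarrow> p * q \<in> Z_inv_poly \<pi>"
  unfolding Z_inv_poly_def by (auto intro!: Z_inv_sum Z_inv_mult simp: coeff_mult)

lemma Z_inv_poly_power: "p \<in> Z_inv_poly \<pi> \<Longrightarrow> p ^ n \<in> Z_inv_poly \<pi>"
  by (induction n) (auto intro: Z_inv_poly_mult Z_inv_poly_const one_in_Z_inv simp: one_pCons)

lemma Z_inv_poly_sum: "(\<And>i. i \<in> I \<Longrightarrow> p i \<in> Z_inv_poly \<pi>) \<Longrightarrow> sum p I \<in> Z_inv_poly \<pi>"
  unfolding Z_inv_poly_def by (auto simp: coeff_sum intro: Z_inv_sum)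

lemma Z_inv_poly_prod: "(\<And>i. i \<in> I \<Longrightarrow> p i \<in> Z_inv_poly \<pi>) \<Longrightarrow> prod p I \<in> Z_inv_poly \<pi>"
  by (induction I rule: infinite_finite_induct)
    (auto intro: Z_inv_poly_mult Z_inv_poly_const one_in_Z_inv simp: one_pCons)

lemma Z_inv_poly_clear_denominator:
  assumes "p \<in> Z_inv_poly \<pi>"
  obtains n P where "n \<noteq> 0" "pi_number \<pi> n" "of_int_poly P = Polynomial.smult (of_int n) p"
proof -
  have "\<exists>n P. n \<noteq> 0 \<and> pi_number \<pi> n \<and> of_int_poly P = Polynomial.smult (of_int n) p"
    using assms
  proof (induction p)
    case 0
    show ?case by (intro exI[of _ 1] exI[of _ 0]) (simp add: pi_number_1)
  next
    case (pCons a p)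
    have "coeff (pCons a p) 0 \<in> Z_inv \<pi>" "\<And>i. coeff (pCons a p) (Suc i) \<in> Z_inv \<pi>"
      using pCons.prems unfolding Z_inv_poly_def by blast+
    then have "a \<in> Z_inv \<pi>" "p \<in> Z_inv_poly \<pi>" by (auto simp: Z_inv_poly_def)
    with pCons.IH obtain m k n P where *: "a = of_int m / of_int k" "k \<noteq> 0" "pi_number \<pi> k"
       "n \<noteq> 0" "pi_number \<pi> n" "of_int_poly P = Polynomial.smult (of_int n) p"
      unfolding Z_inv_def by blast
    show ?case
    proof (intro exI conjI)
      show "of_int_poly (pCons (m * n) (Polynomial.smult k P)) =
        Polynomial.smult (of_int (k * n)) (pCons a p)"
        using * by (simp add: hom_distribs)
    qed (use * in \<open>auto intro: pi_number_mult\<close>)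
  qed
  then show ?thesis using that by blast
qed

text \<open>For a monic polynomial the common denominator reappears as the leading coefficient, so
  the content of \<open>P\<close> divides it; \<open>gauss_Z_inv\<close> cancels this
  content.\<close>

lemma lead_coeff_clear_denominator:
  fixes p :: "rat poly"
  assumes "lead_coeff p = 1" "of_int_poly P = Polynomial.smult (of_int n) p" "n \<noteq> 0"
  shows "lead_coeff P = n"
proof -
  have "of_int (lead_coeff P) = (of_int n :: rat)"
    using arg_cong[OF assms(2), of lead_coeff] assms(1,3) by (simp add: hom_distribs)
  then show ?thesis by simp
qed

text \<open>After clearing denominators, \<open>n G H = d e F\<close> over the integers. Contents
  are multiplicative, and those of \<open>G\<close> and \<open>H\<close> divide the leading
  coefficients \<open>d\<close> and \<open>e\<close>. Cancelling them leaves cofactors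
  \<open>d'\<close> and \<open>e'\<close> whose product divides \<open>n\<close>. So
  \<open>d'\<close> is a \<pi>-number, and it is a denominator for \<open>g\<close>.\<close>

lemma gauss_Z_inv:
  fixes g h :: "rat poly"
  assumes "lead_coeff g = 1" "lead_coeff h = 1" "g * h \<in> Z_inv_poly \<pi>"
  shows "g \<in> Z_inv_poly \<pi>"
proof -
  have all: "p \<in> Z_inv_poly UNIV" for p
  proof -
    have "q \<in> Z_inv UNIV" for q
      using quotient_of_div[of q "fst (quotient_of q)" "snd (quotient_of q)"]
        Z_invI[of "snd (quotient_of q)" UNIV "fst (quotient_of q)"]
        quotient_of_denom_pos[of q "fst (quotient_of q)" "snd (quotient_of q)"]
      by (auto simp: pi_number_def)
    then show ?thesis by (simp add: Z_inv_poly_def)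
  qed
  obtain d G where G: "d \<noteq> 0" "of_int_poly G = Polynomial.smult (of_int d) g"
    using Z_inv_poly_clear_denominator[OF all[of g]] .
  obtain e H where H: "e \<noteq> 0" "of_int_poly H = Polynomial.smult (of_int e) h"
    using Z_inv_poly_clear_denominator[OF all[of h]] .
  obtain n F where F: "n \<noteq> 0" "pi_number \<pi> n" "of_int_poly F = Polynomial.smult (of_int n) (g * h)"
    using Z_inv_poly_clear_denominator[OF assms(3)] .
  have lead: "lead_coeff G = d" "lead_coeff H = e" "lead_coeff F = n"
    using lead_coeff_clear_denominator[OF _ G(2)] lead_coeff_clear_denominator[OF _ H(2)]
      lead_coeff_clear_denominator[OF _ F(3)] assms G H F by (simp_all only: lead_coeff_mult) auto
  have "of_int_poly (Polynomial.smult n (G * H)) = (of_int_poly (Polynomial.smult (d * e) F) :: rat poly)"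
    unfolding of_int_poly_hom.hom_mult of_int_hom.map_poly_hom_smult G(2) H(2) F(3)
    by (simp add: ac_simps)
  then have "Polynomial.smult n (G * H) = Polynomial.smult (d * e) F" by simp
  then have eq: "normalize n * (content G * content H) = normalize (d * e) * content F"
    by (metis content_mult content_smult)
  obtain d' where d': "d = content G * d'" using lead(1) content_dvd_coeff by (metis dvdE)
  obtain e' where e': "e = content H * e'" using lead(2) content_dvd_coeff by (metis dvdE)
  have nz: "content G \<noteq> 0" "content H \<noteq> 0" using d' e' G H by auto
  have "\<bar>n\<bar> * (content G * content H) = (\<bar>d'\<bar> * \<bar>e'\<bar> * content F) * (content G * content H)"
    using eq d' e' normalize_content[of G] normalize_content[of H] by (auto simp: abs_mult ac_simps)
  then have "\<bar>n\<bar> = \<bar>d'\<bar> * \<bar>e'\<bar> * content F" using nz by simp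
  then have "d' dvd n" by (metis abs_dvd_iff dvd_abs_iff dvd_triv_left mult.assoc)
  then have d'pi: "pi_number \<pi> d'" "d' \<noteq> 0" using pi_number_dvd F G d' by auto
  show ?thesis unfolding Z_inv_poly_def
  proof safe
    fix i
    obtain c where c: "coeff G i = content G * c" using content_dvd_coeff by (metis dvdE)
    have "of_int (coeff G i) = of_int d * coeff g i"
      using arg_cong[OF G(2), of "\<lambda>p. coeff p i"] by simp
    then have "coeff g i = of_int c / of_int d'"
      using c d' nz d'pi by (simp add: field_simps)
    then show "coeff g i \<in> Z_inv \<pi>" using Z_invI d'pi by simp
  qed
qed

section \<open>Matrices and their characteristic polynomials\<close>

text \<open>Horner's scheme, with the same recursion as \<open>pact\<close> below, so that matrix
  and operator can be compared by induction on the polynomial.\<close>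

definition mat_poly :: "'a :: comm_ring_1 mat \<Rightarrow> 'a poly \<Rightarrow> 'a mat" where
  "mat_poly A p = fold_coeffs (\<lambda>a F. A * F + a \<cdot>\<^sub>m 1\<^sub>m (dim_row A)) p (0\<^sub>m (dim_row A) (dim_row A))"

lemma mat_poly_0: "A \<in> carrier_mat k k \<Longrightarrow> mat_poly A 0 = 0\<^sub>m k k"
  by (simp add: mat_poly_def)

lemma mat_poly_pCons:
  assumes "A \<in> carrier_mat k k"
  shows "mat_poly A (pCons a p) = A * mat_poly A p + a \<cdot>\<^sub>m 1\<^sub>m k"
proof -
  \<comment> \<open>\<open>cCons\<close> drops a zero coefficient in front of the zero polynomial,
    so the Horner step must be neutral in that case.\<close>
  have "A * 0\<^sub>m k k + 0 \<cdot>\<^sub>m 1\<^sub>m k = 0\<^sub>m k k" using assms by auto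
  then show ?thesis using assms
    by (cases "p = 0 \<and> a = 0") (auto simp: mat_poly_def fold_coeffs_def cCons_def)
qed

lemma mat_poly_carrier: "A \<in> carrier_mat k k \<Longrightarrow> mat_poly A p \<in> carrier_mat k k"
  by (induction p) (auto simp: mat_poly_0 mat_poly_pCons)

lemma char_poly_matrix_mult_index:
  assumes "A \<in> carrier_mat k k" "B \<in> carrier_mat k k" "i < k" "j < k"
  shows "(char_poly_matrix A * B) $$ (i, j)
    = [:0, 1:] * B $$ (i, j) - (\<Sum>l<k. [:A $$ (i, l):] * B $$ (l, j))"
proof -
  have "(char_poly_matrix A * B) $$ (i, j) = (\<Sum>l<k. char_poly_matrix A $$ (i, l) * B $$ (l, j))"
    using assms char_poly_matrix_closed[OF assms(1)]
    by (simp add: scalar_prod_def lessThan_atLeast0 del: char_poly_matrix_closed)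
  also have "\<dots> = (\<Sum>l<k. (if l = i then [:0, 1:] * B $$ (l, j) else 0) - [:A $$ (i, l):] * B $$ (l, j))"
    using assms by (intro sum.cong) (auto simp: char_poly_matrix_def algebra_simps)
  finally show ?thesis using assms by (simp add: sum_subtractf)
qed

text \<open>Division of \<open>p\<close> times the identity by x - A, with remainder p(A). It serves
  both the Cayley-Hamilton theorem and \<open>char_poly_dvd_power\<close>.\<close>

lemma mat_poly_remainder:
  fixes A :: "'a :: comm_ring_1 mat"
  assumes A: "A \<in> carrier_mat k k"
  obtains B where "B \<in> carrier_mat k k"
    "p \<cdot>\<^sub>m 1\<^sub>m k = char_poly_matrix A * B + map_mat (\<lambda>a. [:a:]) (mat_poly A p)"
proof -
  have C: "char_poly_matrix A \<in> carrier_mat k k" using A by simp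
  have "\<exists>B \<in> carrier_mat k k. p \<cdot>\<^sub>m 1\<^sub>m k = char_poly_matrix A * B + map_mat (\<lambda>a. [:a:]) (mat_poly A p)"
  proof (induction p)
    case 0
    show ?case using A C
      by (intro bexI[of _ "0\<^sub>m k k"] eq_matI) (auto simp: mat_poly_0 right_mult_zero_mat[of _ k k])
  next
    case (pCons a p)
    then obtain B where B: "B \<in> carrier_mat k k"
      and eq: "p \<cdot>\<^sub>m 1\<^sub>m k = char_poly_matrix A * B + map_mat (\<lambda>a. [:a:]) (mat_poly A p)" by blast
    let ?G = "map_mat (\<lambda>a. [:a:]) (mat_poly A p)"
    have G: "mat_poly A p \<in> carrier_mat k k" "?G \<in> carrier_mat k k" using mat_poly_carrier[OF A, of p] by auto
    \<comment> \<open>\<open>X\<close> and \<open>c\<close> hide the polynomial constructors, so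
      that the simplifier calculates with plain ring elements.\<close>
    define X where "X = [:0, 1 :: 'a:]"
    define c where "c = (\<lambda>a :: 'a. [:a:])"
    have c_mult: "c (a * b) = c a * c b" and c_add: "c (a + b) = c a + c b" for a b by (simp_all add: c_def)
    have c_sum: "c (\<Sum>l<k. f l) = (\<Sum>l<k. c (f l))" for f
      by (induction k) (simp add: c_def, simp add: c_add)
    have eq': "p * (1\<^sub>m k $$ (i, j)) = X * B $$ (i, j) - (\<Sum>l<k. c (A $$ (i, l)) * B $$ (l, j))
        + c (mat_poly A p $$ (i, j))"
      if "i < k" "j < k" for i j
      using arg_cong[OF eq, of "\<lambda>M. M $$ (i, j)"] that A B C G
      by (simp add: char_poly_matrix_mult_index[OF A B] X_def c_def del: index_mult_mat(1))
    \<comment> \<open>From X p(A) = (X - A) p(A) + A p(A): the first summand goes into the quotient,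
      the second starts the next Horner step of the remainder.\<close>
    let ?B = "[:0, 1:] \<cdot>\<^sub>m B + ?G"
    have B': "?B \<in> carrier_mat k k" using B G by simp
    have "pCons a p \<cdot>\<^sub>m 1\<^sub>m k = char_poly_matrix A * ?B
      + map_mat (\<lambda>a. [:a:]) (mat_poly A (pCons a p))" (is "?L = ?R")
    proof (rule eq_matI)
      fix i j assume ij: "i < dim_row ?R" "j < dim_col ?R"
      then have ij: "i < k" "j < k" using A mat_poly_carrier[OF A, of "pCons a p"] by auto
      have "?L $$ (i, j) = X * (p * (1\<^sub>m k $$ (i, j))) + c a * (1\<^sub>m k $$ (i, j))"
        using ij by (simp add: X_def c_def)
      also have "\<dots> = X * (X * B $$ (i, j) + c (mat_poly A p $$ (i, j)))
          - (\<Sum>l<k. c (A $$ (i, l)) * (X * B $$ (l, j) + c (mat_poly A p $$ (l, j))))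
          + ((\<Sum>l<k. c (A $$ (i, l)  * mat_poly A p $$ (l, j))) + c a * (1\<^sub>m k $$ (i, j)))"
        unfolding eq'[OF ij] c_mult
        by (simp add: algebra_simps sum.distrib sum_distrib_left)
      also have "\<dots> = ?R $$ (i, j)"
      proof -
        have "mat_poly A (pCons a p) $$ (i, j) = (\<Sum>l<k. A $$ (i, l) * mat_poly A p $$ (l, j)) + a * (1\<^sub>m k $$ (i, j))"
          using ij A G by (simp add: mat_poly_pCons scalar_prod_def lessThan_atLeast0)
        moreover have "c (sum f {..<k} + a * (1\<^sub>m k $$ (i, j))) = (\<Sum>l<k. c (f l)) + c a * (1\<^sub>m k $$ (i, j))" for f
          using ij by (simp add: c_add c_sum c_mult) (simp add: c_def)
        moreover have "?R $$ (i, j) = (char_poly_matrix A * ?B) $$ (i, j) + c (mat_poly A (pCons a p) $$ (i, j))"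
          using ij C B' mat_poly_carrier[OF A, of "pCons a p"] by (simp add: c_def del: index_mult_mat(1))
        ultimately show ?thesis
          using ij B G by (simp add: char_poly_matrix_mult_index[OF A B'] X_def c_def)
      qed
      finally show "?L $$ (i, j) = ?R $$ (i, j)" .
    qed (use A mat_poly_carrier[OF A, of "pCons a p"] in auto)
    then show ?case using B' by blast
  qed
  then show ?thesis using that by blast
qed

text \<open>With remainder zero, \<open>p\<close> times the identity is x - A times another matrix;
  take determinants. This bounds the characteristic polynomial without eigenvalues.\<close>

lemma char_poly_dvd_power:
  fixes A :: "'a :: comm_ring_1 mat"
  assumes A: "A \<in> carrier_mat k k" and "mat_poly A p = 0\<^sub>m k k"
  shows "char_poly A dvd p ^ k"
proof -
  have hom0: "map_mat (\<lambda>a. [:a:]) (0\<^sub>m k k) = (0\<^sub>m k k :: 'a poly mat)" by (auto intro!: eq_matI)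
  obtain B where B: "B \<in> carrier_mat k k"
    and "p \<cdot>\<^sub>m 1\<^sub>m k = char_poly_matrix A * B + map_mat (\<lambda>a. [:a:]) (mat_poly A p)"
    using mat_poly_remainder[OF A] .
  then have "p \<cdot>\<^sub>m 1\<^sub>m k = char_poly_matrix A * B" 
    using assms
    by (simp add: right_add_zero_mat[OF mult_carrier_mat[OF char_poly_matrix_closed[OF A] B]] hom0)
  from arg_cong[OF this, of det] show ?thesis
    using A B by (simp add: det_smult det_mult[of _ k] char_poly_def)
qed

text \<open>A polynomial matrix \<open>D\<close> with \<open>(x - A) D\<close> constant vanishes, as the coefficient of highest
  degree in \<open>D\<close> survives in \<open>x D\<close>.\<close>

lemma cayley_hamilton_mat_poly:
  fixes A :: "'a :: comm_ring_1 mat"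
  assumes A: "A \<in> carrier_mat k k"
  shows "mat_poly A (char_poly A) = 0\<^sub>m k k"
proof -
  let ?C = "char_poly_matrix A"
  have C: "?C \<in> carrier_mat k k" using A by simp
  obtain B where B: "B \<in> carrier_mat k k"
    and eq: "char_poly A \<cdot>\<^sub>m 1\<^sub>m k = ?C * B + map_mat (\<lambda>a. [:a:]) (mat_poly A (char_poly A))"
    using mat_poly_remainder[OF A] .
  let ?F = "mat_poly A (char_poly A)"
  have F: "?F \<in> carrier_mat k k" by (rule mat_poly_carrier[OF A])
  \<comment> \<open>The adjugate and \<open>B\<close> are both right quotients of
    \<open>char_poly A\<close> by x - A, with remainders zero and \<open>?F\<close>; hence x - A
    times \<open>D\<close> is constant.\<close>
  define D where "D = adj_mat ?C - B"
  have aC: "adj_mat ?C \<in> carrier_mat k k" "?C * adj_mat ?C = char_poly A \<cdot>\<^sub>m 1\<^sub>m k"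
    using adj_mat[OF C] by (auto simp: char_poly_def)
  have D: "D \<in> carrier_mat k k" using aC B by (auto simp: D_def)
  have CD: "?C * D = map_mat (\<lambda>a. [:a:]) ?F"
    unfolding D_def using aC B C F eq by (auto simp: mult_minus_distrib_mat[of _ k k] intro!: eq_matI)
  have entry: "[:?F $$ (i, j):] = [:0, 1:] * D $$ (i, j) - (\<Sum>l<k. [:A $$ (i, l):] * D $$ (l, j))"
    if "i < k" "j < k" for i j
    using arg_cong[OF CD, of "\<lambda>M. M $$ (i, j)"] that F
    by (simp add: char_poly_matrix_mult_index[OF A D] del: index_mult_mat(1))
  have zero: "coeff (D $$ (i, j)) d = 0" if ij: "i < k" "j < k" for i j d
  proof -
    \<comment> \<open>For \<open>k = 0\<close> this is \<open>Max {}\<close>, of unspecified value;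
      \<open>deg\<close> is then vacuous.\<close>
    define d0 where "d0 = Max ((\<lambda>(i, j). degree (D $$ (i, j))) ` ({..<k} \<times> {..<k}))"
    have deg: "degree (D $$ (i, j)) \<le> d0" if "i < k" "j < k" for i j
      unfolding d0_def using that by (intro Max_ge) (auto intro!: image_eqI[of _ _ "(i, j)"])
    \<comment> \<open>Downward induction from one above the top degree: in \<open>entry\<close>, the
      coefficient of degree \<open>Suc d\<close> expresses coefficient \<open>d\<close> of
      \<open>D\<close> through coefficients \<open>Suc d\<close>, which already vanish.\<close>
    have "\<forall>i<k. \<forall>j<k. coeff (D $$ (i, j)) d = 0" if "d \<le> Suc d0" for d
      using that
    proof (induction rule: inc_induct)
      case base
      show ?case using deg by (auto intro!: coeff_eq_0 le_imp_less_Suc)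
    next
      case (step d)
      show ?case
      proof (intro allI impI)
        fix i j assume ij: "i < k" "j < k"
        show "coeff (D $$ (i, j)) d = 0"
          using arg_cong[OF entry[OF ij], of "\<lambda>p. coeff p (Suc d)"] ij step.IH
          by (simp add: coeff_sum)
      qed
    qed
    then show ?thesis using ij deg[OF ij] coeff_eq_0[of "D $$ (i, j)" d] by (cases "d \<le> Suc d0") auto
  qed
  have "?F $$ (i, j) = 0" if ij: "i < k" "j < k" for i j
    using arg_cong[OF entry[OF ij], of "\<lambda>p. coeff p 0"] ij zero by (simp add: coeff_sum)
  then show ?thesis using F by (intro eq_matI) auto
qed

text \<open>The characteristic polynomial is a monic factor of \<open>p ^ k\<close>, so Gauss' lemma
  applies. It lets the action on the centre inherit integrality from \<open>L\<close> without
  extending a basis of the centre to one of \<open>L\<close>.\<close>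

lemma char_poly_in_Z_inv_poly:
  assumes A: "A \<in> carrier_mat k k" and "mat_poly A p = 0\<^sub>m k k" "lead_coeff p = 1" "p \<in> Z_inv_poly \<pi>"
  shows "char_poly A \<in> Z_inv_poly \<pi>"
proof -
  obtain q where q: "p ^ k = char_poly A * q" using char_poly_dvd_power[OF assms(1,2)] by (metis dvdE)
  have "lead_coeff (char_poly A) = 1" using degree_monic_char_poly[OF A] by simp
  moreover from this have "lead_coeff q = 1"
    using arg_cong[OF q, of lead_coeff] assms(3) by (simp add: lead_coeff_mult lead_coeff_power)
  ultimately show ?thesis using gauss_Z_inv[of "char_poly A" q \<pi>] q Z_inv_poly_power[OF assms(4), of k] by simp
qed

lemma det_in_Z_inv_poly:
  assumes "P \<in> carrier_mat k k" "\<And>i j. i < k \<Longrightarrow> j < k \<Longrightarrow> P $$ (i, j) \<in> Z_inv_poly \<pi>"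
  shows "det P \<in> Z_inv_poly \<pi>"
proof -
  have "signof p \<in> Z_inv_poly \<pi>" for p
    using Z_inv_poly_const[OF one_in_Z_inv] Z_inv_poly_const[OF of_int_in_Z_inv[of "-1"]]
    by (simp add: sign_def one_pCons)
  then show ?thesis unfolding det_def'[OF assms(1)]
    using assms(2) by (intro Z_inv_poly_sum Z_inv_poly_mult Z_inv_poly_prod)
      (auto simp: permutes_in_image[of _ "{0..<k}", simplified])
qed

lemma char_poly_of_Z_inv_mat:
  assumes "S \<in> carrier_mat k k" "\<And>i j. i < k \<Longrightarrow> j < k \<Longrightarrow> S $$ (i, j) \<in> Z_inv \<pi>"
  shows "char_poly S \<in> Z_inv_poly \<pi>"
  unfolding char_poly_def
proof (rule det_in_Z_inv_poly)
  show "char_poly_matrix S $$ (i, j) \<in> Z_inv_poly \<pi>" if "i < k" "j < k" for i j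
  proof -
    have "[:0, 1:] \<in> Z_inv_poly \<pi>"
      by (auto simp: Z_inv_poly_def coeff_pCons zero_in_Z_inv one_in_Z_inv split: nat.split)
    moreover have "[:- S $$ (i, j):] \<in> Z_inv_poly \<pi>"
      using that assms by (intro Z_inv_poly_const Z_inv_uminus)
    moreover have "char_poly_matrix S $$ (i, j) = (if i = j then [:0, 1:] else 0) + [:- S $$ (i, j):]"
      using that assms by (simp add: char_poly_matrix_def)
    ultimately show ?thesis by (auto intro: Z_inv_poly_add simp del: add_pCons)
  qed
qed (use assms in simp)

section \<open>Integrality of products\<close>

text \<open>Being a ring homomorphism, evaluation commutes with determinants; this is what turns x -
  S into z - S below.\<close>

lemma (in comm_ring_hom) eval_poly_map_hom: "comm_ring_hom (\<lambda>p. poly (map_poly hom p) z)"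
proof -
  interpret m: map_poly_comm_ring_hom hom ..
  show ?thesis by unfold_locales (simp_all add: hom_distribs)
qed

text \<open>The determinant trick for integrality: \<open>z\<close> acts on the \<open>w j\<close> modulo the ideal \<open>I\<close> through the
  matrix \<open>S\<close>, and the adjugate of \<open>z - S\<close> is applied to these relations.\<close>

lemma char_poly_annihilates_modulo_ideal:
  fixes h :: "'r :: comm_ring_1 \<Rightarrow> 't :: comm_ring_1" and I :: "'t set"
  assumes "comm_ring_hom h"
    and I: "0 \<in> I" "\<And>a b. a \<in> I \<Longrightarrow> b \<in> I \<Longrightarrow> a + b \<in> I" "\<And>a b. a \<in> I \<Longrightarrow> b * a \<in> I"
    and S: "S \<in> carrier_mat k k"
    and w: "\<And>j. j < k \<Longrightarrow> z * w j - (\<Sum>l<k. h (S $$ (j, l)) * w l) \<in> I" and j: "j < k"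
  shows "poly (map_poly h (char_poly S)) z * w j \<in> I"
proof -
  interpret h: comm_ring_hom h by fact
  define e where "e = (\<lambda>p. poly (map_poly h p) z)"
  interpret e: comm_ring_hom e unfolding e_def by (rule h.eval_poly_map_hom)
  have I_sum: "sum f J \<in> I" if "\<And>i. i \<in> J \<Longrightarrow> f i \<in> I" for f :: "nat \<Rightarrow> 't" and J
    using that by (induction J rule: infinite_finite_induct) (auto intro: I)
  \<comment> \<open>\<open>P\<close> is z - S over the target ring, and its determinant is the value
    of the characteristic polynomial at \<open>z\<close>.\<close>
  define P where "P = map_mat e (char_poly_matrix S)"
  have P: "P \<in> carrier_mat k k" using char_poly_matrix_closed[OF S] by (simp add: P_def)
  have P_index: "P $$ (i, l) = (if i = l then z else 0) - h (S $$ (i, l))" if "i < k" "l < k" for i l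
    using that S by (simp add: P_def char_poly_matrix_def e_def hom_distribs)
  have det: "det P = e (char_poly S)" by (simp add: P_def char_poly_def)
  have "det P * w j = (\<Sum>l<k. (det P \<cdot>\<^sub>m 1\<^sub>m k) $$ (j, l) * w l)"
    using j by (simp add: if_distrib if_distribR sum.delta cong: if_cong)
  also have "\<dots> = (\<Sum>l<k. (\<Sum>i<k. adj_mat P $$ (j, i) * P $$ (i, l)) * w l)"
    unfolding adj_mat(3)[OF P, symmetric] using j P adj_mat(1)[OF P]
    by (intro sum.cong) (auto simp: scalar_prod_def lessThan_atLeast0)
  also have "\<dots> = (\<Sum>i<k. adj_mat P $$ (j, i) * (\<Sum>l<k. P $$ (i, l) * w l))"
    unfolding sum_distrib_right sum_distrib_left by (subst sum.swap) (simp add: ac_simps)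
  also have "\<dots> \<in> I"
  proof (rule I_sum, rule I(3))
    fix i assume "i \<in> {..<k}"
    then have i: "i < k" by simp
    have "(\<Sum>l<k. P $$ (i, l) * w l) = (\<Sum>l<k. (if i = l then z * w l else 0) - h (S $$ (i, l)) * w l)"
      using i by (intro sum.cong) (auto simp: P_index algebra_simps)
    also have "\<dots> = z * w i - (\<Sum>l<k. h (S $$ (i, l)) * w l)" using i by (simp add: sum_subtractf)
    finally show "(\<Sum>l<k. P $$ (i, l) * w l) \<in> I" using w[OF i] by simp
  qed
  finally show ?thesis unfolding det by (simp add: e_def)
qed

text \<open>Bivariate polynomials are polynomials in \<open>s\<close> over \<open>\<rat>[t]\<close>; these are the embeddings of \<open>\<rat>[s]\<close>
  and of \<open>\<rat>[t]\<close>, and the substitution of \<open>st\<close>.\<close>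

definition poly_s :: "rat poly \<Rightarrow> rat poly poly" where
  "poly_s p = map_poly (\<lambda>a. [:a:]) p"

definition poly_t :: "rat poly \<Rightarrow> rat poly poly" where
  "poly_t p = [:p:]"

definition poly_st :: "rat poly \<Rightarrow> rat poly poly" where
  "poly_st p = poly (map_poly (\<lambda>a. [:[:a:]:]) p) [:0, [:0, 1:]:]"

text \<open>Row \<open>a\<close> of the companion matrix: \<open>x\<^sup>a\<^sup>+\<^sup>1 \<equiv> \<Sum>\<^sub>b c\<^sub>a\<^sub>b x\<^sup>b\<close> modulo the monic polynomial \<open>p\<close>.\<close>

definition companion :: "rat poly \<Rightarrow> nat \<Rightarrow> nat \<Rightarrow> rat" where
  "companion p a b = (if Suc a < degree p then (if b = Suc a then 1 else 0) else - coeff p b)"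

lemma companion_in_Z_inv: "p \<in> Z_inv_poly \<pi> \<Longrightarrow> companion p a b \<in> Z_inv \<pi>"
  by (auto simp: companion_def Z_inv_poly_def intro: Z_inv_uminus zero_in_Z_inv one_in_Z_inv)

text \<open>The difference is zero in the shift rows and p(x) in the last row. Both values lie in
  every ideal that contains p(x), which is all that \<open>integral_product\<close> asks
  for.\<close>

lemma companion_reduction:
  fixes h :: "rat \<Rightarrow> 't :: comm_ring_1"
  assumes "comm_ring_hom h" "lead_coeff p = 1" "a < degree p"
  shows "x ^ Suc a - (\<Sum>b<degree p. h (companion p a b) * x ^ b) \<in> {0, poly (map_poly h p) x}"
proof -
  interpret h: comm_ring_hom h by fact
  show ?thesis
  proof (cases "Suc a < degree p")
    case True
    then have "(\<Sum>b<degree p. h (companion p a b) * x ^ b) = (\<Sum>b<degree p. if b = Suc a then x ^ b else 0)"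
      by (intro sum.cong) (auto simp: companion_def)
    then show ?thesis using True by simp
  next
    case False
    then have a: "Suc a = degree p" using assms by simp
    have "poly (map_poly h p) x = (\<Sum>b\<le>degree p. h (coeff p b) * x ^ b)"
      unfolding poly_altdef using degree_map_poly_le[of h p]
      by (intro sum.mono_neutral_cong_left) (auto simp: coeff_eq_0 simp flip: h.coeff_map_poly_hom)
    also have "\<dots> = x ^ degree p + (\<Sum>b<degree p. h (coeff p b) * x ^ b)"
      using assms(2) by (simp add: lessThan_Suc_atMost[symmetric])
    finally show ?thesis using False a by (simp add: companion_def h.hom_uminus sum_negf)
  qed
qed

text \<open>Modulo q(s) and f(t), multiplication by st acts on the monomials with exponents below
  the two degrees through the Kronecker product of the companion matrices. Its entries lie in the
  ring, so its characteristic polynomial is a monic relation for st. The result is an identity of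
  polynomials, so that it can be applied to any action of the two variables.\<close>

lemma integral_product:
  assumes q: "lead_coeff q = 1" "q \<in> Z_inv_poly \<pi>" and f: "lead_coeff f = 1" "f \<in> Z_inv_poly \<pi>"
  obtains h u v where "lead_coeff h = 1" "h \<in> Z_inv_poly \<pi>"
    "poly_st h = poly_s q * u + poly_t f * v"
proof -
  define \<phi> where "\<phi> = (\<lambda>a :: rat. [:[:a:]:])"
  interpret h: comm_ring_hom \<phi>
    by unfold_locales (auto simp: \<phi>_def one_pCons)
  have hom: "comm_ring_hom \<phi>" ..
  define m n where "m = degree q" and "n = degree f"
  define s t where "s = [:0, 1 :: rat poly:]" and "t = [:[:0, 1 :: rat:]:]"
  have t_hom: "[:p:] = poly (map_poly \<phi> p) t" for p
  proof (induction p)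
    case (pCons a p)
    have "[:pCons a p:] = \<phi> a + t * [:p:]" by (simp add: \<phi>_def t_def)
    then show ?case using pCons by (simp add: h.map_poly_pCons_hom)
  qed simp
  have s_hom: "poly_s p = poly (map_poly \<phi> p) s" for p
  proof (induction p)
    case (pCons a p)
    have "poly_s (pCons a p) = \<phi> a + s * poly_s p"
      by (cases "a = 0 \<and> p = 0") (auto simp: \<phi>_def s_def poly_s_def map_poly_pCons)
    then show ?case using pCons by (simp add: h.map_poly_pCons_hom)
  qed (simp add: poly_s_def)
  define I where "I = {poly_s q * u + poly_t f * v |u v. True}"
  have I: "0 \<in> I" "\<And>a b. a \<in> I \<Longrightarrow> b \<in> I \<Longrightarrow> a + b \<in> I" "\<And>a b. a \<in> I \<Longrightarrow> b * a \<in> I"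
  proof -
    show "0 \<in> I" unfolding I_def by (auto intro!: exI[of _ 0])
    show "a + b \<in> I" if ab: "a \<in> I" "b \<in> I" for a b
    proof -
      from ab obtain u v u' v' where "a = poly_s q * u + poly_t f * v" "b = poly_s q * u' + poly_t f * v'"
        unfolding I_def by blast
      then have "a + b = poly_s q * (u + u') + poly_t f * (v + v')" by (simp add: algebra_simps)
      then show ?thesis unfolding I_def by blast
    qed
    show "b * a \<in> I" if a: "a \<in> I" for a b
    proof -
      from a obtain u v where "a = poly_s q * u + poly_t f * v" unfolding I_def by blast
      then have "b * a = poly_s q * (b * u) + poly_t f * (b * v)" by (simp add: algebra_simps)
      then show ?thesis unfolding I_def by blast
    qed
  qed
  have qI: "poly_s q \<in> I"
    unfolding I_def by (rule CollectI, rule exI[of _ 1], rule exI[of _ 0]) simp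
  have fI: "poly_t f \<in> I"
    unfolding I_def by (rule CollectI, rule exI[of _ 0], rule exI[of _ 1]) simp
  \<comment> \<open>The pair of exponents (a, b) is coded as the single index
    \<open>a * n + b\<close>.\<close>
  define w where "w = (\<lambda>j. s ^ (j div n) * t ^ (j mod n))"
  define S where "S = mat (m * n) (m * n)
    (\<lambda>(j, l). companion q (j div n) (l div n) * companion f (j mod n) (l mod n))"
  have S: "S \<in> carrier_mat (m * n) (m * n)" by (simp add: S_def)
  define h where "h = char_poly S"
  have rel: "s * t * w j - (\<Sum>l<m * n. \<phi> (S $$ (j, l)) * w l) \<in> I" if j: "j < m * n" for j
  proof -
    have n0: "n > 0" using j by (cases n) auto
    have a: "j div n < m" and b: "j mod n < n"
      using j n0 by (auto simp: less_mult_imp_div_less)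
    define A B where "A = (\<Sum>a<m. \<phi> (companion q (j div n) a) * s ^ a)"
      and "B = (\<Sum>b<n. \<phi> (companion f (j mod n) b) * t ^ b)"
    have "(\<Sum>l<m * n. \<phi> (S $$ (j, l)) * w l) = (\<Sum>l<m * n. (\<phi> (companion q (j div n) (l div n)) * s ^ (l div n))
        * (\<phi> (companion f (j mod n) (l mod n)) * t ^ (l mod n)))"
      using j by (intro sum.cong) (auto simp: S_def w_def h.hom_mult ac_simps)
    also have "\<dots> = A * B"
      unfolding A_def B_def sum_product sum.cartesian_product
    proof (rule sum.reindex_bij_witness[of _ "\<lambda>(a, b). a * n + b" "\<lambda>l. (l div n, l mod n)"])
      show "(case p of (a, b) \<Rightarrow> a * n + b) \<in> {..<m * n}" if mem: "p \<in> {..<m} \<times> {..<n}" for p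
      proof -
        obtain a b where p: "p = (a, b)" "a < m" "b < n" using mem by blast
        then have "a * n + b < Suc a * n" by simp
        also have "\<dots> \<le> m * n" using p by (intro mult_le_mono1) simp
        finally show ?thesis using p by simp
      qed
    qed (use n0 in \<open>auto simp: less_mult_imp_div_less\<close>)
    \<comment> \<open>Reducing one factor at a time: the product of the two powers minus A B splits
      into two terms, each a multiple of a companion relation.\<close>
    finally have *: "s * t * w j - (\<Sum>l<m * n. \<phi> (S $$ (j, l)) * w l)
      = t ^ Suc (j mod n) * (s ^ Suc (j div n) - A) + A * (t ^ Suc (j mod n) - B)"
      by (simp add: w_def algebra_simps)
    have "s ^ Suc (j div n) - A \<in> I"
      using companion_reduction[OF hom q(1), of "j div n" s] a I(1) qI
      unfolding A_def m_def s_hom by auto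
    moreover have "t ^ Suc (j mod n) - B \<in> I"
      using companion_reduction[OF hom f(1), of "j mod n" t] b I(1) fI
      unfolding B_def n_def poly_t_def t_hom by auto
    ultimately show ?thesis unfolding * by (intro I)
  qed
  have st: "[:0, [:0, 1:]:] = s * t" by (simp add: s_def t_def)
  have "poly_st h \<in> I"
  proof (cases "m * n = 0")
    \<comment> \<open>A monic polynomial of degree zero is 1, so the ideal is everything; there is
      no index 0 at which \<open>w\<close> could be evaluated. Otherwise
      \<open>w 0 = 1\<close>.\<close>
    case True
    then have "q = 1 \<or> f = 1" using q(1) f(1) unfolding m_def n_def by (auto elim: degree_eq_zeroE)
    then have "1 \<in> I" using qI fI by (auto simp: poly_s_def poly_t_def one_pCons)
    then show ?thesis using I(3)[of 1 "poly_st h"] by simp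
  next
    case False
    then have "poly (map_poly \<phi> h) (s * t) * w 0 \<in> I"
      unfolding h_def by (intro char_poly_annihilates_modulo_ideal[OF hom I S rel]) auto
    then show ?thesis unfolding poly_st_def st by (simp add: w_def \<phi>_def)
  qed
  then obtain u v where "poly_st h = poly_s q * u + poly_t f * v" unfolding I_def by blast
  moreover have "lead_coeff h = 1" unfolding h_def using degree_monic_char_poly[OF S] by simp
  moreover have "h \<in> Z_inv_poly \<pi>" unfolding h_def
    by (rule char_poly_of_Z_inv_mat[OF S])
      (use q f in \<open>auto simp: S_def intro!: Z_inv_mult companion_in_Z_inv\<close>)
  ultimately show ?thesis using that by blast
qed

section \<open>Rational vector spaces with an operator\<close>

text \<open>All rationals belong to the carrier of \<open>class_ring\<close>; the rules below
  restate the module axioms without side conditions on scalars.\<close>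

locale rat_vectorspace = vectorspace class_ring V for V :: "(rat, 'v, 'z) module_scheme" (structure)
begin

lemma smult_closed': "x \<in> carrier V \<Longrightarrow> a \<odot> x \<in> carrier V"
  using smult_closed[of a x] by simp

lemma smult_add_left: "x \<in> carrier V \<Longrightarrow> (a + b) \<odot> x = a \<odot> x \<oplus> b \<odot> x"
  using smult_l_distr[of a b x] by simp

lemma smult_add_right: "x \<in> carrier V \<Longrightarrow> y \<in> carrier V \<Longrightarrow> a \<odot> (x \<oplus> y) = a \<odot> x \<oplus> a \<odot> y"
  using smult_r_distr[of a x y] by simp

lemma smult_smult: "x \<in> carrier V \<Longrightarrow> a \<odot> (b \<odot> x) = (a * b) \<odot> x"
  using smult_assoc1[of a b x] by simp

lemma smult_1: "x \<in> carrier V \<Longrightarrow> 1 \<odot> x = x"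
  using smult_one[of x] by simp

lemma smult_0: "x \<in> carrier V \<Longrightarrow> 0 \<odot> x = \<zero>"
  using smult_l_null[of x] by simp

lemma smult_zero: "a \<odot> \<zero> = \<zero>"
  using smult_r_null[of a] by simp

lemma smult_neg: "x \<in> carrier V \<Longrightarrow> (- a) \<odot> x = \<ominus> (a \<odot> x)"
  using smult_l_minus[of a x] by (simp add: class_ring_simps)

lemma smult_finsum: "finite I \<Longrightarrow> g \<in> I \<rightarrow> carrier V \<Longrightarrow> a \<odot> (\<Oplus>i\<in>I. g i) = (\<Oplus>i\<in>I. a \<odot> g i)"
  using finsum_smult_ldistr[of I a g] by simp

lemma smult_eq_zeroD: "x \<in> carrier V \<Longrightarrow> a \<odot> x = \<zero> \<Longrightarrow> a \<noteq> 0 \<Longrightarrow> x = \<zero>"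
  using smult_smult[of x "inverse a" a] smult_zero by (simp add: smult_1)

lemma sum_smult: "finite I \<Longrightarrow> x \<in> carrier V \<Longrightarrow> (\<Sum>i\<in>I. c i) \<odot> x = (\<Oplus>i\<in>I. c i \<odot> x)"
  by (induction I rule: finite_induct)
    (auto simp: smult_0 smult_add_left smult_closed' finsum_insert Pi_def)

lemma finsum_swap:
  assumes "finite I" "finite J" "\<And>i j. i \<in> I \<Longrightarrow> j \<in> J \<Longrightarrow> g i j \<in> carrier V"
  shows "(\<Oplus>i\<in>I. \<Oplus>j\<in>J. g i j) = (\<Oplus>j\<in>J. \<Oplus>i\<in>I. g i j)"
  using assms
proof (induction I rule: finite_induct)
  case (insert i I)
  have "(\<Oplus>j\<in>J. \<Oplus>i\<in>insert i I. g i j) = (\<Oplus>j\<in>J. g i j \<oplus> (\<Oplus>i\<in>I. g i j))"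
    using insert by (intro finsum_cong') (auto simp: finsum_insert Pi_def)
  also have "\<dots> = (\<Oplus>j\<in>J. g i j) \<oplus> (\<Oplus>j\<in>J. \<Oplus>i\<in>I. g i j)"
    using insert.prems by (intro finsum_addf) auto
  finally show ?case using insert by (simp add: finsum_insert Pi_def)
qed (simp add: finsum_zero)

lemma submodule_finsum:
  assumes "submodule class_ring W V" "finite I" "\<And>i. i \<in> I \<Longrightarrow> g i \<in> W"
  shows "(\<Oplus>i\<in>I. g i) \<in> W"
proof -
  note W = submodule.subset[OF assms(1)] submodule.m_closed[OF assms(1)] submodule.zero_closed[OF assms(1)]
  show ?thesis using assms(2,3)
  proof (induction I rule: finite_induct)
    case (insert i I)
    have "g \<in> I \<rightarrow> carrier V" "g i \<in> carrier V" using insert W(1) by blast+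
    then show ?case using insert W by (simp add: finsum_insert)
  qed (simp add: W)
qed

text \<open>\<open>lin_det\<close> and \<open>lin_char_poly\<close> choose a matrix by
  \<open>SOME\<close>; without a witness nothing could be derived from that choice.\<close>

lemma represents_exists:
  assumes "fin_dim" "\<And>x. x \<in> carrier V \<Longrightarrow> f x \<in> carrier V"
  obtains bs A where "represents V f bs A"
proof -
  obtain B where B: "finite B" "basis B" using finite_basis_exists[OF assms(1)] by blast
  then have BC: "B \<subseteq> carrier V" and span: "span B = carrier V" by (auto simp: basis_def)
  obtain bs where bs: "set bs = B" "distinct bs" using finite_distinct_list[OF B(1)] by blast
  have inj: "inj_on ((!) bs) {..<length bs}" using bs by (auto simp: inj_on_nth)
  have im: "(!) bs ` {..<length bs} = B" using bs by (auto simp: set_conv_nth)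
  have "\<forall>j\<in>{..<length bs}. \<exists>c. f (bs ! j) = (\<Oplus>i\<in>{..<length bs}. c i \<odot> bs ! i)"
  proof
    fix j assume "j \<in> {..<length bs}"
    then have j: "j < length bs" by simp
    have "bs ! j \<in> carrier V" using nth_mem[OF j] bs(1) BC by blast
    then have "f (bs ! j) \<in> span B" unfolding span by (rule assms(2))
    then obtain a where "lincomb a B = f (bs ! j)" using finite_in_span[OF B(1) BC] by blast
    then have "f (bs ! j) = lincomb a B" by simp
    also have "\<dots> = (\<Oplus>i\<in>{..<length bs}. a (bs ! i) \<odot> bs ! i)"
      unfolding lincomb_def im[symmetric]
      by (subst finsum_reindex[OF _ inj]) (use BC smult_closed' in \<open>auto simp: im\<close>)
    finally show "\<exists>c. f (bs ! j) = (\<Oplus>i\<in>{..<length bs}. c i \<odot> bs ! i)"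
      by (intro exI[of _ "\<lambda>i. a (bs ! i)"])
  qed
  from bchoice[OF this] obtain c
    where c: "\<And>j. j < length bs \<Longrightarrow> f (bs ! j) = (\<Oplus>i\<in>{..<length bs}. c j i \<odot> bs ! i)"
    by blast
  have "represents V f bs (mat (length bs) (length bs) (\<lambda>(i, j). c j i))"
    unfolding represents_def
  proof (intro conjI allI impI)
    fix j assume j: "j < length bs"
    have "(\<Oplus>i\<in>{..<length bs}. c j i \<odot> bs ! i) =
      (\<Oplus>i\<in>{..<length bs}. mat (length bs) (length bs) (\<lambda>(i, j). c j i) $$ (i, j) \<odot> bs ! i)"
      using j bs BC smult_closed' by (intro finsum_cong') (auto simp: subset_iff)
    then show "f (bs ! j) = \<dots>" using c[OF j] by simp
  qed (use bs B in auto)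
  then show ?thesis using that by blast
qed

end

locale rat_operator = rat_vectorspace V for V :: "(rat, 'v, 'z) module_scheme" (structure) +
  fixes f :: "'v \<Rightarrow> 'v"
  assumes f_closed: "x \<in> carrier V \<Longrightarrow> f x \<in> carrier V"
    and f_add: "x \<in> carrier V \<Longrightarrow> y \<in> carrier V \<Longrightarrow> f (x \<oplus> y) = f x \<oplus> f y"
    and f_smult: "x \<in> carrier V \<Longrightarrow> f (a \<odot> x) = a \<odot> f x"
begin

text \<open>The value of p(f) at a vector, by Horner's scheme on vectors; no ring of operators has
  to be constructed.\<close>

definition pact :: "rat poly \<Rightarrow> 'v \<Rightarrow> 'v" where
  "pact p x = fold_coeffs (\<lambda>a v. a \<odot> x \<oplus> f v) p \<zero>"

lemma f_zero: "f \<zero> = \<zero>"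
  using f_smult[of \<zero> 0] by (simp add: smult_0 f_closed)

lemma f_neg: "x \<in> carrier V \<Longrightarrow> f (\<ominus> x) = \<ominus> f x"
  using f_smult[of x "-1"] by (simp add: smult_neg smult_1 f_closed)

lemma f_finsum: "finite I \<Longrightarrow> g \<in> I \<rightarrow> carrier V \<Longrightarrow> f (\<Oplus>i\<in>I. g i) = (\<Oplus>i\<in>I. f (g i))"
  by (induction I rule: finite_induct) (auto simp: f_zero f_add f_closed finsum_insert Pi_def)

lemma pact_0: "pact 0 x = \<zero>"
  by (simp add: pact_def)

lemma pact_pCons: "x \<in> carrier V \<Longrightarrow> pact (pCons a p) x = a \<odot> x \<oplus> f (pact p x)"
  by (cases "p = 0 \<and> a = 0") (auto simp: pact_def fold_coeffs_def cCons_def smult_0 f_zero)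

lemma pact_closed: "x \<in> carrier V \<Longrightarrow> pact p x \<in> carrier V"
  by (induction p) (auto simp: pact_0 pact_pCons f_closed smult_closed')

lemma pact_const: "x \<in> carrier V \<Longrightarrow> pact [:a:] x = a \<odot> x"
  by (simp add: pact_pCons pact_0 f_zero smult_closed')

lemma pact_add_vec: "x \<in> carrier V \<Longrightarrow> y \<in> carrier V \<Longrightarrow> pact p (x \<oplus> y) = pact p x \<oplus> pact p y"
  by (induction p) (auto simp: pact_0 pact_pCons f_add f_closed smult_closed' smult_add_right pact_closed a_ac)

lemma pact_smult_vec: "x \<in> carrier V \<Longrightarrow> pact p (a \<odot> x) = a \<odot> pact p x"
  by (induction p) (auto simp: pact_0 pact_pCons f_smult f_closed smult_closed' smult_add_right smult_zero
    pact_closed smult_smult mult.commute)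

lemma pact_add: "x \<in> carrier V \<Longrightarrow> pact (p + q) x = pact p x \<oplus> pact q x"
  by (induction p q rule: poly_induct2)
    (auto simp: pact_0 pact_pCons f_add f_closed smult_closed' smult_add_left pact_closed a_ac)

lemma pact_smult: "x \<in> carrier V \<Longrightarrow> pact (Polynomial.smult a p) x = a \<odot> pact p x"
  by (induction p) (auto simp: pact_0 pact_pCons f_smult f_closed smult_closed' smult_add_right smult_zero
    pact_closed smult_smult)

lemma pact_mult: "x \<in> carrier V \<Longrightarrow> pact (p * q) x = pact p (pact q x)"
  by (induction p) (auto simp: pact_0 pact_pCons pact_add pact_smult pact_closed smult_0 smult_closed' f_closed)

lemma pact_f: "x \<in> carrier V \<Longrightarrow> pact p (f x) = f (pact p x)"
  by (induction p) (auto simp: pact_0 pact_pCons f_zero f_add f_smult f_closed smult_closed' pact_closed)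

text \<open>The bridge between the two Horner schemes: column \<open>j\<close> of p(A) holds the
  coordinates of p(f) at the j-th basis vector. It carries Cayley-Hamilton from matrices to
  operators, and annihilating polynomials back to matrices.\<close>

lemma pact_basis:
  assumes rep: "represents V f bs A" and j: "j < length bs"
  shows "pact p (bs ! j) = (\<Oplus>i\<in>{..<length bs}. mat_poly A p $$ (i, j) \<odot> bs ! i)"
proof -
  define k where "k = length bs"
  have A: "A \<in> carrier_mat k k" and C: "set bs \<subseteq> carrier V"
    and f_bs: "\<And>j. j < k \<Longrightarrow> f (bs ! j) = (\<Oplus>i\<in>{..<k}. A $$ (i, j) \<odot> bs ! i)"
    using rep by (auto simp: represents_def basis_def k_def)
  have bs: "bs ! i \<in> carrier V" if "i < k" for i using that C by (auto simp: k_def)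
  note closed = smult_closed'[OF bs] f_closed[OF bs]
  have "pact p (bs ! j) = (\<Oplus>i\<in>{..<k}. mat_poly A p $$ (i, j) \<odot> bs ! i)"
  proof (induction p)
    case 0
    have "(\<Oplus>i\<in>{..<k}. mat_poly A 0 $$ (i, j) \<odot> bs ! i) = (\<Oplus>i\<in>{..<k}. \<zero>)"
      using j A bs by (intro finsum_cong') (auto simp: mat_poly_0[OF A] smult_0 k_def)
    then show ?case by (simp add: pact_0 finsum_zero)
  next
    case (pCons a p)
    let ?F = "mat_poly A p"
    have F: "?F \<in> carrier_mat k k" by (rule mat_poly_carrier[OF A])
    have "f (pact p (bs ! j)) = (\<Oplus>l\<in>{..<k}. f (?F $$ (l, j) \<odot> bs ! l))"
      unfolding pCons.IH by (rule f_finsum) (auto intro: closed)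
    also have "\<dots> = (\<Oplus>l\<in>{..<k}. \<Oplus>i\<in>{..<k}. (?F $$ (l, j) * A $$ (i, l)) \<odot> bs ! i)"
    proof (rule finsum_cong')
      fix l assume "l \<in> {..<k}"
      then have l: "l < k" by simp
      have "f (?F $$ (l, j) \<odot> bs ! l) = ?F $$ (l, j) \<odot> (\<Oplus>i\<in>{..<k}. A $$ (i, l) \<odot> bs ! i)"
        using f_smult[OF bs[OF l]] f_bs[OF l] by simp
      also have "\<dots> = (\<Oplus>i\<in>{..<k}. ?F $$ (l, j) \<odot> (A $$ (i, l) \<odot> bs ! i))"
        by (rule smult_finsum) (auto intro: closed)
      also have "\<dots> = (\<Oplus>i\<in>{..<k}. (?F $$ (l, j) * A $$ (i, l)) \<odot> bs ! i)"
        by (rule finsum_cong') (auto simp: smult_smult bs intro: closed)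
      finally show "f (?F $$ (l, j) \<odot> bs ! l) = \<dots>" .
    qed (auto intro!: finsum_closed closed)
    also have "\<dots> = (\<Oplus>i\<in>{..<k}. \<Oplus>l\<in>{..<k}. (?F $$ (l, j) * A $$ (i, l)) \<odot> bs ! i)"
      by (rule finsum_swap) (auto intro: closed)
    also have "\<dots> = (\<Oplus>i\<in>{..<k}. (\<Sum>l<k. ?F $$ (l, j) * A $$ (i, l)) \<odot> bs ! i)"
      by (rule finsum_cong') (auto simp: sum_smult bs intro: closed)
    finally have f: "f (pact p (bs ! j)) = \<dots>" .
    have "(\<Oplus>i\<in>{..<k}. (if i = j then a else 0) \<odot> bs ! i)
      = (\<Oplus>i\<in>{..<k}. if j = i then a \<odot> bs ! i else \<zero>)"
      by (rule finsum_cong') (auto simp: smult_0 bs intro: closed)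
    also have "\<dots> = a \<odot> bs ! j"
      by (rule finsum_singleton) (use j in \<open>auto simp: k_def[symmetric] intro: closed\<close>)
    finally have "pact (pCons a p) (bs ! j) = (\<Oplus>i\<in>{..<k}. (if i = j then a else 0) \<odot> bs ! i)
      \<oplus> (\<Oplus>i\<in>{..<k}. (\<Sum>l<k. ?F $$ (l, j) * A $$ (i, l)) \<odot> bs ! i)"
      using pact_pCons[OF bs, of j a p] f j by (simp add: k_def)
    also have "\<dots> = (\<Oplus>i\<in>{..<k}. (if i = j then a else 0) \<odot> bs ! i
        \<oplus> (\<Sum>l<k. ?F $$ (l, j) * A $$ (i, l)) \<odot> bs ! i)"
      by (rule finsum_addf[symmetric]) (auto intro: closed)
    also have "\<dots> = (\<Oplus>i\<in>{..<k}. mat_poly A (pCons a p) $$ (i, j) \<odot> bs ! i)"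
    proof (rule finsum_cong')
      fix i assume "i \<in> {..<k}"
      then have i: "i < k" by simp
      have "mat_poly A (pCons a p) $$ (i, j) = (if i = j then a else 0) + (\<Sum>l<k. ?F $$ (l, j) * A $$ (i, l))"
        using i j A F by (simp add: mat_poly_pCons k_def[symmetric] scalar_prod_def lessThan_atLeast0 ac_simps)
      then show "(if i = j then a else 0) \<odot> bs ! i \<oplus> (\<Sum>l<k. ?F $$ (l, j) * A $$ (i, l)) \<odot> bs ! i
          = mat_poly A (pCons a p) $$ (i, j) \<odot> bs ! i"
        using smult_add_left[OF bs[OF i]] by simp
    qed (auto intro: closed)
    finally show ?case .
  qed
  then show ?thesis by (simp add: k_def)
qed

text \<open>The kernel of this operator is a submodule, and by \<open>pact_basis\<close> and
  Cayley-Hamilton it contains the basis.\<close>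

lemma pact_char_poly:
  assumes rep: "represents V f bs A" and x: "x \<in> carrier V"
  shows "pact (char_poly A) x = \<zero>"
proof -
  have A: "A \<in> carrier_mat (length bs) (length bs)" and C: "set bs \<subseteq> carrier V" and span: "span (set bs) = carrier V"
    using rep by (auto simp: represents_def basis_def)
  define W where "W = {x \<in> carrier V. pact (char_poly A) x = \<zero>}"
  have W: "submodule class_ring W V"
  proof
    show "\<zero> \<in> W" using pact_smult_vec[of \<zero> "char_poly A" 0] by (simp add: W_def smult_0 pact_closed)
  qed (auto simp: W_def pact_add_vec pact_smult_vec smult_closed' smult_zero)
  have "pact (char_poly A) (bs ! j) = \<zero>" if j: "j < length bs" for j
  proof -
    have "pact (char_poly A) (bs ! j) = (\<Oplus>i\<in>{..<length bs}. \<zero>)"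
      unfolding pact_basis[OF rep j] using A C j
      by (intro finsum_cong') (auto simp: cayley_hamilton_mat_poly[OF A] smult_0 subset_iff)
    then show ?thesis by (simp add: finsum_zero)
  qed
  then have "set bs \<subseteq> W"
    unfolding W_def subset_iff mem_Collect_eq by (metis C in_set_conv_nth subsetD)
  then have "span (set bs) \<subseteq> W" by (rule span_is_subset[OF _ W])
  then have "x \<in> W" using x unfolding span by blast
  then show ?thesis by (simp add: W_def)
qed

lemma mat_poly_eq_zero:
  assumes rep: "represents V f bs A" and zero: "\<And>x. x \<in> carrier V \<Longrightarrow> pact p x = \<zero>"
  shows "mat_poly A p = 0\<^sub>m (length bs) (length bs)"
proof -
  define k where "k = length bs"
  have A: "A \<in> carrier_mat k k" and C: "set bs \<subseteq> carrier V" and li: "lin_indpt (set bs)"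
    and dist: "distinct bs"
    using rep by (auto simp: represents_def basis_def k_def)
  have inj: "inj_on ((!) bs) {..<k}" using dist by (auto simp: inj_on_nth k_def)
  have im: "set bs = (!) bs ` {..<k}" by (auto simp: set_conv_nth k_def)
  have "mat_poly A p $$ (i, j) = 0" if ij: "i < k" "j < k" for i j
  proof (rule ccontr)
    assume nz: "mat_poly A p $$ (i, j) \<noteq> 0"
    define a where "a = (\<lambda>v. mat_poly A p $$ (the_inv_into {..<k} ((!) bs) v, j))"
    have a: "a (bs ! i) = mat_poly A p $$ (i, j)" if "i < k" for i
      using the_inv_into_f_f[OF inj, of i] that by (simp add: a_def)
    have "lincomb a (set bs) = (\<Oplus>i\<in>{..<k}. a (bs ! i) \<odot> bs ! i)"
      unfolding lincomb_def im
      by (subst finsum_reindex[OF _ inj]) (use C smult_closed' in \<open>auto simp: im\<close>)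
    also have "\<dots> = (\<Oplus>i\<in>{..<k}. mat_poly A p $$ (i, j) \<odot> bs ! i)"
      using C by (intro finsum_cong') (auto simp: a im intro!: smult_closed')
    also have "\<dots> = \<zero>"
      using pact_basis[OF rep, of j p] zero[of "bs ! j"] ij C nth_mem[of j bs] by (auto simp: k_def subset_iff)
    finally have "lin_dep (set bs)"
      using nz a ij by (intro lin_dep_crit[of "set bs" _ a "bs ! i"]) (auto simp: im)
    then show False using li by simp
  qed
  then show ?thesis using mat_poly_carrier[OF A, of p] unfolding k_def[symmetric]
    by (intro eq_matI) auto
qed

end

section \<open>Dynkin indices and comparison of coefficients\<close>

text \<open>Level 1 is the centre of the Lie algebra. Testing left brackets suffices, since
  \<open>bracket_swap\<close> gives the other side.\<close>

primrec lie_upper_central :: "(rat, 'v, 'z) lie_algebra_scheme \<Rightarrow> nat \<Rightarrow> 'v set" where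
  "lie_upper_central L 0 = {\<zero>\<^bsub>L\<^esub>}"
| "lie_upper_central L (Suc i) = {x \<in> carrier L. \<forall>y \<in> carrier L. \<lbrakk>x, y\<rbrakk>\<^bsub>L\<^esub> \<in> lie_upper_central L i}"

lemma dynkin_weight_simps [simp]:
  "dynkin_weight [] = 0" "dynkin_weight ((r, s) # rs) = r + s + dynkin_weight rs"
  by (simp_all add: dynkin_weight_def)

lemma dynkin_word_simps [simp]:
  "dynkin_word X Y [] = []"
  "dynkin_word X Y ((r, s) # rs) = replicate r X @ replicate s Y @ dynkin_word X Y rs"
  by (simp_all add: dynkin_word_def)

lemma length_dynkin_word: "length (dynkin_word X Y rs) = dynkin_weight rs"
  by (induction rs) auto

lemma set_dynkin_word: "set (dynkin_word X Y rs) \<subseteq> {X, Y}"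
  by (induction rs) (auto split: if_splits)

lemma map_dynkin_word: "map h (dynkin_word X Y rs) = dynkin_word (h X) (h Y) rs"
  by (induction rs) auto

text \<open>These index the linear terms X and Y; the truncation retains them only from
  \<open>c = 1\<close> on.\<close>

lemma dynkin_indices_weight_1:
  assumes "1 \<le> c"
  shows "{rs \<in> dynkin_indices c. dynkin_weight rs < 2} = {[(1, 0)], [(0, 1)]}"
proof -
  have "rs = [(1, 0)] \<or> rs = [(0, 1)]" if rs: "rs \<in> dynkin_indices c" "dynkin_weight rs < 2" for rs
  proof -
    obtain r s rs' where eq: "rs = (r, s) # rs'" using rs by (cases rs) (auto simp: dynkin_indices_def)
    have "rs' = []"
    proof (rule ccontr)
      assume "rs' \<noteq> []"
      then obtain r' s' rs'' where "rs' = (r', s') # rs''" by (cases rs') auto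
      then show False using rs eq by (auto simp: dynkin_indices_def)
    qed
    then show ?thesis using rs eq by (cases r; cases s) (auto simp: dynkin_indices_def)
  qed
  then show ?thesis using assms by (auto simp: dynkin_indices_def)
qed

lemma dynkin_indices_weight_2:
  assumes "2 \<le> c"
  shows "{rs \<in> dynkin_indices c. dynkin_weight rs = 2}
    = {[(2, 0)], [(1, 1)], [(0, 2)], [(1, 0), (1, 0)], [(1, 0), (0, 1)], [(0, 1), (1, 0)], [(0, 1), (0, 1)]}"
    (is "_ = ?S")
proof -
  have "rs \<in> ?S" if rs: "rs \<in> dynkin_indices c" "dynkin_weight rs = 2" for rs
  proof -
    obtain r s rs' where eq: "rs = (r, s) # rs'" using rs by (cases rs) (auto simp: dynkin_indices_def)
    then have le: "r + s \<le> 2" "r + s \<noteq> 0" using rs by (auto simp: dynkin_indices_def)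
    show ?thesis
    proof (cases rs')
      case Nil
      then have "r + s = 2" using rs eq by simp
      then have "(r = 0 \<and> s = 2) \<or> (r = 1 \<and> s = 1) \<or> (r = 2 \<and> s = 0)" by arith
      then show ?thesis using Nil eq by auto
    next
      case (Cons p rs'')
      obtain r' s' where p: "p = (r', s')" by (cases p)
      have pos': "r' + s' \<noteq> 0" using rs eq Cons p by (auto simp: dynkin_indices_def)
      have sum: "r + s + (r' + s' + dynkin_weight rs'') = 2" using rs eq Cons p by simp
      have "rs'' = []"
      proof (cases rs'')
        case (Cons p' rs3)
        obtain r'' s'' where p': "p' = (r'', s'')" by (cases p')
        have "r'' + s'' \<noteq> 0" using rs eq \<open>rs' = _\<close> p Cons p' by (auto simp: dynkin_indices_def)
        moreover have "dynkin_weight rs'' = r'' + s'' + dynkin_weight rs3" using Cons p' by simp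
        ultimately show ?thesis using sum le pos' by linarith
      qed simp
      moreover have "(r = 0 \<and> s = 1 \<or> r = 1 \<and> s = 0) \<and> (r' = 0 \<and> s' = 1 \<or> r' = 1 \<and> s' = 0)"
        using sum le pos' by arith
      ultimately show ?thesis using eq Cons p by auto
    qed
  qed
  moreover have "?S \<subseteq> {rs \<in> dynkin_indices c. dynkin_weight rs = 2}"
    using assms by (simp add: dynkin_indices_def)
  ultimately show ?thesis by blast
qed

sublocale rational_lie_algebra \<subseteq> rat_vectorspace L
  by unfold_locales

context rat_vectorspace
begin

text \<open>Comparing coefficients of \<open>t\<^sup>d\<close>: replacing \<open>t\<close> by \<open>2t\<close> and subtracting \<open>2\<^sup>e\<close> times the identity
  removes the terms of weight \<open>e\<close>.\<close>

lemma weight_component_eq: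
  fixes w :: "'i \<Rightarrow> nat"
  assumes I: "finite I" and c: "\<And>i. i \<in> I \<Longrightarrow> w i \<le> c"
    and ab: "a \<in> I \<rightarrow> carrier V" "b \<in> I \<rightarrow> carrier V"
    and eq: "\<And>n. n > 0 \<Longrightarrow> (\<Oplus>i\<in>I. (of_nat n ^ w i) \<odot> a i) = (\<Oplus>i\<in>I. (of_nat n ^ w i) \<odot> b i)"
  shows "(\<Oplus>i\<in>{i \<in> I. w i = d}. a i) = (\<Oplus>i\<in>{i \<in> I. w i = d}. b i)"
proof -
  \<comment> \<open>The accumulated factor: it vanishes exactly at the indices whose weight lies in
    \<open>D\<close>.\<close>
  define P where "P = (\<lambda>D i. \<Prod>e\<in>D. (2 ^ w i - 2 ^ e :: rat))"
  have "(\<Oplus>i\<in>I. (of_nat n ^ w i) \<odot> (P D i \<odot> a i)) = (\<Oplus>i\<in>I. (of_nat n ^ w i) \<odot> (P D i \<odot> b i))"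
    if "finite D" "n > 0" for D n
    using that
  proof (induction D arbitrary: n rule: finite_induct)
    case empty
    have "(\<Oplus>i\<in>I. (of_nat n ^ w i) \<odot> (P {} i \<odot> g i)) = (\<Oplus>i\<in>I. (of_nat n ^ w i) \<odot> g i)"
      if "g \<in> I \<rightarrow> carrier V" for g
      using that by (intro finsum_cong') (auto simp: P_def smult_1 smult_closed' Pi_iff)
    then show ?case using eq[OF empty] ab by simp
  next
    case (insert e D)
    \<comment> \<open>The factor for \<open>e\<close> arises from the sum at \<open>2 * n\<close>
      minus \<open>2 ^ e\<close> times the sum at \<open>n\<close>; hence the induction keeps
      \<open>n\<close> arbitrary.\<close>
    have "(\<Oplus>i\<in>I. (of_nat n ^ w i) \<odot> (P (insert e D) i \<odot> g i))
      = (\<Oplus>i\<in>I. (of_nat (2 * n) ^ w i) \<odot> (P D i \<odot> g i))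
        \<oplus> (- (2 ^ e)) \<odot> (\<Oplus>i\<in>I. (of_nat n ^ w i) \<odot> (P D i \<odot> g i))"
      if g: "g \<in> I \<rightarrow> carrier V" for g
    proof -
      have gc: "g i \<in> carrier V" if "i \<in> I" for i using g that by auto
      have "(\<Oplus>i\<in>I. (of_nat n ^ w i) \<odot> (P (insert e D) i \<odot> g i))
        = (\<Oplus>i\<in>I. (of_nat (2 * n) ^ w i) \<odot> (P D i \<odot> g i)
          \<oplus> (- (2 ^ e)) \<odot> ((of_nat n ^ w i) \<odot> (P D i \<odot> g i)))"
      proof (rule finsum_cong')
        fix i assume i: "i \<in> I"
        have "of_nat n ^ w i * P (insert e D) i = of_nat (2 * n) ^ w i * P D i + - (2 ^ e) * (of_nat n ^ w i * P D i)"
          using insert.hyps by (simp add: P_def algebra_simps power_mult_distrib)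
        then show "(of_nat n ^ w i) \<odot> (P (insert e D) i \<odot> g i) = (of_nat (2 * n) ^ w i) \<odot> (P D i \<odot> g i)
          \<oplus> (- (2 ^ e)) \<odot> ((of_nat n ^ w i) \<odot> (P D i \<odot> g i))"
          using gc[OF i] by (simp only: smult_smult smult_closed' smult_add_left[symmetric] mult.assoc)
      qed (auto intro!: smult_closed' gc)
      also have "\<dots> = (\<Oplus>i\<in>I. (of_nat (2 * n) ^ w i) \<odot> (P D i \<odot> g i))
        \<oplus> (\<Oplus>i\<in>I. (- (2 ^ e)) \<odot> ((of_nat n ^ w i) \<odot> (P D i \<odot> g i)))"
        by (rule finsum_addf) (auto intro!: smult_closed' gc)
      also have "(\<Oplus>i\<in>I. (- (2 ^ e)) \<odot> ((of_nat n ^ w i) \<odot> (P D i \<odot> g i)))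
        = (- (2 ^ e)) \<odot> (\<Oplus>i\<in>I. (of_nat n ^ w i) \<odot> (P D i \<odot> g i))"
        by (rule smult_finsum[symmetric, OF I]) (auto intro!: smult_closed' gc)
      finally show ?thesis .
    qed
    from this[OF ab(1)] this[OF ab(2)] show ?case using insert.IH[of n] insert.IH[of "2 * n"] insert.prems by simp
  qed
  \<comment> \<open>Removing every weight up to \<open>c\<close> except \<open>d\<close> leaves the
    component of weight \<open>d\<close> times the constant \<open>r\<close> below, which is
    non-zero as a product of differences of distinct powers of 2.\<close>
  from this[of "{..c} - {d}" 1]
  have eq1: "(\<Oplus>i\<in>I. P ({..c} - {d}) i \<odot> a i) = (\<Oplus>i\<in>I. P ({..c} - {d}) i \<odot> b i)"
  proof -
    assume *: "finite ({..c} - {d}) \<Longrightarrow> 0 < (1 :: nat) \<Longrightarrow>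
      (\<Oplus>i\<in>I. (of_nat 1 ^ w i) \<odot> (P ({..c} - {d}) i \<odot> a i))
      = (\<Oplus>i\<in>I. (of_nat 1 ^ w i) \<odot> (P ({..c} - {d}) i \<odot> b i))"
    have "(\<Oplus>i\<in>I. (of_nat 1 ^ w i) \<odot> (P ({..c} - {d}) i \<odot> g i)) = (\<Oplus>i\<in>I. P ({..c} - {d}) i \<odot> g i)"
      if "g \<in> I \<rightarrow> carrier V" for g
      using that by (intro finsum_cong') (auto simp: smult_1 smult_closed' Pi_iff)
    then show ?thesis using * ab by simp
  qed
  define r where "r = (\<Prod>e\<in>{..c} - {d}. (2 ^ d - 2 ^ e :: rat))"
  have r: "r \<noteq> 0" unfolding r_def by simp
  have restrict: "(\<Oplus>i\<in>I. P ({..c} - {d}) i \<odot> g i) = r \<odot> (\<Oplus>i\<in>{i \<in> I. w i = d}. g i)"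
    if g: "g \<in> I \<rightarrow> carrier V" for g
  proof -
    have gc: "g i \<in> carrier V" if "i \<in> I" for i using g that by auto
    have zero: "P ({..c} - {d}) i \<odot> g i = \<zero>" if "i \<in> I - {i \<in> I. w i = d}" for i
    proof -
      have "P ({..c} - {d}) i = 0" unfolding P_def
        by (rule prod_zero) (use that c[of i] in auto)
      then show ?thesis using that gc by (simp add: smult_0)
    qed
    have "(\<Oplus>i\<in>I. P ({..c} - {d}) i \<odot> g i) = (\<Oplus>i\<in>{i \<in> I. w i = d}. P ({..c} - {d}) i \<odot> g i)"
      by (rule add.finprod_mono_neutral_cong_right[OF I]) (use zero in \<open>auto intro!: smult_closed' gc\<close>)
    also have "\<dots> = (\<Oplus>i\<in>{i \<in> I. w i = d}. r \<odot> g i)"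
      by (rule finsum_cong') (auto simp: P_def r_def intro!: smult_closed' gc)
    also have "\<dots> = r \<odot> (\<Oplus>i\<in>{i \<in> I. w i = d}. g i)"
      by (rule smult_finsum[symmetric]) (use I gc in auto)
    finally show ?thesis .
  qed
  have closed: "(\<Oplus>i\<in>{i \<in> I. w i = d}. g i) \<in> carrier V" if "g \<in> I \<rightarrow> carrier V" for g
    using that by (intro finsum_closed) auto
  have "inverse r \<odot> (r \<odot> (\<Oplus>i\<in>{i \<in> I. w i = d}. a i)) = inverse r \<odot> (r \<odot> (\<Oplus>i\<in>{i \<in> I. w i = d}. b i))"
    using eq1 restrict ab by simp
  then show ?thesis using r closed[OF ab(1)] closed[OF ab(2)] by (simp add: smult_smult smult_1)
qed

end

section \<open>Nilpotent Lie algebras and the Baker-Campbell-Hausdorff product\<close>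

context rational_lie_algebra
begin

abbreviation "U \<equiv> lie_upper_central L"

definition dynkin_term :: "'v \<Rightarrow> 'v \<Rightarrow> (nat \<times> nat) list \<Rightarrow> 'v" where
  "dynkin_term X Y rs = dynkin_coeff rs \<odot> right_normed L (dynkin_word X Y rs)"

lemma bracket_zero: "x \<in> carrier L \<Longrightarrow> \<lbrakk>\<zero>, x\<rbrakk> = \<zero>" "x \<in> carrier L \<Longrightarrow> \<lbrakk>x, \<zero>\<rbrakk> = \<zero>"
  using bracket_smult_left[of \<zero> x 0] bracket_smult_right[of x \<zero> 0]
  by (simp_all add: smult_0 bracket_closed)

lemma bracket_swap:
  assumes "x \<in> carrier L" "y \<in> carrier L" shows "\<lbrakk>x, y\<rbrakk> = \<ominus> \<lbrakk>y, x\<rbrakk>"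
proof -
  have "\<lbrakk>x \<oplus> y, x \<oplus> y\<rbrakk> = \<lbrakk>x, x \<oplus> y\<rbrakk> \<oplus> \<lbrakk>y, x \<oplus> y\<rbrakk>"
    by (rule bracket_add_left) (use assms in auto)
  also have "\<dots> = \<lbrakk>x, y\<rbrakk> \<oplus> \<lbrakk>y, x\<rbrakk>"
    using assms by (simp add: bracket_add_right bracket_self bracket_closed)
  finally have "\<lbrakk>x, y\<rbrakk> \<oplus> \<lbrakk>y, x\<rbrakk> = \<zero>" using assms by (simp add: bracket_self)
  then show ?thesis using minus_equality[of "\<lbrakk>x, y\<rbrakk>" "\<lbrakk>y, x\<rbrakk>"] assms bracket_closed by simp
qed

lemma right_normed_closed: "set w \<subseteq> carrier L \<Longrightarrow> right_normed L w \<in> carrier L"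
proof (induction w)
  case (Cons x w)
  then show ?case by (cases w) (auto intro: bracket_closed)
qed simp

lemma dynkin_word_carrier: "X \<in> carrier L \<Longrightarrow> Y \<in> carrier L \<Longrightarrow> set (dynkin_word X Y rs) \<subseteq> carrier L"
  using set_dynkin_word[of X Y rs] by auto

lemma dynkin_term_closed: "X \<in> carrier L \<Longrightarrow> Y \<in> carrier L \<Longrightarrow> dynkin_term X Y rs \<in> carrier L"
  unfolding dynkin_term_def by (intro smult_closed' right_normed_closed dynkin_word_carrier)

lemma bch_altdef: "bch L c X Y = (\<Oplus>rs\<in>dynkin_indices c. dynkin_term X Y rs)"
  by (simp add: bch_def dynkin_term_def)

lemma bch_closed: "X \<in> carrier L \<Longrightarrow> Y \<in> carrier L \<Longrightarrow> bch L c X Y \<in> carrier L"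
  unfolding bch_altdef by (intro finsum_closed) (auto intro: dynkin_term_closed)

lemma upper_central_closed: "x \<in> U i \<Longrightarrow> x \<in> carrier L"
  by (cases i) auto

lemma upper_central_submodule: "submodule class_ring (U i) L"
proof (induction i)
  case 0
  show ?case by unfold_locales (auto simp: smult_zero)
next
  case (Suc i)
  note IH = submodule.m_closed[OF Suc] submodule.zero_closed[OF Suc]
    submodule.smult_closed[OF Suc, simplified]
  show ?case
    by unfold_locales (auto simp: bracket_add_left bracket_smult_left bracket_zero smult_closed' intro!: IH)
qed

lemmas upper_central_add = submodule.m_closed[OF upper_central_submodule]
lemmas upper_central_zero = submodule.zero_closed[OF upper_central_submodule]
lemmas upper_central_smult = submodule.smult_closed[OF upper_central_submodule, simplified]

lemma upper_central_neg: "x \<in> U i \<Longrightarrow> \<ominus> x \<in> U i"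
  using upper_central_smult[of x i "-1"] upper_central_closed[of x i] by (simp add: smult_neg smult_1)

lemma upper_central_bracket:
  assumes "x \<in> U (Suc i)" "y \<in> carrier L" shows "\<lbrakk>x, y\<rbrakk> \<in> U i" "\<lbrakk>y, x\<rbrakk> \<in> U i"
proof -
  show *: "\<lbrakk>x, y\<rbrakk> \<in> U i" using assms by simp
  have "\<lbrakk>y, x\<rbrakk> = \<ominus> \<lbrakk>x, y\<rbrakk>" by (rule bracket_swap) (use assms in auto)
  then show "\<lbrakk>y, x\<rbrakk> \<in> U i" using upper_central_neg[OF *] by simp
qed

lemma upper_central_mono: "x \<in> U i \<Longrightarrow> x \<in> U (Suc i)"
  by (induction i arbitrary: x) (auto simp: bracket_zero)

lemma upper_central_ideal: "x \<in> U i \<Longrightarrow> y \<in> carrier L \<Longrightarrow> \<lbrakk>y, x\<rbrakk> \<in> U i"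
  using upper_central_bracket(2)[OF upper_central_mono] by blast

text \<open>By induction on \<open>j\<close>, right-normed products of length
  \<open>c + 1 - j\<close> lie in \<open>U j\<close>, because prefixing one more letter lands in the
  level below. For \<open>j = c\<close> these are single elements.\<close>

lemma upper_central_eq_carrier:
  assumes "lie_nilpotent_class_le L c" shows "U c = carrier L"
proof -
  have "right_normed L w \<in> U j" if "set w \<subseteq> carrier L" "length w + j = Suc c" "j \<le> c" for w j
    using that
  proof (induction j arbitrary: w)
    case 0
    then show ?case using assms by (auto simp: lie_nilpotent_class_le_def)
  next
    case (Suc j)
    have closed: "right_normed L w \<in> carrier L" using Suc.prems(1) by (rule right_normed_closed)
    have "\<lbrakk>right_normed L w, y\<rbrakk> \<in> U j" if y: "y \<in> carrier L" for y
    proof -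
      have "w \<noteq> []" using Suc.prems by auto
      then have "right_normed L (y # w) = \<lbrakk>y, right_normed L w\<rbrakk>" by (cases w) auto
      moreover have "right_normed L (y # w) \<in> U j" using Suc.prems y by (intro Suc.IH) auto
      ultimately show ?thesis
        using bracket_swap[OF closed y] upper_central_neg by simp
    qed
    then show ?case using closed by simp
  qed
  from this[of "[x]" c for x] show ?thesis using upper_central_closed by auto
qed

text \<open>The innermost bracket either involves X, and so lies in \<open>U i\<close>, or is the
  bracket of Y with itself and vanishes. The outer brackets stay in the ideal
  \<open>U i\<close>.\<close>

lemma right_normed_upper_central:
  assumes X: "X \<in> U (Suc i)" and Y: "Y \<in> carrier L"
  shows "set w \<subseteq> {X, Y} \<Longrightarrow> 2 \<le> length w \<Longrightarrow> right_normed L w \<in> U i"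
proof (induction w)
  case (Cons a w)
  have XC: "X \<in> carrier L" by (rule upper_central_closed[OF X])
  have a: "a \<in> carrier L" using Cons.prems XC Y by auto
  show ?case
  proof (cases "length w = 1")
    case True
    then obtain b where w: "w = [b]" by (cases w) auto
    have "a = X \<or> b = X \<or> a = Y \<and> b = Y" "b \<in> carrier L" using Cons.prems w XC Y by auto
    then show ?thesis
      using upper_central_bracket[OF X a] upper_central_bracket[OF X, of b] bracket_self[OF Y]
        upper_central_zero w by auto
  next
    case False
    then obtain b v where w: "w = b # v" using Cons.prems by (cases w) auto
    have "right_normed L w \<in> U i" using Cons False by auto
    then show ?thesis using upper_central_ideal[OF _ a] w by simp
  qed
qed simp

lemma bch_split:
  assumes "1 \<le> c" "X \<in> carrier L" "Y \<in> carrier L"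
  shows "bch L c X Y = X \<oplus> Y \<oplus> (\<Oplus>rs\<in>{rs \<in> dynkin_indices c. 2 \<le> dynkin_weight rs}. dynkin_term X Y rs)"
proof -
  let ?A = "{rs \<in> dynkin_indices c. dynkin_weight rs < 2}"
  let ?B = "{rs \<in> dynkin_indices c. 2 \<le> dynkin_weight rs}"
  have AB: "dynkin_indices c = ?A \<union> ?B" by auto
  have "bch L c X Y = (\<Oplus>rs\<in>?A \<union> ?B. dynkin_term X Y rs)"
    unfolding bch_altdef by (subst AB) (rule refl)
  also have "\<dots> = (\<Oplus>rs\<in>?A. dynkin_term X Y rs) \<oplus> (\<Oplus>rs\<in>?B. dynkin_term X Y rs)"
  proof (rule finsum_Un_disjoint)
    show "dynkin_term X Y \<in> ?A \<rightarrow> carrier L" "dynkin_term X Y \<in> ?B \<rightarrow> carrier L"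
      using dynkin_term_closed[OF assms(2,3)] by (blast intro: Pi_I)+
    show "?A \<inter> ?B = {}" by auto
  qed (simp_all add: finite_dynkin_indices)
  also have "(\<Oplus>rs\<in>?A. dynkin_term X Y rs) = X \<oplus> Y"
    unfolding dynkin_indices_weight_1[OF assms(1)]
    using assms by (simp add: finsum_insert dynkin_term_closed) (simp add: dynkin_term_def dynkin_coeff_def smult_1)
  finally show ?thesis .
qed

text \<open>Every term beyond X and Y comes from a word of length at least 2. This makes group
  multiplication additive modulo the next lower level.\<close>

lemma bch_upper_central:
  assumes c: "lie_nilpotent_class_le L c" and X: "X \<in> U (Suc i)" and Y: "Y \<in> carrier L"
  obtains z where "z \<in> U i" "bch L c X Y = X \<oplus> Y \<oplus> z"
proof (cases "1 \<le> c")
  case True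
  have "(\<Oplus>rs\<in>{rs \<in> dynkin_indices c. 2 \<le> dynkin_weight rs}. dynkin_term X Y rs) \<in> U i"
  proof (rule submodule_finsum[OF upper_central_submodule])
    show "dynkin_term X Y rs \<in> U i" if "rs \<in> {rs \<in> dynkin_indices c. 2 \<le> dynkin_weight rs}" for rs
      unfolding dynkin_term_def using that
      by (intro upper_central_smult right_normed_upper_central[OF X Y])
        (auto simp: length_dynkin_word set_dynkin_word)
  qed (simp add: finite_dynkin_indices)
  then show ?thesis using that bch_split[OF True upper_central_closed[OF X] Y] by blast
next
  \<comment> \<open>For \<open>c = 0\<close> the truncated series loses even its linear terms, but
    then the Lie algebra is zero.\<close>
  case False
  then have "c = 0" by simp
  then have "U 0 = carrier L" using upper_central_eq_carrier[OF c] by simp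
  then have "carrier L = {\<zero>}" by simp
  then have "bch L c X Y = X \<oplus> Y \<oplus> \<zero>"
    using bch_closed[OF upper_central_closed[OF X] Y, of c] upper_central_closed[OF X] Y by simp
  then show ?thesis using that upper_central_zero by blast
qed

text \<open>All brackets on a line vanish. Hence powers in the group become multiples of the
  logarithm.\<close>

lemma bch_multiples:
  assumes c: "lie_nilpotent_class_le L c" and z: "z \<in> carrier L"
  shows "bch L c (a \<odot> z) (b \<odot> z) = (a + b) \<odot> z"
proof (cases "1 \<le> c")
  case True
  have rn: "right_normed L w = \<zero>" if "set w \<subseteq> {a \<odot> z, b \<odot> z}" "2 \<le> length w" for w
    using that
  proof (induction w)
    case (Cons x w)
    have x: "x \<in> carrier L" using Cons.prems z by (auto simp: smult_closed')
    show ?case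
    proof (cases "length w = 1")
      case True
      then obtain y where w: "w = [y]" by (cases w) auto
      then show ?thesis using Cons.prems z
        by (auto simp: bracket_smult_left bracket_smult_right bracket_self smult_closed' smult_zero)
    next
      case False
      then obtain y v where w: "w = y # v" using Cons.prems by (cases w) auto
      have "right_normed L w = \<zero>" using Cons False by auto
      then show ?thesis using bracket_zero(2)[OF x] w by simp
    qed
  qed simp
  have "(\<Oplus>rs\<in>{rs \<in> dynkin_indices c. 2 \<le> dynkin_weight rs}. dynkin_term (a \<odot> z) (b \<odot> z) rs)
    = (\<Oplus>rs\<in>{rs \<in> dynkin_indices c. 2 \<le> dynkin_weight rs}. \<zero>)"
    by (rule finsum_cong')
      (simp_all add: dynkin_term_def rn[OF set_dynkin_word] length_dynkin_word smult_zero)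
  then show ?thesis using bch_split[OF True smult_closed'[OF z] smult_closed'[OF z], of a b] z
    by (simp add: finsum_zero smult_closed' smult_add_left)
next
  case False
  then have "c = 0" by simp
  then have "U 0 = carrier L" using upper_central_eq_carrier[OF c] by simp
  then have "carrier L = {\<zero>}" by simp
  then show ?thesis
    using bch_closed[OF smult_closed'[OF z] smult_closed'[OF z], of c a b] smult_closed'[OF z] by simp
qed

lemma dynkin_term_scale:
  assumes "X \<in> carrier L" "Y \<in> carrier L" "rs \<in> dynkin_indices c"
  shows "dynkin_term (a \<odot> X) (a \<odot> Y) rs = (a ^ dynkin_weight rs) \<odot> dynkin_term X Y rs"
proof -
  have "right_normed L (map (\<lambda>x. a \<odot> x) w) = (a ^ length w) \<odot> right_normed L w"
    if "set w \<subseteq> carrier L" "w \<noteq> []" for w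
    using that
  proof (induction w)
    case (Cons x w)
    show ?case
    proof (cases w)
      case (Cons y v)
      have w: "right_normed L w \<in> carrier L" using Cons.prems by (auto intro: right_normed_closed)
      have "right_normed L (map (\<lambda>x. a \<odot> x) (x # w)) = \<lbrakk>a \<odot> x, right_normed L (map (\<lambda>x. a \<odot> x) w)\<rbrakk>"
        using Cons by simp
      also have "\<dots> = \<lbrakk>a \<odot> x, (a ^ length w) \<odot> right_normed L w\<rbrakk>" using Cons.IH Cons.prems Cons by simp
      also have "\<dots> = (a ^ length (x # w)) \<odot> \<lbrakk>x, right_normed L w\<rbrakk>" using Cons.prems w
        by (simp add: bracket_smult_left bracket_smult_right bracket_closed smult_closed' smult_smult mult.commute)
      finally show ?thesis using Cons by simp
    qed simp
  qed simp
  moreover have "dynkin_word X Y rs \<noteq> []"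
  proof -
    have "dynkin_weight rs > 0" using assms(3) by (cases rs) (auto simp: dynkin_indices_def)
    then show ?thesis using length_dynkin_word[of X Y rs] by auto
  qed
  ultimately show ?thesis
    using dynkin_word_carrier[OF assms(1,2)] right_normed_closed[OF dynkin_word_carrier[OF assms(1,2)]]
    unfolding dynkin_term_def map_dynkin_word[symmetric, of "\<lambda>x. a \<odot> x"]
    by (simp add: length_dynkin_word smult_smult mult.commute)
qed

lemma bch_scale:
  assumes "X \<in> carrier L" "Y \<in> carrier L"
  shows "bch L c (a \<odot> X) (a \<odot> Y) = (\<Oplus>rs\<in>dynkin_indices c. (a ^ dynkin_weight rs) \<odot> dynkin_term X Y rs)"
  unfolding bch_altdef using assms
  by (intro finsum_cong') (auto simp: dynkin_term_scale intro!: smult_closed' dynkin_term_closed)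

text \<open>Four of the seven terms are brackets of an element with itself. The others contribute
  1/2, -1/4 and, after swapping the bracket, 1/4.\<close>

lemma dynkin_weight_2_sum:
  assumes "2 \<le> c" "X \<in> carrier L" "Y \<in> carrier L"
  shows "(\<Oplus>rs\<in>{rs \<in> dynkin_indices c. dynkin_weight rs = 2}. dynkin_term X Y rs) = (1 / 2) \<odot> \<lbrakk>X, Y\<rbrakk>"
proof -
  have YX: "\<lbrakk>Y, X\<rbrakk> = (- 1) \<odot> \<lbrakk>X, Y\<rbrakk>"
    using bracket_swap[of Y X] assms bracket_closed by (simp add: smult_neg smult_1)
  have terms: "dynkin_term X Y [(2, 0)] = \<zero>" "dynkin_term X Y [(0, 2)] = \<zero>"
    "dynkin_term X Y [(1, 0), (1, 0)] = \<zero>" "dynkin_term X Y [(0, 1), (0, 1)] = \<zero>"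
    "dynkin_term X Y [(1, 1)] = (1 / 2) \<odot> \<lbrakk>X, Y\<rbrakk>"
    "dynkin_term X Y [(1, 0), (0, 1)] = (- 1 / 4) \<odot> \<lbrakk>X, Y\<rbrakk>"
    "dynkin_term X Y [(0, 1), (1, 0)] = (1 / 4) \<odot> \<lbrakk>X, Y\<rbrakk>"
    using assms bracket_closed
    by (simp_all add: dynkin_term_def dynkin_coeff_def numeral_2_eq_2 bracket_self smult_zero YX smult_smult
      del: One_nat_def) (simp_all add: numeral_2_eq_2 bracket_self smult_zero YX smult_smult)
  show ?thesis unfolding dynkin_indices_weight_2[OF assms(1)]
    using assms bracket_closed[of X Y]
    by (simp add: finsum_insert dynkin_term_closed terms smult_closed' del: One_nat_def)
      (simp add: smult_add_left[symmetric] smult_0)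
qed

text \<open>Covers the case in which the truncation contains no terms of weight 2 from which the
  bracket could be read off.\<close>

lemma bracket_zero_of_class_less_2:
  assumes "lie_nilpotent_class_le L c" "c < 2" "x \<in> carrier L" "y \<in> carrier L"
  shows "\<lbrakk>x, y\<rbrakk> = \<zero>"
proof -
  have "U c = carrier L" by (rule upper_central_eq_carrier[OF assms(1)])
  then have "x \<in> U 1" using assms upper_central_mono[of x 0] by (cases c) (auto simp: numeral_2_eq_2 less_Suc_eq)
  then show ?thesis using assms by simp
qed

text \<open>Scaling both arguments by n multiplies the part of weight w by the w-th power of n, so
  the parts of weight 2 agree, and these are half the brackets. The free choice of
  \<open>X'\<close>, \<open>Y'\<close> and \<open>f\<close> admits two uses: \<nu> respects
  brackets, and commuting elements have commuting logarithms.\<close>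

lemma bracket_eq_of_weight_2:
  assumes c: "lie_nilpotent_class_le L c" and X: "X \<in> carrier L" "Y \<in> carrier L" "X' \<in> carrier L" "Y' \<in> carrier L"
    and op: "rat_operator L f"
    and eq: "\<And>n. n > 0 \<Longrightarrow> f (bch L c (of_nat n \<odot> X) (of_nat n \<odot> Y)) = bch L c (of_nat n \<odot> X') (of_nat n \<odot> Y')"
  shows "f \<lbrakk>X, Y\<rbrakk> = \<lbrakk>X', Y'\<rbrakk>"
proof -
  interpret f: rat_operator L f by fact
  show ?thesis
  proof (cases "c < 2")
    case True
    then show ?thesis using bracket_zero_of_class_less_2[OF c True] X f.f_zero by simp
  next
    case False
    let ?I = "dynkin_indices c"
    have "(\<Oplus>rs\<in>{rs \<in> ?I. dynkin_weight rs = 2}. f (dynkin_term X Y rs))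
      = (\<Oplus>rs\<in>{rs \<in> ?I. dynkin_weight rs = 2}. dynkin_term X' Y' rs)"
    proof (rule weight_component_eq[OF finite_dynkin_indices])
      show "dynkin_weight rs \<le> c" if "rs \<in> ?I" for rs using that by (simp add: dynkin_indices_def)
      show "(\<Oplus>rs\<in>?I. (of_nat n ^ dynkin_weight rs) \<odot> f (dynkin_term X Y rs))
        = (\<Oplus>rs\<in>?I. (of_nat n ^ dynkin_weight rs) \<odot> dynkin_term X' Y' rs)" if "n > 0" for n
      proof -
        have "(\<Oplus>rs\<in>?I. (of_nat n ^ dynkin_weight rs) \<odot> f (dynkin_term X Y rs))
          = (\<Oplus>rs\<in>?I. f ((of_nat n ^ dynkin_weight rs) \<odot> dynkin_term X Y rs))"
          using X by (intro finsum_cong') (auto simp: f.f_smult dynkin_term_closed intro!: smult_closed' f.f_closed)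
        also have "\<dots> = f (\<Oplus>rs\<in>?I. (of_nat n ^ dynkin_weight rs) \<odot> dynkin_term X Y rs)"
          using X by (intro f.f_finsum[symmetric] finite_dynkin_indices) (auto intro!: smult_closed' dynkin_term_closed)
        finally show ?thesis using eq[OF that] X by (simp add: bch_scale)
      qed
    qed (use X in \<open>auto intro: f.f_closed dynkin_term_closed\<close>)
    also have "(\<Oplus>rs\<in>{rs \<in> ?I. dynkin_weight rs = 2}. f (dynkin_term X Y rs))
      = f (\<Oplus>rs\<in>{rs \<in> ?I. dynkin_weight rs = 2}. dynkin_term X Y rs)"
      using X by (intro f.f_finsum[symmetric]) (auto simp: finite_dynkin_indices intro!: dynkin_term_closed)
    finally have "(1 / 2) \<odot> f \<lbrakk>X, Y\<rbrakk> = (1 / 2) \<odot> \<lbrakk>X', Y'\<rbrakk>"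
      using False X bracket_closed by (simp add: dynkin_weight_2_sum f.f_smult)
    then have "2 \<odot> ((1 / 2) \<odot> f \<lbrakk>X, Y\<rbrakk>) = 2 \<odot> ((1 / 2) \<odot> \<lbrakk>X', Y'\<rbrakk>)" by simp
    then show ?thesis using X bracket_closed f.f_closed by (simp add: smult_smult smult_1)
  qed
qed

end

section \<open>Automorphisms with integral inverse\<close>

context rational_lie_algebra
begin

section \<open>Logarithms of the unit, of powers and of inverses\<close>

lemma bch_hom_one:
  assumes c: "lie_nilpotent_class_le L c" and "group G"
    and closed: "\<And>x. x \<in> carrier G \<Longrightarrow> l x \<in> carrier L"
    and mult: "\<And>x y. x \<in> carrier G \<Longrightarrow> y \<in> carrier G \<Longrightarrow> l (x \<otimes>\<^bsub>G\<^esub> y) = bch L c (l x) (l y)"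
  shows "l \<one>\<^bsub>G\<^esub> = \<zero>"
proof -
  interpret G: group G by fact
  have o: "l \<one>\<^bsub>G\<^esub> \<in> carrier L" by (rule closed) simp
  have "l \<one>\<^bsub>G\<^esub> = (1 + 1) \<odot> l \<one>\<^bsub>G\<^esub>"
    using mult[of "\<one>\<^bsub>G\<^esub>" "\<one>\<^bsub>G\<^esub>"] bch_multiples[OF c o, of 1 1] o by (simp add: smult_1)
  then have "l \<one>\<^bsub>G\<^esub> \<oplus> l \<one>\<^bsub>G\<^esub> = l \<one>\<^bsub>G\<^esub>" using smult_add_left[OF o, of 1 1] smult_1[OF o] by simp
  then show ?thesis using o by (simp add: add.r_cancel_one)
qed

text \<open>Stated for an arbitrary group because it is applied both to \<open>M\<close> with
  \<open>lg\<close> and to \<open>N\<close> with its logarithm \<open>l\<close>.\<close>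

lemma bch_hom_pow:
  assumes c: "lie_nilpotent_class_le L c" and "group G"
    and closed: "\<And>x. x \<in> carrier G \<Longrightarrow> l x \<in> carrier L"
    and mult: "\<And>x y. x \<in> carrier G \<Longrightarrow> y \<in> carrier G \<Longrightarrow> l (x \<otimes>\<^bsub>G\<^esub> y) = bch L c (l x) (l y)"
    and x: "x \<in> carrier G"
  shows "l (x [^]\<^bsub>G\<^esub> n) = of_nat n \<odot> l x"
proof -
  interpret G: group G by fact
  have lx: "l x \<in> carrier L" using x by (rule closed)
  show ?thesis
  proof (induction n)
    case 0
    then show ?case using bch_hom_one[OF c \<open>group G\<close> closed mult] lx by (simp add: smult_0)
  next
    case (Suc n)
    have "l (x [^]\<^bsub>G\<^esub> Suc n) = bch L c (of_nat n \<odot> l x) (1 \<odot> l x)"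
      using mult[of "x [^]\<^bsub>G\<^esub> n" x] x Suc lx by (simp add: smult_1)
    also have "\<dots> = (of_nat n + 1) \<odot> l x" by (rule bch_multiples[OF c lx])
    finally show ?case by (simp add: add.commute)
  qed
qed

text \<open>\<open>l\<close> need not be surjective, so an element with the negative logarithm is a
  hypothesis; injectivity then identifies it with the inverse.\<close>

lemma bch_hom_inv:
  assumes c: "lie_nilpotent_class_le L c" and "group G"
    and closed: "\<And>x. x \<in> carrier G \<Longrightarrow> l x \<in> carrier L"
    and mult: "\<And>x y. x \<in> carrier G \<Longrightarrow> y \<in> carrier G \<Longrightarrow> l (x \<otimes>\<^bsub>G\<^esub> y) = bch L c (l x) (l y)"
    and inj: "inj_on l (carrier G)" and x: "x \<in> carrier G" and y: "y \<in> carrier G" "l y = \<ominus> l x"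
  shows "l (inv\<^bsub>G\<^esub> x) = \<ominus> l x"
proof -
  interpret G: group G by fact
  have lx: "l x \<in> carrier L" using x by (rule closed)
  have "l (x \<otimes>\<^bsub>G\<^esub> y) = \<zero>"
    using mult[OF x y(1)] bch_multiples[OF c lx, of 1 "- 1"] y(2) lx by (simp add: smult_1 smult_0 smult_neg)
  then have "x \<otimes>\<^bsub>G\<^esub> y = \<one>\<^bsub>G\<^esub>"
    using inj_onD[OF inj, of "x \<otimes>\<^bsub>G\<^esub> y" "\<one>\<^bsub>G\<^esub>"] x y bch_hom_one[OF c \<open>group G\<close> closed mult] by simp
  then have "inv\<^bsub>G\<^esub> x = y" using G.inv_equality[of y x] x y G.inv_comm by blast
  then show ?thesis using y by simp
qed

end

section \<open>A Lie automorphism, its inverse \<mu>, and the upper central series\<close>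

locale lie_automorphism = rational_lie_algebra L + nu: rat_operator L \<nu>
  for L :: "(rat, 'v, 'z) lie_algebra_scheme" (structure) and \<nu> :: "'v \<Rightarrow> 'v" +
  assumes bij: "bij_betw \<nu> (carrier L) (carrier L)"
    and nu_bracket: "x \<in> carrier L \<Longrightarrow> y \<in> carrier L \<Longrightarrow> \<nu> \<lbrakk>x, y\<rbrakk> = \<lbrakk>\<nu> x, \<nu> y\<rbrakk>"
begin

definition \<mu> :: "'v \<Rightarrow> 'v" where "\<mu> = inv_into (carrier L) \<nu>"

lemma mu_closed: "x \<in> carrier L \<Longrightarrow> \<mu> x \<in> carrier L"
  using bij_betw_imp_surj_on[OF bij] inv_into_into[of x \<nu> "carrier L"] by (simp add: \<mu>_def)

lemma nu_mu: "x \<in> carrier L \<Longrightarrow> \<nu> (\<mu> x) = x"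
  using bij_betw_imp_surj_on[OF bij] f_inv_into_f[of x \<nu> "carrier L"] by (simp add: \<mu>_def)

lemma mu_nu: "x \<in> carrier L \<Longrightarrow> \<mu> (\<nu> x) = x"
  using bij_betw_imp_inj_on[OF bij] by (simp add: \<mu>_def)

lemma mu_eqI: "x \<in> carrier L \<Longrightarrow> \<nu> x = y \<Longrightarrow> \<mu> y = x"
  using mu_nu by blast

sublocale mu: rat_operator L \<mu>
proof unfold_locales
  fix x y assume xy: "x \<in> carrier L" "y \<in> carrier L"
  show "\<mu> (x \<oplus> y) = \<mu> x \<oplus> \<mu> y"
    by (rule mu_eqI) (use xy in \<open>simp_all add: mu_closed nu.f_add nu_mu\<close>)
next
  fix x a assume x: "x \<in> carrier L"
  show "\<mu> (a \<odot> x) = a \<odot> \<mu> x"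
    by (rule mu_eqI) (use x in \<open>simp_all add: mu_closed nu.f_smult nu_mu smult_closed'\<close>)
qed (rule mu_closed)

lemma mu_bracket:
  assumes "x \<in> carrier L" "y \<in> carrier L" shows "\<lbrakk>\<mu> x, y\<rbrakk> = \<mu> \<lbrakk>x, \<nu> y\<rbrakk>"
  by (rule mu_eqI[symmetric]) (use assms in \<open>simp_all add: mu_closed bracket_closed nu_bracket nu_mu\<close>)

text \<open>Surjectivity enters here: an arbitrary y is \<nu> of \<open>\<mu> y\<close>, so the
  bracket with y is \<nu> of a bracket.\<close>

lemma upper_central_nu: "x \<in> U i \<Longrightarrow> \<nu> x \<in> U i"
proof (induction i arbitrary: x)
  case (Suc i)
  have "\<lbrakk>\<nu> x, y\<rbrakk> \<in> U i" if y: "y \<in> carrier L" for y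
  proof -
    have "\<lbrakk>\<nu> x, y\<rbrakk> = \<nu> \<lbrakk>x, \<mu> y\<rbrakk>"
      using nu_bracket[of x "\<mu> y"] Suc.prems y by (simp add: mu_closed nu_mu)
    then show ?thesis using Suc.IH Suc.prems y by (simp add: mu_closed)
  qed
  then show ?case using Suc.prems nu.f_closed by simp
qed (simp add: nu.f_zero)

lemma upper_central_mu: "x \<in> U i \<Longrightarrow> \<mu> x \<in> U i"
  by (induction i arbitrary: x) (auto simp: mu.f_zero mu_closed mu_bracket nu.f_closed)

text \<open>The action of \<open>\<rat>[s, t]\<close> on the bilinear map \<open>[x, y]\<close>: \<open>s\<close> applies \<open>\<mu>\<close> to the value and \<open>t\<close>
  applies \<open>\<nu>\<close> to \<open>y\<close>. By \<open>[\<mu> x, y] = \<mu> [x, \<nu> y]\<close>, \<open>st\<close> applies \<open>\<mu>\<close> to \<open>x\<close>.\<close>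

definition biact :: "rat poly poly \<Rightarrow> 'v \<Rightarrow> 'v \<Rightarrow> 'v" where
  "biact P x y = fold_coeffs (\<lambda>p v. \<lbrakk>x, nu.pact p y\<rbrakk> \<oplus> \<mu> v) P \<zero>"

lemma biact_0: "biact 0 x y = \<zero>"
  by (simp add: biact_def)

lemma biact_pCons:
  assumes "x \<in> carrier L" "y \<in> carrier L"
  shows "biact (pCons p P) x y = \<lbrakk>x, nu.pact p y\<rbrakk> \<oplus> \<mu> (biact P x y)"
  using assms
  by (cases "P = 0 \<and> p = 0")
    (auto simp: biact_def fold_coeffs_def cCons_def mu.f_zero nu.pact_0 bracket_zero)

lemma biact_closed: "x \<in> carrier L \<Longrightarrow> y \<in> carrier L \<Longrightarrow> biact P x y \<in> carrier L"
  by (induction P) (auto simp: biact_0 biact_pCons mu_closed bracket_closed nu.pact_closed)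

lemma biact_add:
  "x \<in> carrier L \<Longrightarrow> y \<in> carrier L \<Longrightarrow> biact (P + Q) x y = biact P x y \<oplus> biact Q x y"
  by (induction P Q rule: poly_induct2)
    (auto simp: biact_0 biact_pCons biact_closed mu.f_add mu_closed nu.pact_add nu.pact_closed
      bracket_add_right bracket_closed a_ac)

lemma biact_smult_const:
  "x \<in> carrier L \<Longrightarrow> y \<in> carrier L \<Longrightarrow> biact (Polynomial.smult [:a:] P) x y = a \<odot> biact P x y"
  by (induction P)
    (auto simp: biact_0 biact_pCons biact_closed mu.f_smult mu_closed nu.pact_smult nu.pact_closed
      bracket_smult_right bracket_closed smult_add_right smult_zero)

lemma biact_poly_t:
  assumes "x \<in> carrier L" "y \<in> carrier L" and f: "\<And>z. z \<in> carrier L \<Longrightarrow> nu.pact f z = \<zero>"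
  shows "biact (poly_t f * Q) x y = \<zero>"
proof -
  have "biact (Polynomial.smult f Q) x y = \<zero>"
    using assms(1,2)
    by (induction Q) (simp_all add: biact_0 biact_pCons nu.pact_mult nu.pact_closed f bracket_zero mu.f_zero)
  then show ?thesis by (simp add: poly_t_def)
qed

lemma poly_s_pCons: "poly_s (pCons a q) = pCons [:a:] (poly_s q)"
  by (cases "a = 0 \<and> q = 0") (auto simp: poly_s_def map_poly_pCons)

lemma biact_poly_s:
  assumes "x \<in> carrier L" "y \<in> carrier L"
  shows "biact (poly_s q * Q) x y = mu.pact q (biact Q x y)"
proof (induction q)
  case 0
  show ?case by (simp add: poly_s_def biact_0 mu.pact_0)
next
  case (pCons a q)
  have "biact (poly_s (pCons a q) * Q) x y
    = biact (Polynomial.smult [:a:] Q) x y \<oplus> biact (pCons 0 (poly_s q * Q)) x y"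
    using assms by (simp add: poly_s_pCons biact_add)
  also have "biact (Polynomial.smult [:a:] Q) x y = a \<odot> biact Q x y"
    using assms by (rule biact_smult_const)
  also have "biact (pCons 0 (poly_s q * Q)) x y = \<mu> (mu.pact q (biact Q x y))"
    using assms pCons by (simp add: biact_pCons nu.pact_0 bracket_zero mu_closed mu.pact_closed biact_closed)
  finally show ?case using assms by (simp add: mu.pact_pCons biact_closed)
qed

lemma biact_poly_st:
  assumes "x \<in> carrier L" "y \<in> carrier L"
  shows "biact (poly_st h) x y = \<lbrakk>mu.pact h x, y\<rbrakk>"
proof -
  \<comment> \<open>Coefficientwise, t puts one more \<nu> on the second argument, and
    \<open>mu_bracket\<close> trades it together with the outer \<mu> for \<mu> on the first
    argument.\<close>
  have t: "\<mu> (biact (Polynomial.smult [:0, 1:] P) x y) = biact P (\<mu> x) y"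
    if "x \<in> carrier L" "y \<in> carrier L" for P x y
  proof (induction P)
    case (pCons p P)
    have "\<mu> \<lbrakk>x, \<nu> (nu.pact p y)\<rbrakk> = \<lbrakk>\<mu> x, nu.pact p y\<rbrakk>"
      using that by (simp add: mu_bracket nu.pact_closed)
    moreover have "nu.pact ([:0, 1:] * p) y = \<nu> (nu.pact p y)"
      using that by (simp add: nu.pact_pCons smult_0 nu.f_closed nu.pact_closed)
    ultimately show ?case using that pCons
      by (simp only: smult_pCons biact_pCons mu_closed mu.f_add bracket_closed nu.f_closed nu.pact_closed biact_closed)
  qed (simp add: biact_0 mu.f_zero)
  have st: "biact ([:0, [:0, 1:]:] * P) x y = biact P (\<mu> x) y"
    if "x \<in> carrier L" "y \<in> carrier L" for P x y
  proof -
    have "[:0, [:0, 1:]:] * P = pCons 0 (Polynomial.smult [:0, 1:] P)" by simp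
    then show ?thesis using t[OF that] that
      by (simp only: biact_pCons nu.pact_0 bracket_zero)
        (simp add: mu_closed biact_closed)
  qed
  interpret h: comm_ring_hom "\<lambda>a :: rat. [:[:a:]:]" by unfold_locales (auto simp: one_pCons)
  show ?thesis using assms
  \<comment> \<open>\<open>x\<close> varies because each factor st replaces it by
    \<open>\<mu> x\<close>.\<close>
  proof (induction h arbitrary: x)
    case 0
    then show ?case by (simp add: poly_st_def biact_0 mu.pact_0 bracket_zero)
  next
    case (pCons a h)
    have "poly_st (pCons a h) = [:[:a:]:] + [:0, [:0, 1:]:] * poly_st h"
      unfolding poly_st_def h.map_poly_pCons_hom by simp
    then have "biact (poly_st (pCons a h)) x y = \<lbrakk>x, a \<odot> y\<rbrakk> \<oplus> \<lbrakk>mu.pact h (\<mu> x), y\<rbrakk>"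
      using pCons.prems pCons.IH[OF mu_closed[OF pCons.prems(1)] pCons.prems(2)]
      by (simp only: biact_add st biact_pCons biact_0 mu.f_zero nu.pact_const)
        (simp add: bracket_closed smult_closed')
    then show ?case using pCons.prems
      by (simp add: mu.pact_pCons mu.pact_f bracket_add_left bracket_smult_left bracket_smult_right
        smult_closed' mu_closed mu.pact_closed)
  qed
qed

lemma biact_upper_central:
  assumes "x \<in> U (Suc i)" "y \<in> carrier L" shows "biact P x y \<in> U i"
proof (induction P)
  case (pCons p P)
  then show ?case using assms upper_central_closed[OF assms(1)]
    by (simp only: biact_pCons)
      (intro upper_central_add upper_central_bracket(1) upper_central_mu nu.pact_closed)
qed (simp add: biact_0 upper_central_zero)

text \<open>Integrality of \<mu> on the factor of \<open>U (Suc i)\<close> by \<open>U i\<close>,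
  phrased without the quotient; index 0 is the centre.\<close>

definition inverse_integral :: "nat set \<Rightarrow> nat \<Rightarrow> bool" where
  "inverse_integral \<pi> i \<longleftrightarrow> (\<exists>g \<in> Z_inv_poly \<pi>. lead_coeff g = 1 \<and> (\<forall>x \<in> U (Suc i). mu.pact g x \<in> U i))"

text \<open>Let the identity for \<open>poly_st h\<close> act on the bracket of x and y. The part
  with f(t) vanishes, and the part with g(s) is g(\<mu>) of an element of \<open>U (Suc i)\<close>,
  hence in \<open>U i\<close>. As y is arbitrary, h(\<mu>) x lies in
  \<open>U (Suc i)\<close>.\<close>

lemma inverse_integral_Suc:
  assumes "inverse_integral \<pi> i" and f: "f \<in> Z_inv_poly \<pi>" "lead_coeff f = 1"
    "\<And>z. z \<in> carrier L \<Longrightarrow> nu.pact f z = \<zero>"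
  shows "inverse_integral \<pi> (Suc i)"
proof -
  obtain g where g: "g \<in> Z_inv_poly \<pi>" "lead_coeff g = 1" "\<And>x. x \<in> U (Suc i) \<Longrightarrow> mu.pact g x \<in> U i"
    using assms(1) by (auto simp: inverse_integral_def)
  obtain h u v where h: "lead_coeff h = 1" "h \<in> Z_inv_poly \<pi>" "poly_st h = poly_s g * u + poly_t f * v"
    using integral_product[OF g(2,1) f(2,1)] .
  have "mu.pact h x \<in> U (Suc i)" if x: "x \<in> U (Suc (Suc i))" for x
  proof -
    have xc: "x \<in> carrier L" using x by simp
    have "\<lbrakk>mu.pact h x, y\<rbrakk> \<in> U i" if y: "y \<in> carrier L" for y
    proof -
      have "\<lbrakk>mu.pact h x, y\<rbrakk> = biact (poly_s g * u) x y \<oplus> biact (poly_t f * v) x y"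
        using biact_poly_st[OF xc y, of h] h(3) biact_add[OF xc y] by simp
      also have "\<dots> = mu.pact g (biact u x y)"
        using biact_poly_t[OF xc y f(3)] biact_poly_s[OF xc y] mu.pact_closed[OF biact_closed[OF xc y]] by simp
      finally show ?thesis using g(3)[OF biact_upper_central[OF x y]] by simp
    qed
    then show ?thesis using mu.pact_closed[OF xc] by simp
  qed
  then show ?thesis using h by (auto simp: inverse_integral_def)
qed

lemma nu_power:
  assumes "x \<in> carrier L"
  shows "(\<nu> ^^ n) x \<in> carrier L"
    "y \<in> carrier L \<Longrightarrow> (\<nu> ^^ n) (x \<oplus> y) = (\<nu> ^^ n) x \<oplus> (\<nu> ^^ n) y"
    "(\<nu> ^^ n) (a \<odot> x) = a \<odot> (\<nu> ^^ n) x"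
proof (induction n)
  case (Suc n)
  have closed: "(\<nu> ^^ n) z \<in> carrier L" if "z \<in> carrier L" for z
    using that by (induction n) (auto intro: nu.f_closed)
  { case 1 then show ?case using Suc nu.f_closed by simp }
  { case 2 then show ?case using Suc closed assms nu.f_add by simp }
  { case 3 then show ?case using Suc closed assms nu.f_smult by simp }
qed (use assms in simp_all)

lemma mu_power:
  assumes "x \<in> carrier L"
  shows "(\<mu> ^^ n) x \<in> carrier L" "(\<nu> ^^ n) ((\<mu> ^^ n) x) = x"
proof -
  show closed: "(\<mu> ^^ n) x \<in> carrier L" for n
    using assms by (induction n) (auto intro: mu_closed)
  show "(\<nu> ^^ n) ((\<mu> ^^ n) x) = x"
    by (induction n) (simp, simp only: funpow.simps o_apply funpow_swap1[of \<nu>] nu_mu closed)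
qed

text \<open>Reversing coefficients turns a polynomial in \<nu> into one in \<mu> times a power of
  \<nu>. Lists keep zeros at both ends; the exponent is the length, one more than the formal degree,
  which the extra \<mu> compensates.\<close>

lemma pact_rev:
  assumes x: "x \<in> carrier L"
  shows "nu.pact (Poly cs) x = (\<nu> ^^ length cs) (\<mu> (mu.pact (Poly (rev cs)) x))"
proof (induction cs)
  case Nil
  show ?case by (simp add: nu.pact_0 mu.pact_0 mu.f_zero)
next
  case (Cons a cs)
  let ?n = "length cs" and ?m = "mu.pact (Poly (rev cs)) x"
  have m: "?m \<in> carrier L" using x by (rule mu.pact_closed)
  have "mu.pact (monom a n) x = a \<odot> (\<mu> ^^ n) x" for n
    by (induction n) (use x in \<open>simp_all add: monom_0 mu.pact_const monom_Suc mu.pact_pCons mu.f_smult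
      mu.pact_0 mu.f_zero mu_power smult_0 smult_closed' mu_closed\<close>)
  then have "mu.pact (Poly (rev (a # cs))) x = ?m \<oplus> a \<odot> (\<mu> ^^ ?n) x"
    using x by (simp add: Poly_snoc mu.pact_add)
  then have "\<mu> (mu.pact (Poly (rev (a # cs))) x) = \<mu> ?m \<oplus> a \<odot> (\<mu> ^^ Suc ?n) x"
    using x m mu_power(1)[OF x] by (simp add: mu.f_add mu.f_smult smult_closed')
  then have "(\<nu> ^^ Suc ?n) (\<mu> (mu.pact (Poly (rev (a # cs))) x)) = (\<nu> ^^ Suc ?n) (\<mu> ?m) \<oplus> a \<odot> x"
    using nu_power(2)[OF mu_closed[OF m] smult_closed'[OF mu_power(1)[OF x]], of "Suc ?n" a "Suc ?n"]
      nu_power(3)[OF mu_power(1)[OF x], of "Suc ?n" a "Suc ?n"] mu_power(2)[OF x, of "Suc ?n"]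
    by (simp only:)
  also have "\<dots> = a \<odot> x \<oplus> \<nu> (nu.pact (Poly cs) x)"
    using Cons nu_power(1)[OF mu_closed[OF m], of "Suc ?n"] x by (simp add: a_comm smult_closed')
  finally show ?case using x by (simp add: nu.pact_pCons)
qed

text \<open>Read backwards, the monic relation for \<mu> starts with 1. So \<mu> acts on the factor
  as minus r(\<nu>); the statement is given after applying \<nu>.\<close>

lemma inverse_integralD:
  assumes "inverse_integral \<pi> i"
  obtains r where "r \<in> Z_inv_poly \<pi>" "\<And>x. x \<in> U (Suc i) \<Longrightarrow> x \<oplus> \<nu> (nu.pact r x) \<in> U i"
proof -
  obtain g where g: "g \<in> Z_inv_poly \<pi>" "lead_coeff g = 1" "\<And>x. x \<in> U (Suc i) \<Longrightarrow> mu.pact g x \<in> U i"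
    using assms by (auto simp: inverse_integral_def)
  \<comment> \<open>The leading coefficient 1 of \<open>g\<close> comes first, and the tail
    \<open>cs'\<close> holds the coefficients of r.\<close>
  define cs where "cs = rev (coeffs g)"
  have "g \<noteq> 0" using g(2) by auto
  then obtain cs' where cs': "cs = 1 # cs'"
    using g(2) last_coeffs_eq_coeff_degree[of g] unfolding cs_def
    by (cases "coeffs g" rule: rev_cases) auto
  have "set (coeffs g) \<subseteq> Z_inv \<pi>" using g(1) by (auto simp: Z_inv_poly_def coeffs_def)
  then have "set cs' \<subseteq> Z_inv \<pi>" using cs' unfolding cs_def by (metis set_rev set_subset_Cons subset_trans)
  then have "Poly cs' \<in> Z_inv_poly \<pi>"
    by (auto simp: Z_inv_poly_def nth_default_def zero_in_Z_inv)
  moreover have "x \<oplus> \<nu> (nu.pact (Poly cs') x) \<in> U i" if x: "x \<in> U (Suc i)" for x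
  proof -
    have xc: "x \<in> carrier L" using x by simp
    have "x \<oplus> \<nu> (nu.pact (Poly cs') x) = nu.pact (Poly cs) x"
      using cs' xc by (simp add: nu.pact_pCons smult_1)
    also have "\<dots> = (\<nu> ^^ length cs) (\<mu> (mu.pact g x))"
      unfolding pact_rev[OF xc] by (simp add: cs_def)
    also have "\<dots> \<in> U i"
    proof -
      have "(\<nu> ^^ n) z \<in> U i" if "z \<in> U i" for n z
        using that by (induction n) (auto intro: upper_central_nu)
      then show ?thesis using g(3)[OF x] upper_central_mu by blast
    qed
    finally show ?thesis .
  qed
  ultimately show ?thesis using that by blast
qed

text \<open>The reflected polynomial annihilates \<mu> because \<nu> is injective. Its leading
  coefficient is the constant term of \<open>p\<close>, so scaling by the inverse \<open>u\<close>
  makes it monic over the ring.\<close>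

lemma inverse_integral_0:
  assumes p: "p \<in> Z_inv_poly \<pi>" "coeff p 0 * u = 1" "u \<in> Z_inv \<pi>"
    and zero: "\<And>x. x \<in> U (Suc 0) \<Longrightarrow> nu.pact p x = \<zero>"
  shows "inverse_integral \<pi> 0"
proof -
  have p0: "coeff p 0 \<noteq> 0" using p(2) by auto
  define g where "g = Polynomial.smult u (reflect_poly p)"
  have "g \<in> Z_inv_poly \<pi>"
    using p(1,3) by (auto simp: g_def Z_inv_poly_def coeff_reflect_poly zero_in_Z_inv intro: Z_inv_mult)
  moreover have "lead_coeff g = 1"
    using p0 p(2) by (auto simp: g_def coeff_reflect_poly mult.commute)
  moreover have "mu.pact g x \<in> U 0" if x: "x \<in> U (Suc 0)" for x
  proof -
    have xc: "x \<in> carrier L" using x by simp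
    have inj: "y = \<zero>" if "y \<in> carrier L" "(\<nu> ^^ n) y = \<zero>" for n y
      using that
    proof (induction n)
      case (Suc n)
      have "\<mu> (\<nu> ((\<nu> ^^ n) y)) = \<zero>" using Suc.prems mu.f_zero by simp
      then show ?case using Suc mu_nu[OF nu_power(1)[OF Suc.prems(1)]] by simp
    qed simp
    have m: "mu.pact (reflect_poly p) x \<in> carrier L" by (rule mu.pact_closed[OF xc])
    have "(\<nu> ^^ length (coeffs p)) (\<mu> (mu.pact (reflect_poly p) x)) = \<zero>"
      using pact_rev[OF xc, of "coeffs p"] zero[OF x] by (simp add: reflect_poly_def)
    then have "\<mu> (mu.pact (reflect_poly p) x) = \<zero>" using inj mu_closed[OF m] by blast
    then have "mu.pact (reflect_poly p) x = \<zero>" using nu_mu[OF m] nu.f_zero by simp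
    then show ?thesis using xc by (simp add: g_def mu.pact_smult smult_zero)
  qed
  ultimately show ?thesis by (auto simp: inverse_integral_def)
qed

end

text \<open>The image of \<open>l\<close> need not be an additive subgroup. What is recorded is its
  closure under the BCH product, \<nu> and scalars from the ring.\<close>

locale lattice_in_lie_algebra = lie_automorphism L \<nu> + N: group N
  for L :: "(rat, 'v, 'z) lie_algebra_scheme" (structure) and \<nu> :: "'v \<Rightarrow> 'v"
    and N :: "('a, 'b) monoid_scheme" +
  fixes c :: nat and l :: "'a \<Rightarrow> 'v" and \<sigma> :: "'a \<Rightarrow> 'a" and \<pi> :: "nat set"
  assumes nilp: "lie_nilpotent_class_le L c"
    and l_closed: "X \<in> carrier N \<Longrightarrow> l X \<in> carrier L"
    and l_inj: "inj_on l (carrier N)"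
    and l_mult: "X \<in> carrier N \<Longrightarrow> Y \<in> carrier N \<Longrightarrow> l (X \<otimes>\<^bsub>N\<^esub> Y) = bch L c (l X) (l Y)"
    and \<sigma>_hom: "\<sigma> \<in> hom N N"
    and l_\<sigma>: "X \<in> carrier N \<Longrightarrow> l (\<sigma> X) = \<nu> (l X)"
    and l_Z_inv: "X \<in> carrier N \<Longrightarrow> r \<in> Z_inv \<pi> \<Longrightarrow> \<exists>Y \<in> carrier N. l Y = r \<odot> l X"
begin

lemma \<sigma>_closed: "X \<in> carrier N \<Longrightarrow> \<sigma> X \<in> carrier N"
  using hom_in_carrier[OF \<sigma>_hom] .

lemma l_one: "l \<one>\<^bsub>N\<^esub> = \<zero>"
  by (rule bch_hom_one[OF nilp N.is_group l_closed l_mult])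

lemma l_inv: assumes X: "X \<in> carrier N" shows "l (inv\<^bsub>N\<^esub> X) = \<ominus> l X"
proof -
  obtain Y where "Y \<in> carrier N" "l Y = (- 1) \<odot> l X"
    using l_Z_inv[OF X Z_inv_uminus[OF one_in_Z_inv]] by blast
  then show ?thesis
    using bch_hom_inv[OF nilp N.is_group l_closed l_mult l_inj X, of Y] l_closed[OF X]
    by (simp add: smult_neg smult_1)
qed

text \<open>Horner's scheme carried out in the group: \<sigma> plays \<nu>, and multiplication plays
  addition. Each scalar multiple of \<open>l X\<close> lies in \<open>U (Suc i)\<close>, so the
  error of every product stays in \<open>U i\<close>.\<close>

lemma pact_approximation:
  assumes X: "X \<in> carrier N" "l X \<in> U (Suc i)" and r: "r \<in> Z_inv_poly \<pi>"
  shows "\<exists>W \<in> carrier N. \<exists>z \<in> U i. l W = nu.pact r (l X) \<oplus> z"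
  using r
proof (induction r)
  case 0
  show ?case using l_one upper_central_zero by (intro bexI[of _ "\<one>\<^bsub>N\<^esub>"] bexI[of _ \<zero>]) (auto simp: nu.pact_0)
next
  case (pCons a r)
  have "coeff (pCons a r) 0 \<in> Z_inv \<pi>" "\<And>i. coeff (pCons a r) (Suc i) \<in> Z_inv \<pi>"
    using pCons.prems unfolding Z_inv_poly_def by blast+
  then have a: "a \<in> Z_inv \<pi>" and r: "r \<in> Z_inv_poly \<pi>" by (auto simp: Z_inv_poly_def)
  have lX: "l X \<in> carrier L" using X by (simp add: l_closed)
  obtain W z where W: "W \<in> carrier N" "z \<in> U i" "l W = nu.pact r (l X) \<oplus> z" using pCons.IH[OF r] by blast
  obtain A where A: "A \<in> carrier N" "l A = a \<odot> l X" using l_Z_inv[OF X(1) a] by blast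
  have zc: "z \<in> carrier L" using W(2) by (rule upper_central_closed)
  have lA: "l A \<in> U (Suc i)" using A upper_central_smult[OF X(2)] by simp
  have l\<sigma>W: "l (\<sigma> W) \<in> carrier L" using W by (intro l_closed \<sigma>_closed)
  obtain z' where z': "z' \<in> U i" "bch L c (l A) (l (\<sigma> W)) = l A \<oplus> l (\<sigma> W) \<oplus> z'"
    using bch_upper_central[OF nilp lA l\<sigma>W] .
  have z'c: "z' \<in> carrier L" using z'(1) by (rule upper_central_closed)
  have "l (A \<otimes>\<^bsub>N\<^esub> \<sigma> W) = l A \<oplus> l (\<sigma> W) \<oplus> z'" using l_mult[OF A(1) \<sigma>_closed[OF W(1)]] z' by simp
  also have "\<dots> = nu.pact (pCons a r) (l X) \<oplus> (\<nu> z \<oplus> z')"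
    using lX zc z'c W A by (simp add: l_\<sigma> nu.f_add nu.pact_closed nu.pact_pCons nu.f_closed smult_closed' a_assoc)
  finally show ?case using A W z' upper_central_add[OF upper_central_nu[OF W(2)] z'(1)] \<sigma>_closed
    by (intro bexI[of _ "A \<otimes>\<^bsub>N\<^esub> \<sigma> W"] bexI[of _ "\<nu> z \<oplus> z'"]) auto
qed

text \<open>\<open>W\<close> approximates minus r(\<nu>) of \<open>l X\<close>, so
  \<open>\<sigma> W\<close> agrees with \<open>X\<close> modulo \<open>U i\<close>. The quotient of
  \<open>X\<close> by \<open>\<sigma> W\<close> has logarithm in \<open>U i\<close>, and its
  preimage \<open>Y\<close> is corrected by \<open>W\<close>.\<close>

lemma preimage_exists:
  assumes int: "\<And>j. inverse_integral \<pi> j"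
  shows "X \<in> carrier N \<Longrightarrow> l X \<in> U i \<Longrightarrow> X \<in> \<sigma> ` carrier N"
proof (induction i arbitrary: X)
  case 0
  then have "X = \<one>\<^bsub>N\<^esub>" using inj_onD[OF l_inj, of X "\<one>\<^bsub>N\<^esub>"] l_one by simp
  then show ?case using hom_one[OF \<sigma>_hom N.is_group N.is_group] by force
next
  case (Suc i)
  have lX: "l X \<in> carrier L" using Suc by (simp add: l_closed)
  obtain r where r: "r \<in> Z_inv_poly \<pi>" "\<And>x. x \<in> U (Suc i) \<Longrightarrow> x \<oplus> \<nu> (nu.pact r x) \<in> U i"
    by (rule inverse_integralD[OF int[of i]], rule that)
  have "Polynomial.smult (- 1) r \<in> Z_inv_poly \<pi>"
    using r(1) by (auto simp: Z_inv_poly_def intro: Z_inv_uminus)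
  then obtain W z where W: "W \<in> carrier N" "z \<in> U i" "l W = nu.pact (Polynomial.smult (- 1) r) (l X) \<oplus> z"
    using pact_approximation[OF Suc.prems] by blast
  let ?p = "nu.pact r (l X)"
  have closed: "z \<in> carrier L" "?p \<in> carrier L" "\<nu> z \<in> carrier L" "\<nu> ?p \<in> carrier L" "l W \<in> carrier L"
    using W upper_central_closed nu.pact_closed lX nu.f_closed l_closed by auto
  have "l W = \<ominus> ?p \<oplus> z" using W(3) lX closed by (simp add: nu.pact_smult smult_neg smult_1 del: smult_minus_left)
  then have l\<sigma>W: "l (\<sigma> W) = \<ominus> \<nu> ?p \<oplus> \<nu> z"
    using W(1) closed by (simp add: l_\<sigma> nu.f_add nu.f_neg)
  let ?V = "inv\<^bsub>N\<^esub> \<sigma> W"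
  have V: "?V \<in> carrier N" using \<sigma>_closed[OF W(1)] by simp
  have lV: "l ?V = \<nu> ?p \<oplus> \<ominus> \<nu> z"
    using l_inv[OF \<sigma>_closed[OF W(1)]] l\<sigma>W closed by (simp add: minus_add a_comm)
  obtain z' where z': "z' \<in> U i" "bch L c (l X) (l ?V) = l X \<oplus> l ?V \<oplus> z'"
    using bch_upper_central[OF nilp Suc.prems(2) l_closed[OF V]] .
  have z'c: "z' \<in> carrier L" using z'(1) by (rule upper_central_closed)
  have "l (X \<otimes>\<^bsub>N\<^esub> ?V) = l X \<oplus> \<nu> ?p \<oplus> (\<ominus> \<nu> z \<oplus> z')"
    using l_mult[OF Suc.prems(1) V] z' lV lX closed z'c by (simp add: a_assoc)
  also have "\<dots> \<in> U i"
    by (intro upper_central_add r(2) Suc.prems upper_central_neg upper_central_nu W z')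
  finally obtain Y where Y: "Y \<in> carrier N" "\<sigma> Y = X \<otimes>\<^bsub>N\<^esub> ?V"
    using Suc.IH[of "X \<otimes>\<^bsub>N\<^esub> ?V"] Suc.prems V by auto
  have "\<sigma> (Y \<otimes>\<^bsub>N\<^esub> W) = X \<otimes>\<^bsub>N\<^esub> ?V \<otimes>\<^bsub>N\<^esub> \<sigma> W" using hom_mult[OF \<sigma>_hom Y(1) W(1)] Y by simp
  also have "\<dots> = X" using Suc.prems V \<sigma>_closed[OF W(1)] by (simp add: N.m_assoc)
  finally show ?case using Y W by (intro image_eqI[of _ _ "Y \<otimes>\<^bsub>N\<^esub> W"]) auto
qed

end

section \<open>The tensor product with the rationals\<close>

text \<open>Images of independent sets are independent, so their sizes are bounded by the dimension
  of \<open>W\<close>; a maximal independent set is then a finite basis.\<close>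

lemma fin_dim_of_inj_linear_map:
  assumes "linear_map K V W T" "inj_on T (carrier V)" "vectorspace.fin_dim K W"
  shows "vectorspace.fin_dim K V"
proof -
  interpret linear_map K V W T by fact
  have bound: "finite A \<Longrightarrow> card A \<le> W.dim" if A: "A \<subseteq> carrier V" "V.module.lin_indpt A" for A
  proof -
    assume fin: "finite A"
    have "W.module.lin_indpt (T ` A)"
    proof (rule W.module.finite_lin_indpt2)
      show "finite (T ` A)" using fin by simp
      show "T ` A \<subseteq> carrier W" using A(1) f_im by blast
      fix a assume a: "a \<in> T ` A \<rightarrow> carrier K" and zero: "W.module.lincomb a (T ` A) = \<zero>\<^bsub>W\<^esub>"
      have aT: "a \<circ> T \<in> A \<rightarrow> carrier K" using a by auto
      have closed: "V.module.lincomb (a \<circ> T) A \<in> carrier V" using A(1) aT by (rule V.module.lincomb_closed)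
      have "T (V.module.lincomb (a \<circ> T) A) = T \<zero>\<^bsub>V\<^esub>"
        using lincomb_linear_image[OF assms(2) A(1) a fin] zero by (simp add: f0_is_0)
      then have "V.module.lincomb (a \<circ> T) A = \<zero>\<^bsub>V\<^esub>"
        using inj_onD[OF assms(2)] closed by blast
      then have "(a \<circ> T) v = \<zero>\<^bsub>K\<^esub>" if "v \<in> A" for v
        using V.module.lin_dep_crit[OF fin subset_refl aT that] A(2) by blast
      then show "\<forall>v\<in>T ` A. a v = \<zero>\<^bsub>K\<^esub>" by auto
    qed
    moreover have "T ` A \<subseteq> carrier W" using A(1) f_im by blast
    ultimately have "card (T ` A) \<le> W.dim" using W.li_le_dim(2)[OF assms(3)] by blast
    then show "card A \<le> W.dim" using card_image[OF inj_on_subset[OF assms(2) A(1)]] by simp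
  qed
  have fin: "finite A" if A: "A \<subseteq> carrier V" "V.module.lin_indpt A" for A
  proof (rule ccontr)
    assume "infinite A"
    then obtain B where B: "B \<subseteq> A" "finite B" "card B = Suc W.dim"
      using infinite_arbitrarily_large by blast
    then have "card B \<le> W.dim" using bound[of B] A V.module.subset_li_is_li[OF A(2) B(1)] by blast
    then show False using B by simp
  qed
  have "V.module.lin_indpt {}" by (simp add: V.module.lin_dep_def)
  then have "\<exists>A. finite A \<and> maximal A (\<lambda>S. S \<subseteq> carrier V \<and> V.module.lin_indpt S)"
    by (intro maximal_exists[of _ W.dim "{}"]) (use bound fin in auto)
  then obtain A where A: "finite A" "maximal A (\<lambda>S. S \<subseteq> carrier V \<and> V.module.lin_indpt S)" by blast
  then show ?thesis using V.max_li_is_basis unfolding V.fin_dim_def V.basis_def by blast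
qed

text \<open>An additive embedding of \<open>A\<close> into a rational vector space embeds the tensor
  product as well. In the application \<open>A\<close> is the centre of \<open>N\<close> and
  \<open>e\<close> the logarithm.\<close>

locale tensor_embedding = rat_vectorspace V + A: comm_group A
  for V :: "(rat, 'v, 'z) module_scheme" (structure) and A :: "('a, 'b) monoid_scheme" +
  fixes e :: "'a \<Rightarrow> 'v"
  assumes e_closed: "a \<in> carrier A \<Longrightarrow> e a \<in> carrier V"
    and e_mult: "a \<in> carrier A \<Longrightarrow> b \<in> carrier A \<Longrightarrow> e (a \<otimes>\<^bsub>A\<^esub> b) = e a \<oplus> e b"
    and e_inj: "inj_on e (carrier A)"
begin

abbreviation "F \<equiv> tensor_symbols A"
abbreviation "R \<equiv> tensor_relations A"

definition ext :: "('a \<times> rat \<Rightarrow>\<^sub>0 int) \<Rightarrow> 'v" where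
  "ext = (SOME h. h \<in> hom F (add_monoid V) \<and> (\<forall>a \<in> carrier A. \<forall>q. h (frag_of (a, q)) = q \<odot> e a))"

lemma ext: "ext \<in> hom F (add_monoid V)" "a \<in> carrier A \<Longrightarrow> ext (frag_of (a, q)) = q \<odot> e a"
proof -
  note universal = comm_group.free_Abelian_group_universal[OF a_comm_group]
  have "(\<lambda>(a, q). q \<odot> e a) ` (carrier A \<times> UNIV) \<subseteq> carrier (add_monoid V)"
    by (auto intro!: smult_closed' e_closed)
  then obtain h where "h \<in> hom (free_Abelian_group (carrier A \<times> (UNIV :: rat set))) (add_monoid V)"
    "\<And>x. x \<in> carrier A \<times> UNIV \<Longrightarrow> h (frag_of x) = (\<lambda>(a, q). q \<odot> e a) x"
    by (rule universal[of "\<lambda>(a, q). q \<odot> e a" "carrier A \<times> UNIV"]) (rule that)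
  then have "\<exists>h. h \<in> hom F (add_monoid V) \<and> (\<forall>a \<in> carrier A. \<forall>q. h (frag_of (a, q)) = q \<odot> e a)"
    unfolding tensor_symbols_def by (intro exI[of _ h]) auto
  from someI_ex[OF this] show "ext \<in> hom F (add_monoid V)"
    "a \<in> carrier A \<Longrightarrow> ext (frag_of (a, q)) = q \<odot> e a"
    unfolding ext_def by blast+
qed

lemma carrier_F: "x \<in> carrier F \<longleftrightarrow> Poly_Mapping.keys x \<subseteq> carrier A \<times> UNIV"
  by (simp add: tensor_symbols_def)

lemma F_simps: "x \<otimes>\<^bsub>F\<^esub> y = x + y" "\<one>\<^bsub>F\<^esub> = 0" "x \<in> carrier F \<Longrightarrow> inv\<^bsub>F\<^esub> x = - x"
  by (simp_all add: tensor_symbols_def)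

lemma F_group: "group F"
  by (simp add: tensor_symbols_def)

lemma F_closed: "0 \<in> carrier F" "x \<in> carrier F \<Longrightarrow> y \<in> carrier F \<Longrightarrow> x + y \<in> carrier F"
  "x \<in> carrier F \<Longrightarrow> - x \<in> carrier F" "x \<in> carrier F \<Longrightarrow> y \<in> carrier F \<Longrightarrow> x - y \<in> carrier F"
  "a \<in> carrier A \<Longrightarrow> frag_of (a, q) \<in> carrier F"
proof -
  interpret group F by (rule F_group)
  show "0 \<in> carrier F" using one_closed by (simp add: F_simps)
  show add: "x + y \<in> carrier F" if "x \<in> carrier F" "y \<in> carrier F" for x y
    using m_closed[OF that] by (simp add: F_simps)
  show neg: "- x \<in> carrier F" if "x \<in> carrier F" for x
    using inv_closed[OF that] that by (simp add: F_simps)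
  show "x - y \<in> carrier F" if "x \<in> carrier F" "y \<in> carrier F"
    using add[OF that(1) neg[OF that(2)]] by simp
  show "a \<in> carrier A \<Longrightarrow> frag_of (a, q) \<in> carrier F" by (simp add: carrier_F)
qed

lemma ext_group_hom: "group_hom F (add_monoid V) ext"
  using ext(1) F_group by (simp add: group_hom_def group_hom_axioms_def add.is_group)

lemma ext_simps:
  "x \<in> carrier F \<Longrightarrow> ext x \<in> carrier V"
  "x \<in> carrier F \<Longrightarrow> y \<in> carrier F \<Longrightarrow> ext (x + y) = ext x \<oplus> ext y"
  "ext 0 = \<zero>"
  "x \<in> carrier F \<Longrightarrow> ext (- x) = \<ominus> ext x"
  "x \<in> carrier F \<Longrightarrow> y \<in> carrier F \<Longrightarrow> ext (x - y) = ext x \<ominus> ext y"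
proof -
  interpret h: group_hom F "add_monoid V" ext by (rule ext_group_hom)
  show c: "ext x \<in> carrier V" if "x \<in> carrier F" for x using h.hom_closed[OF that] by simp
  show add: "ext (x + y) = ext x \<oplus> ext y" if "x \<in> carrier F" "y \<in> carrier F" for x y
    using h.hom_mult[OF that] by (simp add: F_simps)
  show "ext 0 = \<zero>" using h.hom_one by (simp add: F_simps)
  show neg: "ext (- x) = \<ominus> ext x" if "x \<in> carrier F" for x
    using h.hom_inv[OF that] that by (simp add: F_simps a_inv_def)
  show "ext (x - y) = ext x \<ominus> ext y" if "x \<in> carrier F" "y \<in> carrier F"
    using add[OF that(1) F_closed(3)[OF that(2)]] neg[OF that(2)] by (simp add: a_minus_def)
qed

lemma relations_generators:
  "{frag_of (a \<otimes>\<^bsub>A\<^esub> b, q) - frag_of (a, q) - frag_of (b, q) | a b q. a \<in> carrier A \<and> b \<in> carrier A} \<union>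
   {frag_of (a, q + r) - frag_of (a, q) - frag_of (a, r) | a q r. a \<in> carrier A} \<subseteq> carrier F"
  by (auto intro!: F_closed(4,5))

lemma relations_subgroup: "subgroup R F"
  unfolding tensor_relations_def by (rule group.generate_is_subgroup[OF F_group relations_generators])

lemma R_closed: "0 \<in> R" "x \<in> R \<Longrightarrow> y \<in> R \<Longrightarrow> x + y \<in> R" "x \<in> R \<Longrightarrow> - x \<in> R"
  "x \<in> R \<Longrightarrow> y \<in> R \<Longrightarrow> x - y \<in> R" "x \<in> R \<Longrightarrow> x \<in> carrier F"
proof -
  interpret R: subgroup R F by (rule relations_subgroup)
  show "0 \<in> R" using R.one_closed by (simp add: F_simps)
  show add: "x + y \<in> R" if "x \<in> R" "y \<in> R" for x y using R.m_closed[OF that] by (simp add: F_simps)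
  show c: "x \<in> carrier F" if "x \<in> R" for x using R.mem_carrier[OF that] .
  show neg: "- x \<in> R" if "x \<in> R" for x using R.m_inv_closed[OF that] c[OF that] by (simp add: F_simps)
  show "x - y \<in> R" if "x \<in> R" "y \<in> R" using add[OF that(1) neg[OF that(2)]] by simp
qed

lemma rel_left: "a \<in> carrier A \<Longrightarrow> b \<in> carrier A \<Longrightarrow>
    frag_of (a \<otimes>\<^bsub>A\<^esub> b, q) - frag_of (a, q) - frag_of (b, q) \<in> R"
  unfolding tensor_relations_def by (rule generate.incl) blast

lemma rel_right: "a \<in> carrier A \<Longrightarrow> frag_of (a, q + r) - frag_of (a, q) - frag_of (a, r) \<in> R"
  unfolding tensor_relations_def by (rule generate.incl) blast

text \<open>For two unit elements the defining relation collapses to minus one symbol.\<close>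

lemma rel_one: "frag_of (\<one>\<^bsub>A\<^esub>, q) \<in> R"
  using R_closed(3)[OF rel_left[of "\<one>\<^bsub>A\<^esub>" "\<one>\<^bsub>A\<^esub>" q]] by simp

lemma rel_zero: "a \<in> carrier A \<Longrightarrow> frag_of (a, 0) \<in> R"
  using R_closed(3)[OF rel_right[of a 0 0]] by simp

lemma rel_inv: "a \<in> carrier A \<Longrightarrow> frag_of (inv\<^bsub>A\<^esub> a, q) + frag_of (a, q) \<in> R"
  using R_closed(4)[OF rel_one[of q] rel_left[of "inv\<^bsub>A\<^esub> a" a q]] by (simp add: add.commute)

lemma rel_uminus: "a \<in> carrier A \<Longrightarrow> frag_of (a, - q) + frag_of (a, q) \<in> R"
  using R_closed(4)[OF rel_zero[of a] rel_right[of a "- q" q]] by (simp add: add.commute)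

lemma rel_pow: "a \<in> carrier A \<Longrightarrow> frag_of (a, of_nat m * q) - frag_of (a [^]\<^bsub>A\<^esub> m, q) \<in> R"
proof (induction m)
  case 0
  then show ?case using R_closed(4)[OF rel_zero rel_one] by simp
next
  case (Suc m)
  have "frag_of (a, of_nat m * q + q) - frag_of (a, of_nat m * q) - frag_of (a, q)
    + (frag_of (a, of_nat m * q) - frag_of (a [^]\<^bsub>A\<^esub> m, q))
    - (frag_of (a [^]\<^bsub>A\<^esub> m \<otimes>\<^bsub>A\<^esub> a, q) - frag_of (a [^]\<^bsub>A\<^esub> m, q) - frag_of (a, q)) \<in> R"
    using Suc.prems
    by (intro R_closed(4)[OF R_closed(2)[OF rel_right Suc.IH] rel_left]) auto
  then show ?case by (simp add: algebra_simps)
qed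

text \<open>Common denominators make every tensor a single symbol with second entry 1/n. This form
  reduces injectivity on the tensor product to injectivity of \<open>e\<close>.\<close>

lemma tensor_normal_form:
  assumes "x \<in> carrier F"
  shows "\<exists>a \<in> carrier A. \<exists>n > 0. x - frag_of (a, 1 / of_nat n) \<in> R"
  using assms unfolding carrier_F
proof (induction x rule: frag_induction)
  case zero
  show ?case using R_closed(3)[OF rel_one[of 1]] by (intro bexI[of _ "\<one>\<^bsub>A\<^esub>"] exI[of _ 1]) auto
next
  case (diff x y)
  then obtain a b n m where ab: "a \<in> carrier A" "b \<in> carrier A" "n > 0" "m > 0"
    and xy: "x - frag_of (a, 1 / of_nat n) \<in> R" "y - frag_of (b, 1 / of_nat m) \<in> R" by blast
  \<comment> \<open>Both denominators are refined to \<open>n * m\<close>; by \<open>rel_pow\<close>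
    the surplus integer factors move into \<open>A\<close> as powers.\<close>
  define q where "q = (1 / of_nat (n * m) :: rat)"
  define a' b' where "a' = a [^]\<^bsub>A\<^esub> m" and "b' = b [^]\<^bsub>A\<^esub> n"
  have a'b': "a' \<in> carrier A" "b' \<in> carrier A" using ab by (simp_all add: a'_def b'_def)
  have a'q: "frag_of (a, 1 / of_nat n) - frag_of (a', q) \<in> R"
    using rel_pow[OF ab(1), of m q] ab by (simp add: q_def a'_def)
  have b'q: "frag_of (b, 1 / of_nat m) - frag_of (b', q) \<in> R"
    using rel_pow[OF ab(2), of n q] ab by (simp add: q_def b'_def)
  have "(x - frag_of (a, 1 / of_nat n)) + (frag_of (a, 1 / of_nat n) - frag_of (a', q))
    - ((y - frag_of (b, 1 / of_nat m)) + (frag_of (b, 1 / of_nat m) - frag_of (b', q)))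
    - (frag_of (a' \<otimes>\<^bsub>A\<^esub> inv\<^bsub>A\<^esub> b', q) - frag_of (a', q) - frag_of (inv\<^bsub>A\<^esub> b', q))
    - (frag_of (inv\<^bsub>A\<^esub> b', q) + frag_of (b', q)) \<in> R"
    by (rule R_closed(4)[OF R_closed(4)[OF R_closed(4)[OF R_closed(2)[OF xy(1) a'q] R_closed(2)[OF xy(2) b'q]]
          rel_left[OF a'b'(1) A.inv_closed[OF a'b'(2)]]] rel_inv[OF a'b'(2)]])
  then have "x - y - frag_of (a' \<otimes>\<^bsub>A\<^esub> inv\<^bsub>A\<^esub> b', 1 / of_nat (n * m)) \<in> R" by (simp add: q_def algebra_simps)
  moreover have "n * m > 0" using ab by simp
  moreover have "a' \<otimes>\<^bsub>A\<^esub> inv\<^bsub>A\<^esub> b' \<in> carrier A" using a'b' by simp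
  ultimately show ?case by blast
next
  case (one p)
  then obtain a q where p: "p = (a, q)" "a \<in> carrier A" by auto
  obtain k n where kn: "quotient_of q = (k, n)" by (cases "quotient_of q")
  then have n: "n > 0" and q: "q = of_int k / of_int n"
    using quotient_of_denom_pos quotient_of_div by blast+
  define u where "u = (1 / of_nat (nat n) :: rat)"
  define m where "m = nat \<bar>k\<bar>"
  have pos: "frag_of (a, of_nat m * u) - frag_of (a [^]\<^bsub>A\<^esub> m, u) \<in> R" using rel_pow[OF p(2)] .
  show ?case
  proof (cases "k \<ge> 0")
    case True
    then have "q = of_nat m * u" using n by (simp add: q u_def m_def)
    then show ?thesis using pos n p unfolding u_def
      by (intro bexI[of _ "a [^]\<^bsub>A\<^esub> m"] exI[of _ "nat n"]) auto
  next
    case False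
    then have "q = - (of_nat m * u)" using n by (simp add: q u_def m_def)
    moreover have "frag_of (a, - (of_nat m * u)) + frag_of (a, of_nat m * u)
      - (frag_of (a, of_nat m * u) - frag_of (a [^]\<^bsub>A\<^esub> m, u))
      - (frag_of (inv\<^bsub>A\<^esub> (a [^]\<^bsub>A\<^esub> m), u) + frag_of (a [^]\<^bsub>A\<^esub> m, u)) \<in> R"
      using p by (intro R_closed(4)[OF R_closed(4)[OF rel_uminus pos] rel_inv]) auto
    ultimately have "frag_of p - frag_of (inv\<^bsub>A\<^esub> (a [^]\<^bsub>A\<^esub> m), 1 / of_nat (nat n)) \<in> R"
      by (simp add: p u_def)
    then show ?thesis using n p by (intro bexI[of _ "inv\<^bsub>A\<^esub> (a [^]\<^bsub>A\<^esub> m)"] exI[of _ "nat n"]) auto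
  qed
qed

lemma e_one: "e \<one>\<^bsub>A\<^esub> = \<zero>"
  using e_mult[of "\<one>\<^bsub>A\<^esub>" "\<one>\<^bsub>A\<^esub>"] e_closed[of "\<one>\<^bsub>A\<^esub>"] by (simp add: add.r_cancel_one')

lemma relations_subset_kernel: "R \<subseteq> kernel F (add_monoid V) ext"
proof -
  interpret h: group_hom F "add_monoid V" ext by (rule ext_group_hom)
  have cancel: "u \<oplus> v \<ominus> u \<ominus> v = \<zero>" if "u \<in> carrier V" "v \<in> carrier V" for u v
  proof -
    have "u \<oplus> v \<ominus> u = v" using that by (simp add: a_minus_def a_comm[of u v] a_assoc r_neg)
    then show ?thesis using that by (simp add: a_minus_def r_neg)
  qed
  show ?thesis
    unfolding tensor_relations_def
  proof (rule group.generate_subgroup_incl[OF F_group _ h.subgroup_kernel])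
    have left: "ext (frag_of (a \<otimes>\<^bsub>A\<^esub> b, q) - frag_of (a, q) - frag_of (b, q)) = \<zero>"
      if ab: "a \<in> carrier A" "b \<in> carrier A" for a b q
    proof -
      have "ext (frag_of (a \<otimes>\<^bsub>A\<^esub> b, q) - frag_of (a, q) - frag_of (b, q))
        = (q \<odot> e a \<oplus> q \<odot> e b) \<ominus> q \<odot> e a \<ominus> q \<odot> e b"
        using ab by (simp add: ext_simps F_closed ext(2) e_mult e_closed smult_add_right)
      then show ?thesis using ab by (simp add: cancel e_closed smult_closed')
    qed
    have right: "ext (frag_of (a, q + r) - frag_of (a, q) - frag_of (a, r)) = \<zero>"
      if a: "a \<in> carrier A" for a q r
    proof -
      have "ext (frag_of (a, q + r) - frag_of (a, q) - frag_of (a, r))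
        = (q \<odot> e a \<oplus> r \<odot> e a) \<ominus> q \<odot> e a \<ominus> r \<odot> e a"
        using a by (simp add: ext_simps F_closed ext(2) e_closed smult_add_left)
      then show ?thesis using a by (simp add: cancel e_closed smult_closed')
    qed
    have "ext x = \<zero>" if "x \<in> {frag_of (a \<otimes>\<^bsub>A\<^esub> b, q) - frag_of (a, q) - frag_of (b, q) | a b q. a \<in> carrier A \<and> b \<in> carrier A} \<union>
        {frag_of (a, q + r) - frag_of (a, q) - frag_of (a, r) | a q r. a \<in> carrier A}" for x
      using that left right by blast
    then show "{frag_of (a \<otimes>\<^bsub>A\<^esub> b, q) - frag_of (a, q) - frag_of (b, q) | a b q. a \<in> carrier A \<and> b \<in> carrier A} \<union>
      {frag_of (a, q + r) - frag_of (a, q) - frag_of (a, r) | a q r. a \<in> carrier A}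
      \<subseteq> kernel F (add_monoid V) ext"
      using relations_generators unfolding kernel_def by (simp only: subset_iff mem_Collect_eq) simp
  qed
qed

text \<open>In normal form, a kernel element has (1/n) times \<open>e a\<close> equal to zero.
  Division in the rational space and injectivity of \<open>e\<close> force \<open>a\<close> to be
  the unit, whose symbol is a relation.\<close>

lemma kernel_ext: "kernel F (add_monoid V) ext = R"
proof
  show "R \<subseteq> kernel F (add_monoid V) ext" by (rule relations_subset_kernel)
  show "kernel F (add_monoid V) ext \<subseteq> R"
  proof
    fix x assume "x \<in> kernel F (add_monoid V) ext"
    then have x: "x \<in> carrier F" "ext x = \<zero>" by (auto simp: kernel_def)
    obtain a n where a: "a \<in> carrier A" "n > 0" and r: "x - frag_of (a, 1 / of_nat n) \<in> R"
      using tensor_normal_form[OF x(1)] by blast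
    have "x - frag_of (a, 1 / of_nat n) \<in> kernel F (add_monoid V) ext"
      using r relations_subset_kernel by blast
    then have "\<zero> = \<zero> \<ominus> (1 / of_nat n) \<odot> e a"
      using x a by (simp add: kernel_def ext_simps F_closed ext(2))
    then have "\<ominus> ((1 / of_nat n) \<odot> e a) = \<zero>"
      using e_closed[OF a(1)] smult_closed' by (simp add: a_minus_def)
    then have "(1 / of_nat n) \<odot> e a = \<zero>"
      using minus_minus[of "(1 / of_nat n) \<odot> e a"] smult_closed'[OF e_closed[OF a(1)]] by simp
    then have "e a = \<zero>" using smult_eq_zeroD[OF e_closed[OF a(1)], of "1 / of_nat n"] a(2) by simp
    then have "a = \<one>\<^bsub>A\<^esub>" using inj_onD[OF e_inj, of a "\<one>\<^bsub>A\<^esub>"] a e_one by simp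
    then show "x \<in> R" using R_closed(2)[OF r rel_one[of "1 / of_nat n"]] by simp
  qed
qed

end

context tensor_embedding
begin

text \<open>\<open>ext\<close> is constant on cosets of the relations, so the image of a coset is a
  singleton.\<close>

definition tensor_map :: "('a \<times> rat \<Rightarrow>\<^sub>0 int) set \<Rightarrow> 'v" where
  "tensor_map X = the_elem (ext ` X)"

lemma relations_normal: "R \<lhd> F"
  using group_hom.normal_kernel[OF ext_group_hom] by (simp add: kernel_ext)

lemma ext_relations: "x \<in> R \<Longrightarrow> ext x = \<zero>"
  using kernel_ext by (auto simp: kernel_def)

lemma coset_altdef: "R #>\<^bsub>F\<^esub> x = (\<lambda>r. r + x) ` R"
  by (auto simp: r_coset_def F_simps)

lemma tensor_map_coset: "x \<in> carrier F \<Longrightarrow> tensor_map (R #>\<^bsub>F\<^esub> x) = ext x"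
proof -
  assume x: "x \<in> carrier F"
  have "ext ` (R #>\<^bsub>F\<^esub> x) = (\<lambda>r. ext x) ` R"
    unfolding coset_altdef image_image using x
    by (intro image_cong) (simp_all add: ext_simps R_closed ext_relations)
  also have "\<dots> = {ext x}" using R_closed(1) by auto
  finally show ?thesis by (simp add: tensor_map_def)
qed

lemma tensor_carrier: "carrier (tensor_rat A) = (\<lambda>x. R #>\<^bsub>F\<^esub> x) ` carrier F"
  by (simp add: tensor_rat_def Let_def carrier_FactGroup)

lemma tensor_add:
  "x \<in> carrier F \<Longrightarrow> y \<in> carrier F \<Longrightarrow>
    (R #>\<^bsub>F\<^esub> x) \<oplus>\<^bsub>tensor_rat A\<^esub> (R #>\<^bsub>F\<^esub> y) = R #>\<^bsub>F\<^esub> (x + y)"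
  using normal.rcos_sum[OF relations_normal, of x y] by (simp add: tensor_rat_def Let_def F_simps)

lemma tensor_zero: "\<zero>\<^bsub>tensor_rat A\<^esub> = R #>\<^bsub>F\<^esub> 0"
  by (simp add: tensor_rat_def Let_def coset_altdef)

lemma tensor_smult_def: "q \<odot>\<^bsub>tensor_rat A\<^esub> X = tensor_induced A (\<lambda>(a, r). (a, q * r)) X"
  by (simp add: tensor_rat_def Let_def)

lemma tensor_map_inj: "inj_on tensor_map (carrier (tensor_rat A))"
  using group_hom.FactGroup_inj_on[OF ext_group_hom]
  by (simp add: kernel_ext tensor_map_def[abs_def] tensor_rat_def Let_def)

text \<open>One argument for both scalar multiplication and the map induced by \<sigma>: whatever
  \<open>ext\<close> carries to a linear operator \<open>k\<close> descends to cosets.\<close>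

lemma tensor_induced:
  assumes "rat_operator V k" and g: "\<And>a q. a \<in> carrier A \<Longrightarrow> fst (g (a, q)) \<in> carrier A"
    "\<And>a q. a \<in> carrier A \<Longrightarrow> ext (frag_of (g (a, q))) = k (q \<odot> e a)"
    and X: "X \<in> carrier (tensor_rat A)"
  shows "tensor_induced A g X \<in> carrier (tensor_rat A)" "tensor_map (tensor_induced A g X) = k (tensor_map X)"
proof -
  interpret k: rat_operator V k by fact
  define G where "G = frag_extend (\<lambda>s. frag_of (g s))"
  have G: "x \<in> carrier F \<and> G x \<in> carrier F \<and> ext (G x) = k (ext x)" if "x \<in> carrier F" for x
    using that[unfolded carrier_F]
  proof (induction x rule: frag_induction)
    case zero
    show ?case by (simp add: G_def ext_simps k.f_zero F_closed)
  next
    case (diff x y)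
    then have xy: "x \<in> carrier F" "y \<in> carrier F" "G x \<in> carrier F" "G y \<in> carrier F" by blast+
    have "k (ext x \<ominus> ext y) = k (ext x) \<ominus> k (ext y)"
      using xy by (simp add: a_minus_def k.f_add k.f_neg ext_simps)
    moreover have "G (x - y) = G x - G y" by (simp add: G_def frag_extend_diff)
    ultimately show ?case using diff xy F_closed(4)[OF xy(1,2)] F_closed(4)[OF xy(3,4)] by (simp add: ext_simps)
  next
    case (one p)
    then obtain a q where p: "p = (a, q)" "a \<in> carrier A" by auto
    then show ?case using g[of a q] by (cases "g (a, q)") (simp add: G_def ext(2) F_closed)
  qed
  obtain x where x: "x \<in> carrier F" "X = R #>\<^bsub>F\<^esub> x" using X unfolding tensor_carrier by blast
  \<comment> \<open>Relations are preserved because they form the kernel of \<open>ext\<close> and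
    \<open>k\<close> fixes zero; their generators need not be inspected.\<close>
  have G_R: "G r \<in> R" if "r \<in> R" for r
  proof -
    have r: "r \<in> carrier F" using that by (rule R_closed)
    then have "ext (G r) = \<zero>" "G r \<in> carrier F" using G[OF r] ext_relations[OF that] by (simp_all add: k.f_zero)
    then show ?thesis using kernel_ext by (auto simp: kernel_def)
  qed
  have "tensor_induced A g X = R #>\<^bsub>F\<^esub> G x"
  proof -
    have "tensor_induced A g X = {r + G (r' + x) |r r'. r \<in> R \<and> r' \<in> R}"
      unfolding tensor_induced_def x(2) coset_altdef G_def[symmetric] set_mult_def F_simps by blast
    also have "\<dots> = (\<lambda>r. r + G x) ` R"
    proof
      show "{r + G (r' + x) |r r'. r \<in> R \<and> r' \<in> R} \<subseteq> (\<lambda>r. r + G x) ` R"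
      proof
        fix y assume "y \<in> {r + G (r' + x) |r r'. r \<in> R \<and> r' \<in> R}"
        then obtain r r' where r: "r \<in> R" "r' \<in> R" "y = r + G (r' + x)" by blast
        then have "y = (r + G r') + G x" by (simp add: G_def frag_extend_add ac_simps)
        then show "y \<in> (\<lambda>r. r + G x) ` R" using R_closed(2)[OF r(1) G_R[OF r(2)]] by blast
      qed
      show "(\<lambda>r. r + G x) ` R \<subseteq> {r + G (r' + x) |r r'. r \<in> R \<and> r' \<in> R}"
        using R_closed(1) by force
    qed
    finally show ?thesis by (simp add: coset_altdef)
  qed
  then show "tensor_induced A g X \<in> carrier (tensor_rat A)" "tensor_map (tensor_induced A g X) = k (tensor_map X)"
    using G[OF x(1)] x tensor_map_coset unfolding tensor_carrier by auto
qed

lemma smult_operator: "rat_operator V (\<lambda>v. q \<odot> v)"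
  by unfold_locales (simp_all add: smult_closed' smult_add_right smult_smult mult.commute)

lemma tensor_ops:
  "\<zero>\<^bsub>tensor_rat A\<^esub> \<in> carrier (tensor_rat A)" "tensor_map \<zero>\<^bsub>tensor_rat A\<^esub> = \<zero>"
  "X \<in> carrier (tensor_rat A) \<Longrightarrow> Y \<in> carrier (tensor_rat A) \<Longrightarrow> X \<oplus>\<^bsub>tensor_rat A\<^esub> Y \<in> carrier (tensor_rat A)"
  "X \<in> carrier (tensor_rat A) \<Longrightarrow> Y \<in> carrier (tensor_rat A) \<Longrightarrow>
    tensor_map (X \<oplus>\<^bsub>tensor_rat A\<^esub> Y) = tensor_map X \<oplus> tensor_map Y"
  "X \<in> carrier (tensor_rat A) \<Longrightarrow> q \<odot>\<^bsub>tensor_rat A\<^esub> X \<in> carrier (tensor_rat A)"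
  "X \<in> carrier (tensor_rat A) \<Longrightarrow> tensor_map (q \<odot>\<^bsub>tensor_rat A\<^esub> X) = q \<odot> tensor_map X"
  "X \<in> carrier (tensor_rat A) \<Longrightarrow> tensor_map X \<in> carrier V"
proof -
  show "\<zero>\<^bsub>tensor_rat A\<^esub> \<in> carrier (tensor_rat A)" "tensor_map \<zero>\<^bsub>tensor_rat A\<^esub> = \<zero>"
    using F_closed(1) by (simp_all add: tensor_zero tensor_carrier tensor_map_coset ext_simps)
  show "X \<oplus>\<^bsub>tensor_rat A\<^esub> Y \<in> carrier (tensor_rat A)"
    "tensor_map (X \<oplus>\<^bsub>tensor_rat A\<^esub> Y) = tensor_map X \<oplus> tensor_map Y"
    if XY: "X \<in> carrier (tensor_rat A)" "Y \<in> carrier (tensor_rat A)"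
  proof -
    obtain x y where "x \<in> carrier F" "y \<in> carrier F" "X = R #>\<^bsub>F\<^esub> x" "Y = R #>\<^bsub>F\<^esub> y"
      using XY unfolding tensor_carrier by blast
    then show "X \<oplus>\<^bsub>tensor_rat A\<^esub> Y \<in> carrier (tensor_rat A)"
      "tensor_map (X \<oplus>\<^bsub>tensor_rat A\<^esub> Y) = tensor_map X \<oplus> tensor_map Y"
      by (simp_all add: tensor_add tensor_carrier tensor_map_coset ext_simps F_closed)
  qed
  show "q \<odot>\<^bsub>tensor_rat A\<^esub> X \<in> carrier (tensor_rat A)"
    "tensor_map (q \<odot>\<^bsub>tensor_rat A\<^esub> X) = q \<odot> tensor_map X" if "X \<in> carrier (tensor_rat A)"
    unfolding tensor_smult_def using that
    by (intro tensor_induced[OF smult_operator]; simp add: ext(2) smult_smult e_closed)+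
  show "tensor_map X \<in> carrier V" if "X \<in> carrier (tensor_rat A)"
    using that by (auto simp: tensor_carrier tensor_map_coset ext_simps)
qed

lemma tensor_eqI:
  "X \<in> carrier (tensor_rat A) \<Longrightarrow> Y \<in> carrier (tensor_rat A) \<Longrightarrow> tensor_map X = tensor_map Y \<Longrightarrow> X = Y"
  using inj_onD[OF tensor_map_inj] by blast

text \<open>The equational axioms are pulled back from \<open>V\<close> along the injective
  \<open>tensor_map\<close>.\<close>

lemma tensor_vectorspace: "vectorspace class_ring (tensor_rat A)"
proof -
  let ?T = "tensor_rat A"
  note simps = tensor_ops a_ac smult_smult smult_1 smult_add_left smult_add_right smult_closed'
    smult_neg r_neg
  have ax: "v \<oplus>\<^bsub>?T\<^esub> w = w \<oplus>\<^bsub>?T\<^esub> v"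
      "(v \<oplus>\<^bsub>?T\<^esub> w) \<oplus>\<^bsub>?T\<^esub> x = v \<oplus>\<^bsub>?T\<^esub> (w \<oplus>\<^bsub>?T\<^esub> x)"
      "v \<oplus>\<^bsub>?T\<^esub> \<zero>\<^bsub>?T\<^esub> = v" "v \<oplus>\<^bsub>?T\<^esub> ((- 1) \<odot>\<^bsub>?T\<^esub> v) = \<zero>\<^bsub>?T\<^esub>"
      "(a * b) \<odot>\<^bsub>?T\<^esub> v = a \<odot>\<^bsub>?T\<^esub> (b \<odot>\<^bsub>?T\<^esub> v)" "1 \<odot>\<^bsub>?T\<^esub> v = v"
      "(a + b) \<odot>\<^bsub>?T\<^esub> v = a \<odot>\<^bsub>?T\<^esub> v \<oplus>\<^bsub>?T\<^esub> b \<odot>\<^bsub>?T\<^esub> v"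
      "a \<odot>\<^bsub>?T\<^esub> (v \<oplus>\<^bsub>?T\<^esub> w) = a \<odot>\<^bsub>?T\<^esub> v \<oplus>\<^bsub>?T\<^esub> a \<odot>\<^bsub>?T\<^esub> w"
    if "v \<in> carrier ?T" "w \<in> carrier ?T" "x \<in> carrier ?T" for v w x a b
    by (rule tensor_eqI; simp add: that simps)+
  show ?thesis
  proof (rule vs_criteria)
    show "\<forall>v\<in>carrier ?T. \<exists>neg_v\<in>carrier ?T. v \<oplus>\<^bsub>?T\<^esub> neg_v = \<zero>\<^bsub>?T\<^esub>"
      using ax(4) tensor_ops(5) by blast
    show "field (class_ring :: rat ring)" by (rule class_field)
    show "\<forall>v w. v \<in> carrier ?T \<and> w \<in> carrier ?T \<longrightarrow> v \<oplus>\<^bsub>?T\<^esub> w = w \<oplus>\<^bsub>?T\<^esub> v"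
      by (intro allI impI, elim conjE) (rule ax(1))
    show "\<forall>a v w. a \<in> carrier class_ring \<and> v \<in> carrier ?T \<and> w \<in> carrier ?T \<longrightarrow>
      a \<odot>\<^bsub>?T\<^esub> (v \<oplus>\<^bsub>?T\<^esub> w) = a \<odot>\<^bsub>?T\<^esub> v \<oplus>\<^bsub>?T\<^esub> a \<odot>\<^bsub>?T\<^esub> w"
      by (intro allI impI, elim conjE) (rule ax(8))
  qed (simp_all add: ax tensor_ops del: tensor_ops(2,4,6))
qed

lemma tensor_linear_map: "linear_map class_ring (tensor_rat A) V tensor_map"
proof -
  have "tensor_map \<in> LinearCombinations.module_hom class_ring (tensor_rat A) V"
    by (auto simp: LinearCombinations.module_hom_def tensor_ops)
  then show ?thesis
    using tensor_vectorspace vectorspace_axioms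
    unfolding linear_map_def mod_hom_def mod_hom_axioms_def vectorspace_def by blast
qed

lemma tensor_map_surj: "a \<in> carrier A \<Longrightarrow> q \<odot> e a \<in> tensor_map ` carrier (tensor_rat A)"
  using F_closed(5)[of a q] tensor_map_coset[of "frag_of (a, q)"] ext(2)[of a q]
  unfolding tensor_carrier by (metis image_eqI)

end

locale tensor_operator = tensor_embedding V A e + phi: rat_operator V \<phi>
  for V :: "(rat, 'v, 'z) module_scheme" (structure) and A :: "('a, 'b) monoid_scheme"
    and e :: "'a \<Rightarrow> 'v" and \<phi> :: "'v \<Rightarrow> 'v" +
  fixes f :: "'a \<Rightarrow> 'a"
  assumes f_closed: "a \<in> carrier A \<Longrightarrow> f a \<in> carrier A"
    and e_f: "a \<in> carrier A \<Longrightarrow> e (f a) = \<phi> (e a)"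
begin

lemma tensor_rat_map:
  assumes "X \<in> carrier (tensor_rat A)"
  shows "tensor_rat_map A f X \<in> carrier (tensor_rat A)"
    "tensor_map (tensor_rat_map A f X) = \<phi> (tensor_map X)"
  unfolding tensor_rat_map_def using assms
  by (intro tensor_induced[OF phi.rat_operator_axioms]; simp add: ext(2) f_closed e_f phi.f_smult e_closed)+

sublocale T: rat_operator "tensor_rat A" "tensor_rat_map A f"
proof -
  interpret T: vectorspace class_ring "tensor_rat A" by (rule tensor_vectorspace)
  show "rat_operator (tensor_rat A) (tensor_rat_map A f)"
  proof unfold_locales
    show "tensor_rat_map A f (X \<oplus>\<^bsub>tensor_rat A\<^esub> Y)
        = tensor_rat_map A f X \<oplus>\<^bsub>tensor_rat A\<^esub> tensor_rat_map A f Y"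
      if "X \<in> carrier (tensor_rat A)" "Y \<in> carrier (tensor_rat A)" for X Y
      by (rule tensor_eqI) (use that in \<open>simp_all add: tensor_rat_map tensor_ops phi.f_add\<close>)
    show "tensor_rat_map A f (q \<odot>\<^bsub>tensor_rat A\<^esub> X) = q \<odot>\<^bsub>tensor_rat A\<^esub> tensor_rat_map A f X"
      if "X \<in> carrier (tensor_rat A)" for q X
      by (rule tensor_eqI) (use that in \<open>simp_all add: tensor_rat_map tensor_ops phi.f_smult\<close>)
  qed (rule tensor_rat_map(1))
qed

lemma tensor_map_pact:
  "X \<in> carrier (tensor_rat A) \<Longrightarrow> tensor_map (T.pact p X) = phi.pact p (tensor_map X)"
  by (induction p)
    (simp_all add: T.pact_0 phi.pact_0 T.pact_pCons phi.pact_pCons tensor_ops tensor_rat_map T.pact_closed)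

text \<open>Everything later needed about the determinant on the centre, with bases and cosets
  hidden: Cayley-Hamilton holds on the image of \<open>A\<close> in \<open>V\<close>, and
  polynomials annihilating the operator on \<open>V\<close> annihilate the matrix.\<close>

lemma tensor_matrix:
  assumes "fin_dim"
  obtains B k where "B \<in> carrier_mat k k" "lin_det (tensor_rat A) (tensor_rat_map A f) = det B"
    "\<And>a. a \<in> carrier A \<Longrightarrow> phi.pact (char_poly B) (e a) = \<zero>"
    "\<And>p. \<forall>v \<in> carrier V. phi.pact p v = \<zero> \<Longrightarrow> mat_poly B p = 0\<^sub>m k k"
proof -
  have fd: "T.fin_dim" by (rule fin_dim_of_inj_linear_map[OF tensor_linear_map tensor_map_inj assms])
  define B where "B = (SOME B. \<exists>bs. represents (tensor_rat A) (tensor_rat_map A f) bs B)"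
  have "\<exists>B bs. represents (tensor_rat A) (tensor_rat_map A f) bs B"
    by (rule T.represents_exists[OF fd T.f_closed]) blast+
  from someI_ex[OF this] obtain bs where bs: "represents (tensor_rat A) (tensor_rat_map A f) bs B"
    unfolding B_def by blast
  show ?thesis
  proof
    show "B \<in> carrier_mat (length bs) (length bs)" using bs by (simp add: represents_def)
    show "lin_det (tensor_rat A) (tensor_rat_map A f) = det B" by (simp add: lin_det_def B_def)
    show "phi.pact (char_poly B) (e a) = \<zero>" if a: "a \<in> carrier A" for a
    proof -
      \<comment> \<open>The class of \<open>a\<close> tensored with 1.\<close>
      obtain X where X: "X \<in> carrier (tensor_rat A)" "e a = tensor_map X"
        using tensor_map_surj[OF a, of 1] a by (auto simp: smult_1 e_closed)
      then show ?thesis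
        using tensor_map_pact[OF X(1), of "char_poly B"] T.pact_char_poly[OF bs X(1)] by (simp add: tensor_ops)
    qed
    show "mat_poly B p = 0\<^sub>m (length bs) (length bs)"
      if p: "\<forall>v \<in> carrier V. phi.pact p v = \<zero>" for p
    proof (rule T.mat_poly_eq_zero[OF bs])
      fix X assume X: "X \<in> carrier (tensor_rat A)"
      show "T.pact p X = \<zero>\<^bsub>tensor_rat A\<^esub>"
        by (rule tensor_eqI) (use X p in \<open>simp_all add: T.pact_closed tensor_map_pact tensor_ops\<close>)
    qed
  qed
qed

end

section \<open>The theorem\<close>

theorem theorem3p6:
  fixes \<pi> :: "nat set"
    and N :: "('a, 'b) monoid_scheme" and \<sigma> :: "'a \<Rightarrow> 'a"
    and M :: "('m, 'd) monoid_scheme" and \<iota> :: "'a \<Rightarrow> 'm"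
    and L :: "(rat, 'l, 'z) lie_algebra_scheme" and lg :: "'m \<Rightarrow> 'l"
  assumes "\<forall>p \<in> \<pi>. prime p"
    and "torsion_free_group N" and "nilpotent_group N" and "finite_pruefer_rank N"
    and "pi_divisible \<pi> N"
    and "malcev_completion N M \<iota>" and "malcev_correspondence M L lg"
    and "pi_like_endomorphism \<pi> N M \<iota> L lg \<sigma>"
    and "pi_unit \<pi> (det_on_centre N \<sigma>)"
  shows "\<sigma> \<in> iso N N"
proof -

  \<comment> \<open>The logarithm on the Mal'cev completion\<close>
  interpret N: group N using assms(2) by (simp add: torsion_free_group_def)
  interpret M: group M using assms(6) by (simp add: malcev_completion_def torsion_free_group_def)
  interpret rational_lie_algebra L using assms(7) by (simp add: malcev_correspondence_def)
  obtain c where c: "lie_nilpotent_class_le L c"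
    and lg_mult: "\<And>x y. x \<in> carrier M \<Longrightarrow> y \<in> carrier M \<Longrightarrow> lg (x \<otimes>\<^bsub>M\<^esub> y) = bch L c (lg x) (lg y)"
    using assms(7) by (auto simp: malcev_correspondence_def)
  have lg: "bij_betw lg (carrier M) (carrier L)" using assms(7) by (simp add: malcev_correspondence_def)
  have lg_closed: "lg x \<in> carrier L" if "x \<in> carrier M" for x using bij_betwE[OF lg] that by blast
  have lg_surj: "\<exists>x \<in> carrier M. lg x = v" if "v \<in> carrier L" for v
    using that unfolding bij_betw_imp_surj_on[OF lg, symmetric] by blast
  note lg_inj = bij_betw_imp_inj_on[OF lg]
  have lg_pow: "lg (x [^]\<^bsub>M\<^esub> n) = of_nat n \<odot>\<^bsub>L\<^esub> lg x" if "x \<in> carrier M" for x and n :: nat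
    by (rule bch_hom_pow[OF c M.is_group lg_closed lg_mult that])
  have lg_inv: "lg (inv\<^bsub>M\<^esub> x) = \<ominus>\<^bsub>L\<^esub> lg x" if x: "x \<in> carrier M" for x
  proof -
    obtain y where "y \<in> carrier M" "lg y = \<ominus>\<^bsub>L\<^esub> lg x" using lg_surj lg_closed[OF x] by blast
    then show ?thesis using bch_hom_inv[OF c M.is_group lg_closed lg_mult lg_inj x, of y] by simp
  qed

  \<comment> \<open>Its restriction to \<open>N\<close>\<close>
  have \<iota>: "\<iota> \<in> hom N M" "inj_on \<iota> (carrier N)"
    and \<iota>_root: "\<And>x. x \<in> carrier M \<Longrightarrow> \<exists>n::nat. n > 0 \<and> x [^]\<^bsub>M\<^esub> n \<in> \<iota> ` carrier N"
    using assms(6) by (auto simp: malcev_completion_def)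
  interpret \<iota>: group_hom N M \<iota> by (simp add: group_hom_def group_hom_axioms_def \<iota> N.is_group M.is_group)
  define l where "l = (\<lambda>X. lg (\<iota> X))"
  have l_closed: "l X \<in> carrier L" if "X \<in> carrier N" for X
    using that by (simp add: l_def lg_closed)
  have l_inj: "inj_on l (carrier N)"
    unfolding l_def using \<iota>(2) lg_inj \<iota>.hom_closed by (auto simp: inj_on_def)
  have l_mult: "l (X \<otimes>\<^bsub>N\<^esub> Y) = bch L c (l X) (l Y)" if "X \<in> carrier N" "Y \<in> carrier N" for X Y
    using that by (simp add: l_def lg_mult)
  have l_pow: "l (X [^]\<^bsub>N\<^esub> n) = of_nat n \<odot>\<^bsub>L\<^esub> l X" if "X \<in> carrier N" for X and n :: nat
    by (rule bch_hom_pow[OF c N.is_group l_closed l_mult that])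
  have l_inv: "l (inv\<^bsub>N\<^esub> X) = \<ominus>\<^bsub>L\<^esub> l X" if "X \<in> carrier N" for X
    using that by (simp add: l_def lg_inv)
  \<comment> \<open>The rational span of the logarithms is all of \<open>L\<close>; each later
    passage from \<open>N\<close> to \<open>L\<close> multiplies by such an n and divides
    again.\<close>
  have l_full: "\<exists>n::nat. n > 0 \<and> (\<exists>X \<in> carrier N. of_nat n \<odot>\<^bsub>L\<^esub> v = l X)" if v: "v \<in> carrier L" for v
  proof -
    obtain x where x: "x \<in> carrier M" "lg x = v" using lg_surj[OF v] by blast
    obtain n :: nat where n: "n > 0" "x [^]\<^bsub>M\<^esub> n \<in> \<iota> ` carrier N" using \<iota>_root[OF x(1)] by blast
    then obtain X where X: "X \<in> carrier N" "x [^]\<^bsub>M\<^esub> n = \<iota> X" by blast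
    have "of_nat n \<odot>\<^bsub>L\<^esub> v = l X" using lg_pow[OF x(1), of n] x X by (simp add: l_def)
    then show ?thesis using n X by blast
  qed

  \<comment> \<open>The Lie automorphism induced by \<sigma>\<close>
  obtain \<tau> where \<tau>: "\<tau> \<in> iso M M" and \<tau>\<iota>: "\<And>X. X \<in> carrier N \<Longrightarrow> \<tau> (\<iota> X) = \<iota> (\<sigma> X)"
    and \<sigma>: "\<sigma> \<in> hom N N" "inj_on \<sigma> (carrier N)"
    and pi_like: "pi_like_automorphism \<pi> L (\<lambda>v. lg (\<tau> (inv_into (carrier M) lg v)))"
    using assms(8) by (auto simp: pi_like_endomorphism_def)
  define \<nu> where "\<nu> = (\<lambda>v. lg (\<tau> (inv_into (carrier M) lg v)))"
  have \<tau>_hom: "\<tau> \<in> hom M M" using \<tau> by (simp add: iso_def)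
  have \<nu>_lg: "\<nu> (lg x) = lg (\<tau> x)" if "x \<in> carrier M" for x
    using that inv_into_f_f[OF lg_inj] by (simp add: \<nu>_def)
  have fd: "fin_dim" and \<nu>_hom: "\<nu> \<in> LinearCombinations.module_hom class_ring L L"
    and \<nu>_bij: "bij_betw \<nu> (carrier L) (carrier L)" and f_coeff: "lin_char_poly L \<nu> \<in> Z_inv_poly \<pi>"
    using pi_like by (auto simp: pi_like_automorphism_def \<nu>_def Z_inv_poly_def)
  interpret nu: rat_operator L \<nu>
    using \<nu>_hom by unfold_locales (auto simp: LinearCombinations.module_hom_def)
  have \<nu>_bch: "\<nu> (bch L c v w) = bch L c (\<nu> v) (\<nu> w)" if vw: "v \<in> carrier L" "w \<in> carrier L" for v w
  proof -
    obtain x y where xy: "x \<in> carrier M" "y \<in> carrier M" "v = lg x" "w = lg y" using lg_surj vw by blast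
    have "\<nu> (lg (x \<otimes>\<^bsub>M\<^esub> y)) = lg (\<tau> x \<otimes>\<^bsub>M\<^esub> \<tau> y)"
      using \<nu>_lg[of "x \<otimes>\<^bsub>M\<^esub> y"] hom_mult[OF \<tau>_hom] xy by simp
    then show ?thesis using xy hom_in_carrier[OF \<tau>_hom] by (simp add: lg_mult \<nu>_lg)
  qed
  have \<nu>_bracket: "\<nu> \<lbrakk>v, w\<rbrakk>\<^bsub>L\<^esub> = \<lbrakk>\<nu> v, \<nu> w\<rbrakk>\<^bsub>L\<^esub>" if vw: "v \<in> carrier L" "w \<in> carrier L" for v w
  proof (rule bracket_eq_of_weight_2[OF c vw nu.f_closed[OF vw(1)] nu.f_closed[OF vw(2)] nu.rat_operator_axioms])
    show "\<nu> (bch L c (of_nat n \<odot>\<^bsub>L\<^esub> v) (of_nat n \<odot>\<^bsub>L\<^esub> w)) = bch L c (of_nat n \<odot>\<^bsub>L\<^esub> \<nu> v) (of_nat n \<odot>\<^bsub>L\<^esub> \<nu> w)"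
      for n using vw by (simp add: \<nu>_bch smult_closed' nu.f_smult)
  qed
  interpret lie_automorphism L \<nu>
    using \<nu>_bij \<nu>_bracket by unfold_locales auto

  \<comment> \<open>Scalars from the ring act on the logarithms of \<open>N\<close>\<close>
  have root: "\<exists>Y \<in> carrier N. l Y = (1 / of_nat n) \<odot>\<^bsub>L\<^esub> l X"
    if "n > 0" "pi_number \<pi> (int n)" "X \<in> carrier N" for n :: nat and X
    using that
  proof (induction n arbitrary: X rule: less_induct)
    case (less n)
    show ?case
    proof (cases "n = 1")
      case True
      then show ?thesis using less.prems by (intro bexI[of _ X]) (simp_all add: smult_1 l_closed)
    next
      case False
      \<comment> \<open>Divisibility provides roots for primes in \<pi> only, so one prime factor is
        removed at a time.\<close>
      then obtain p where p: "prime p" "p dvd n" using prime_factor_nat by blast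
      then obtain k where k: "n = p * k" by blast
      have "p \<in> \<pi>" using less.prems(2) p by (simp add: pi_number_def)
      then obtain Y where Y: "Y \<in> carrier N" "Y [^]\<^bsub>N\<^esub> p = X"
        using assms(5) less.prems(3) by (auto simp: pi_divisible_def)
      have "k < n" "k > 0" using k less.prems(1) prime_gt_1_nat[OF p(1)] by auto
      moreover have "pi_number \<pi> (int k)" using pi_number_dvd[OF less.prems(2)] k by simp
      ultimately obtain Z where Z: "Z \<in> carrier N" "l Z = (1 / of_nat k) \<odot>\<^bsub>L\<^esub> l Y"
        using less.IH Y(1) by blast
      have "(1 / of_nat n) \<odot>\<^bsub>L\<^esub> l X = (1 / of_nat n) \<odot>\<^bsub>L\<^esub> (of_nat p \<odot>\<^bsub>L\<^esub> l Y)" using l_pow[OF Y(1), of p] Y by simp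
      also have "\<dots> = (1 / of_nat k) \<odot>\<^bsub>L\<^esub> l Y"
        using l_closed[OF Y(1)] k less.prems(1) by (simp add: smult_smult)
      finally show ?thesis using Z by (intro bexI[of _ Z]) simp_all
    qed
  qed
  have l_Z_inv: "\<exists>Y \<in> carrier N. l Y = r \<odot>\<^bsub>L\<^esub> l X" if X: "X \<in> carrier N" and r: "r \<in> Z_inv \<pi>" for X r
  proof -
    obtain m n where mn: "r = of_int m / of_int n" "n \<noteq> 0" "pi_number \<pi> n" using r by (auto simp: Z_inv_def)
    define k where "k = nat \<bar>m\<bar>"
    have "pi_number \<pi> (int (nat \<bar>n\<bar>))" "nat \<bar>n\<bar> > 0" using mn by (simp_all add: pi_number_def)
    then obtain Z where Z: "Z \<in> carrier N" "l Z = (1 / of_nat (nat \<bar>n\<bar>)) \<odot>\<^bsub>L\<^esub> l X" using root X by blast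
    have Zk: "l (Z [^]\<^bsub>N\<^esub> k) = \<bar>r\<bar> \<odot>\<^bsub>L\<^esub> l X"
      using l_pow[OF Z(1), of k] Z l_closed[OF X] by (simp add: smult_smult mn k_def)
    show ?thesis
    proof (cases "r \<ge> 0")
      case True
      then show ?thesis using Zk Z by (intro bexI[of _ "Z [^]\<^bsub>N\<^esub> k"]) simp_all
    next
      case False
      have "l (inv\<^bsub>N\<^esub> (Z [^]\<^bsub>N\<^esub> k)) = (- \<bar>r\<bar>) \<odot>\<^bsub>L\<^esub> l X"
        using l_inv[of "Z [^]\<^bsub>N\<^esub> k"] Z l_closed[OF X] Zk by (simp add: smult_neg del: abs_of_neg)
      then show ?thesis using False Z by (intro bexI[of _ "inv\<^bsub>N\<^esub> (Z [^]\<^bsub>N\<^esub> k)"]) simp_all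
    qed
  qed
  have l_\<sigma>: "l (\<sigma> X) = \<nu> (l X)" if "X \<in> carrier N" for X
    using that \<tau>\<iota> by (simp add: l_def \<nu>_lg)
  interpret lattice_in_lie_algebra L \<nu> N c l \<sigma> \<pi>
    by unfold_locales (use c l_closed l_inj l_mult \<sigma> l_\<sigma> l_Z_inv in auto)

  \<comment> \<open>The centre of \<open>N\<close> corresponds to the centre of
    \<open>L\<close>\<close>
  have centre_l: "l Z \<in> U (Suc 0)" if Z: "Z \<in> centre N" for Z
  proof -
    have ZN: "Z \<in> carrier N" and comm: "\<And>X. X \<in> carrier N \<Longrightarrow> Z \<otimes>\<^bsub>N\<^esub> X = X \<otimes>\<^bsub>N\<^esub> Z"
      using Z by (auto simp: centre_def)
    have lZ: "l Z \<in> carrier L" using ZN by (rule l_closed)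
    \<comment> \<open>n-th powers of commuting elements commute. Comparing weight 2 with the
      identity operator shows that the bracket equals its negative.\<close>
    have zero: "\<lbrakk>l Z, l X\<rbrakk>\<^bsub>L\<^esub> = \<zero>\<^bsub>L\<^esub>" if X: "X \<in> carrier N" for X
    proof -
      have lX: "l X \<in> carrier L" using X by (rule l_closed)
      have "1 \<odot>\<^bsub>L\<^esub> \<lbrakk>l Z, l X\<rbrakk>\<^bsub>L\<^esub> = \<lbrakk>l X, l Z\<rbrakk>\<^bsub>L\<^esub>"
      proof (rule bracket_eq_of_weight_2[OF c lZ lX lX lZ])
        show "rat_operator L (\<lambda>v. 1 \<odot>\<^bsub>L\<^esub> v)"
          by unfold_locales (simp_all add: smult_1 smult_closed')
        fix n :: nat assume "n > 0"
        have "Z [^]\<^bsub>N\<^esub> n \<otimes>\<^bsub>N\<^esub> X [^]\<^bsub>N\<^esub> n = X [^]\<^bsub>N\<^esub> n \<otimes>\<^bsub>N\<^esub> Z [^]\<^bsub>N\<^esub> n"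
          using X ZN comm by (intro N.group_commutes_pow) auto
        then have "bch L c (of_nat n \<odot>\<^bsub>L\<^esub> l Z) (of_nat n \<odot>\<^bsub>L\<^esub> l X) = bch L c (of_nat n \<odot>\<^bsub>L\<^esub> l X) (of_nat n \<odot>\<^bsub>L\<^esub> l Z)"
          using l_mult[of "Z [^]\<^bsub>N\<^esub> n" "X [^]\<^bsub>N\<^esub> n"] l_mult[of "X [^]\<^bsub>N\<^esub> n" "Z [^]\<^bsub>N\<^esub> n"] X ZN by (simp add: l_pow)
        then show "1 \<odot>\<^bsub>L\<^esub> bch L c (of_nat n \<odot>\<^bsub>L\<^esub> l Z) (of_nat n \<odot>\<^bsub>L\<^esub> l X) = bch L c (of_nat n \<odot>\<^bsub>L\<^esub> l X) (of_nat n \<odot>\<^bsub>L\<^esub> l Z)"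
          using bch_closed lX lZ smult_closed' by (simp add: smult_1)
      qed
      moreover have "\<lbrakk>l X, l Z\<rbrakk>\<^bsub>L\<^esub> = (- 1) \<odot>\<^bsub>L\<^esub> \<lbrakk>l Z, l X\<rbrakk>\<^bsub>L\<^esub>"
        using bracket_swap[OF lX lZ] bracket_closed[OF lZ lX] by (simp add: smult_neg smult_1)
      ultimately have "(1 + 1) \<odot>\<^bsub>L\<^esub> \<lbrakk>l Z, l X\<rbrakk>\<^bsub>L\<^esub> = (1 + (- 1)) \<odot>\<^bsub>L\<^esub> \<lbrakk>l Z, l X\<rbrakk>\<^bsub>L\<^esub>"
        using bracket_closed[OF lZ lX] by (simp only: smult_add_left)
      then have "2 \<odot>\<^bsub>L\<^esub> \<lbrakk>l Z, l X\<rbrakk>\<^bsub>L\<^esub> = \<zero>\<^bsub>L\<^esub>" using bracket_closed[OF lZ lX] by (simp add: smult_0)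
      then show ?thesis using smult_eq_zeroD[OF bracket_closed[OF lZ lX], of 2] by simp
    qed
    have "\<lbrakk>l Z, v\<rbrakk>\<^bsub>L\<^esub> = \<zero>\<^bsub>L\<^esub>" if v: "v \<in> carrier L" for v
    proof -
      obtain n :: nat and X where n: "n > 0" "X \<in> carrier N" "of_nat n \<odot>\<^bsub>L\<^esub> v = l X" using l_full[OF v] by blast
      then have "of_nat n \<odot>\<^bsub>L\<^esub> \<lbrakk>l Z, v\<rbrakk>\<^bsub>L\<^esub> = \<zero>\<^bsub>L\<^esub>"
        using bracket_smult_right[OF lZ v, of "of_nat n"] zero[OF n(2)] by simp
      then show ?thesis using smult_eq_zeroD[OF bracket_closed[OF lZ v], of "of_nat n"] n(1) by simp
    qed
    then show ?thesis using lZ by simp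
  qed
  have l_mult_central: "l (Z \<otimes>\<^bsub>N\<^esub> X) = l Z \<oplus>\<^bsub>L\<^esub> l X"
    if ZX: "l Z \<in> U (Suc 0)" "Z \<in> carrier N" "X \<in> carrier N" for Z X
  proof -
    obtain z where "z \<in> U 0" "bch L c (l Z) (l X) = l Z \<oplus>\<^bsub>L\<^esub> l X \<oplus>\<^bsub>L\<^esub> z"
      using bch_upper_central[OF c ZX(1) l_closed[OF ZX(3)]] .
    then show ?thesis using ZX by (simp add: l_mult l_closed)
  qed
  have l_centre: "Z \<in> centre N" if Z: "Z \<in> carrier N" "l Z \<in> U (Suc 0)" for Z
  proof -
    have "Z \<otimes>\<^bsub>N\<^esub> X = X \<otimes>\<^bsub>N\<^esub> Z" if X: "X \<in> carrier N" for X
    proof -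
      \<comment> \<open>\<open>l_mult_central\<close> needs the central factor on the left; the
        product in the other order is reached as an inverse of a product of inverses.\<close>
      have "l (inv\<^bsub>N\<^esub> Z) \<in> U (Suc 0)" using upper_central_neg[OF Z(2)] l_inv[OF Z(1)] by simp
      then have "l (inv\<^bsub>N\<^esub> (inv\<^bsub>N\<^esub> Z \<otimes>\<^bsub>N\<^esub> inv\<^bsub>N\<^esub> X)) = l Z \<oplus>\<^bsub>L\<^esub> l X"
        using Z X l_closed by (simp add: l_inv l_mult_central minus_add)
      moreover have "inv\<^bsub>N\<^esub> (inv\<^bsub>N\<^esub> Z \<otimes>\<^bsub>N\<^esub> inv\<^bsub>N\<^esub> X) = X \<otimes>\<^bsub>N\<^esub> Z" using Z X by (simp add: N.inv_mult_group)
      ultimately have "l (X \<otimes>\<^bsub>N\<^esub> Z) = l (Z \<otimes>\<^bsub>N\<^esub> X)" using l_mult_central[OF Z(2,1) X] by simp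
      then show ?thesis using inj_onD[OF l_inj] Z X by simp
    qed
    then show ?thesis using Z by (simp add: centre_def)
  qed

  \<comment> \<open>The centre as an abelian group, and its tensor product with the
    rationals\<close>
  define A where "A = N\<lparr>carrier := centre N\<rparr>"
  have A_carrier: "carrier A = centre N" by (simp add: A_def)
  have centre_carrier: "centre N \<subseteq> carrier N" by (auto simp: centre_def)
  have "subgroup (centre N) N"
  proof (rule N.subgroupI[OF centre_carrier])
    have "\<one>\<^bsub>N\<^esub> \<in> centre N" by (simp add: centre_def)
    then show "centre N \<noteq> {}" by blast
    show "inv\<^bsub>N\<^esub> Z \<in> centre N" if Z: "Z \<in> centre N" for Z
    proof -
      have ZN: "Z \<in> carrier N" using Z centre_carrier by blast
      then show ?thesis using upper_central_neg[OF centre_l[OF Z]] by (intro l_centre) (simp_all only: l_inv N.inv_closed)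
    qed
    show "Z \<otimes>\<^bsub>N\<^esub> Z' \<in> centre N" if Z: "Z \<in> centre N" "Z' \<in> centre N" for Z Z'
    proof -
      have ZN: "Z \<in> carrier N" "Z' \<in> carrier N" using Z centre_carrier by blast+
      then show ?thesis using upper_central_add[OF centre_l[OF Z(1)] centre_l[OF Z(2)]] l_mult_central[OF centre_l[OF Z(1)] ZN]
        by (intro l_centre) (simp_all only: N.m_closed)
    qed
  qed
  then have "group A" unfolding A_def by (rule N.subgroup_imp_group)
  then have "comm_group A"
  proof (rule group.group_comm_groupI)
    fix x y assume "x \<in> carrier A" "y \<in> carrier A"
    then have "x \<in> centre N" "y \<in> carrier N" using centre_carrier unfolding A_carrier by blast+
    then have "x \<otimes>\<^bsub>N\<^esub> y = y \<otimes>\<^bsub>N\<^esub> x" unfolding centre_def by blast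
    then show "x \<otimes>\<^bsub>A\<^esub> y = y \<otimes>\<^bsub>A\<^esub> x" by (simp only: A_def) simp
  qed
  then interpret A: comm_group A .
  interpret tensor_operator L A l \<nu> \<sigma>
  proof unfold_locales
    fix a assume "a \<in> carrier A"
    then have a: "a \<in> centre N" "a \<in> carrier N" using centre_carrier by (auto simp: A_carrier)
    show "l a \<in> carrier L" using a by (simp add: l_closed)
    show "\<sigma> a \<in> carrier A" unfolding A_carrier
      using a upper_central_nu[OF centre_l[OF a(1)]] by (intro l_centre \<sigma>_closed) (simp_all only: l_\<sigma>)
    show "l (\<sigma> a) = \<nu> (l a)" using a by (simp add: l_\<sigma>)
    fix b assume "b \<in> carrier A"
    then have "b \<in> carrier N" using centre_carrier by (auto simp: A_carrier)
    then show "l (a \<otimes>\<^bsub>A\<^esub> b) = l a \<oplus>\<^bsub>L\<^esub> l b"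
      using l_mult_central[OF centre_l[OF a(1)] a(2)] by (simp add: A_def)
  next
    show "inj_on l (carrier A)" unfolding A_carrier by (rule inj_on_subset[OF l_inj centre_carrier])
  qed

  \<comment> \<open>Integrality on the centre, and surjectivity of \<sigma>\<close>
  define f where "f = lin_char_poly L \<nu>"
  have f: "f \<in> Z_inv_poly \<pi>" "lead_coeff f = 1" "\<And>v. v \<in> carrier L \<Longrightarrow> nu.pact f v = \<zero>\<^bsub>L\<^esub>"
  proof -
    show "f \<in> Z_inv_poly \<pi>" using f_coeff by (simp add: f_def)
    define F where "F = (SOME F. \<exists>bs. represents L \<nu> bs F)"
    have "\<exists>F bs. represents L \<nu> bs F" by (rule represents_exists[OF fd nu.f_closed]) blast+
    from someI_ex[OF this] obtain bs where bs: "represents L \<nu> bs F" unfolding F_def by blast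
    have fF: "f = char_poly F" by (simp add: f_def lin_char_poly_def F_def)
    have "F \<in> carrier_mat (length bs) (length bs)" using bs by (simp add: represents_def)
    then show "lead_coeff f = 1" unfolding fF using degree_monic_char_poly by metis
    show "nu.pact f v = \<zero>\<^bsub>L\<^esub>" if "v \<in> carrier L" for v
      unfolding fF by (rule nu.pact_char_poly[OF bs that])
  qed
  obtain B k where B: "B \<in> carrier_mat k k" "lin_det (tensor_rat A) (tensor_rat_map A \<sigma>) = det B"
    "\<And>a. a \<in> carrier A \<Longrightarrow> nu.pact (char_poly B) (l a) = \<zero>\<^bsub>L\<^esub>"
    "\<And>p. \<forall>v \<in> carrier L. nu.pact p v = \<zero>\<^bsub>L\<^esub> \<Longrightarrow> mat_poly B p = 0\<^sub>m k k"
    by (rule tensor_matrix[OF fd]) (rule that)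
  have p: "char_poly B \<in> Z_inv_poly \<pi>"
    by (rule char_poly_in_Z_inv_poly[OF B(1) B(4) f(2,1)]) (use f(3) in blast)
  have "inverse_integral \<pi> 0"
  proof -
    have "pi_unit \<pi> (det B)" using assms(9) B(2) by (simp add: det_on_centre_def Let_def A_def)
    then obtain r where r: "r \<in> Z_inv \<pi>" "det B * r = 1" by (auto simp: pi_unit_def)
    \<comment> \<open>The constant term is the determinant of minus \<open>B\<close>, hence det B up
      to the sign \<open>(- 1) ^ k\<close>, which is its own inverse.\<close>
    have "coeff (char_poly B) 0 = poly (char_poly B) 0" by (simp add: poly_0_coeff_0)
    also have "\<dots> = det (- char_matrix B 0)" by (rule char_poly_matrix[OF B(1)])
    also have "- char_matrix B 0 = (- 1) \<cdot>\<^sub>m B" using B(1) by (intro eq_matI) (auto simp: char_matrix_def)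
    also have "det \<dots> = (- 1) ^ k * det B" using B(1) by simp
    finally have "coeff (char_poly B) 0 * ((- 1) ^ k * r) = ((- 1) ^ k * (- 1) ^ k) * (det B * r)" by simp
    also have "\<dots> = 1" using r(2) by (simp add: power_mult_distrib[symmetric])
    finally have unit: "coeff (char_poly B) 0 * ((- 1) ^ k * r) = 1" .
    have "(- 1) ^ k * r \<in> Z_inv \<pi>" using r(1) by (cases "even k") (auto intro: Z_inv_uminus)
    then show ?thesis
    proof (rule inverse_integral_0[OF p unit])
      fix v assume v: "v \<in> U (Suc 0)"
      then have vL: "v \<in> carrier L" by (rule upper_central_closed)
      \<comment> \<open>Cayley-Hamilton is available for logarithms of central elements; a positive
        multiple of \<open>v\<close> is one of them.\<close>
      obtain n :: nat and X where n: "n > 0" "X \<in> carrier N" "of_nat n \<odot>\<^bsub>L\<^esub> v = l X" using l_full[OF vL] by blast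
      have "l X \<in> U (Suc 0)" using upper_central_smult[OF v, of "of_nat n"] n(3) by simp
      then have "X \<in> carrier A" using l_centre[OF n(2)] by (simp add: A_carrier)
      then have "of_nat n \<odot>\<^bsub>L\<^esub> nu.pact (char_poly B) v = \<zero>\<^bsub>L\<^esub>"
        using B(3)[of X] n(3) nu.pact_smult_vec[OF vL, of "char_poly B" "of_nat n"] by simp
      then show "nu.pact (char_poly B) v = \<zero>\<^bsub>L\<^esub>"
        using smult_eq_zeroD[OF nu.pact_closed[OF vL], of "of_nat n"] n(1) by simp
    qed
  qed
  then have "inverse_integral \<pi> j" for j
    by (induction j) (use f inverse_integral_Suc in blast)+
  then have "carrier N \<subseteq> \<sigma> ` carrier N"
    using preimage_exists[of _ c] upper_central_eq_carrier[OF c] l_closed by blast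
  then have "\<sigma> ` carrier N = carrier N" using \<sigma>_closed by blast
  then show ?thesis using \<sigma> by (simp add: iso_def bij_betw_def)
qed

end
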